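(* Let $q=p^r$ be a prime power ($p$ prime), let $n\ge1$, and let $M$ be chosen uniformly at random from the finite unitary group $\mathrm{U}(n,q)$. Fix a strictly increasing sequence $b_1<\cdots<b_k$ of positive integers, each coprime to $p$. Then for any $a_1,\ldots,a_k\in\mathbb{F}_{q^2}$, $$\left|\mathbb{P}_{M\in \mathrm{U}(n,q)}\big(\forall\, 1\le i\le k:\ \mathrm{Tr}(M^{b_i})=a_i\big)-(q^2)^{-k}\right|\le q^{-\frac{n^2}{4b_k}}\,q^{\frac n2}\Big(1+\frac{1}{q-1}\Big)^n\binom{n-1+2b_k}{n}.$$
   Context: $\mathrm{U}(n,q)=\{M\in\mathrm{GL}(n,\mathbb{F}_{q^2}) : M\overline{M}^t=I_n\}$, where $\overline{M}$ is obtained from $M$ by raising every entry to the $q$-th power and $t$ denotes transpose. "Uniformly at random" is Haar probability measure on this finite group. *)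

theory Defs
  imports "HOL-Analysis.Analysis"
begin

primrec matrix_pow :: "'a::semiring_1^'n^'n \<Rightarrow> nat \<Rightarrow> 'a^'n^'n" where
  "matrix_pow M 0 = mat 1"
| "matrix_pow M (Suc m) = M ** matrix_pow M m"

text \<open>Conjugate transpose over F_{q^2}: raise entries to the q-th power and transpose.\<close>
definition conj_transpose :: "nat \<Rightarrow> 'a::field^'n^'n \<Rightarrow> 'a^'n^'n" where
  "conj_transpose q M = (\<chi> i j. (M $ j $ i) ^ q)"

definition unitary_group :: "nat \<Rightarrow> ('a::field^'n^'n) set" where
  "unitary_group q = {M. invertible M \<and> M ** conj_transpose q M = mat 1}"

end

theory Submission
  imports Defs "HOL-Library.Function_Algebras" "HOL-Computational_Algebra.Computational_Algebra" "HOL-Number_Theory.Cong"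
begin

text \<open>
  Expanding in additive characters, one has to bound the average \<open>E n\<close> over \<open>U(n,q)\<close> of
  \<open>\<psi>(\<Sum> c_i Tr(M^{b_i}))\<close> for \<open>c \<noteq> 0\<close>. Let \<open>L(u)\<close> be the generating function, over the monic polynomials
  \<open>G\<close> that agree with their conjugate reversal, of \<open>\<psi>(\<Sum> c_i p_{b_i}(G))\<close>, where \<open>p_b\<close> is the \<open>b\<close>-th
  power sum of the roots, and let \<open>A(u) = \<Sum> E n u^n\<close>. The core is the identity \<open>A(q^2 u) = L(qu) A(-qu)\<close>.

  To obtain it, sum \<open>\<psi>(\<dots>) w(\<langle>v,v\<rangle>)\<close> over all \<open>M\<close> and all vectors \<open>v\<close>, once with \<open>w = 1\<close> and once with a
  nontrivial character \<open>w = \<phi>\<close> of the field with \<open>q\<close> elements; this gives \<open>q^{2n} E n\<close> and, by a Gauss sum, \<open>(-q)^n E n\<close>.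
  The pairs \<open>(M,v)\<close> are classified by the minimal polynomial \<open>F\<close> of \<open>v\<close> and by the sequence \<open>s_j = \<langle>v, M^j v\<rangle>\<close>.
  If \<open>s\<close> has minimal polynomial \<open>D\<close>, of degree \<open>d\<close>, and \<open>F = B D\<close> with \<open>deg B = r\<close>, then the radical of the cyclic
  space of \<open>v\<close> has dimension \<open>r\<close>, and by extension of isometries the pairs of this type contribute
  \<open>|U(n,q)|\<close> times a factor depending on \<open>B\<close> and \<open>D\<close> times \<open>E (n - 2r - d)\<close>. So both sums have generating functions
  \<open>\<beta> \<nu>_w A\<close> with a common \<open>\<beta>\<close>, and counting Hermitian solutions of recurrences
  gives \<open>\<nu>_1 L = L(qu)\<close> and \<open>\<nu>_\<phi> L = 1\<close>.

  The coefficients of \<open>L\<close> are majorised by those of \<open>(1 + qu)^{2 b_k}\<close>, so \<open>E\<close> is majorised by the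
  coefficients of the \<open>2 b_k\<close>-th power of \<open>\<Prod>_{i \<ge> 0} (1 + u q^{-i})\<close>, which Euler's identity makes explicit.
\<close>


section \<open>Finite fields with a square number of elements\<close>

text \<open>Neither of the two sums suffices alone, because \<open>\<beta>\<close>, which collects
  the radicals, is as unknown as \<open>A\<close>. The weights change only \<open>\<nu>_w\<close>,
  so multiplying by \<open>L\<close> lets one sum express \<open>\<beta> A\<close> and the other
  then yields an equation for \<open>A\<close> alone. That \<open>\<nu>_\<phi> L = 1\<close>
  reflects that \<open>s 0\<close> is equidistributed in the field with \<open>q\<close> elements
  over the Hermitian solutions of a recurrence of positive order. If \<open>J\<close> is the last
  index with \<open>c_J\<close> nonzero, then \<open>L\<close> has degree at most
  \<open>2 b_J\<close>: given the higher coefficients of \<open>G\<close>, the power sum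
  \<open>p_{b_J}\<close> is linear with slope \<open>- b_J\<close> in one coefficient that can be
  varied freely. The slope is nonzero because \<open>b_J\<close> is coprime to \<open>p\<close>. The
  constants come from the power with exponent \<open>N = 2 b_k\<close>. Its \<open>n\<close>-th
  coefficient is a sum over the ways to write \<open>n = n_1 + ... + n_N\<close>, which the binomial
  coefficient counts. Each term is at most \<open>q^{n/2} (1 + 1/(q-1))^n\<close> times
  \<open>q\<close> to the power \<open>- (n_1^2 + ... + n_N^2) / 2\<close>, and the sum of squares
  is at least \<open>n^2 / N\<close>; this is the exponent \<open>n^2 / (4 b_k)\<close>.\<close>

lemma finite_field_power_CARD: "x ^ CARD('a) = (x :: 'a::{finite,field})"
proof (cases "x = 0")
  case False
  have "x * (\<Prod>y\<in>UNIV-{0}. x * y) = x * x ^ (CARD('a) - 1) * \<Prod>(UNIV-{0})"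
    by (simp add: prod.distrib mult_ac)
  also have "x * x ^ (CARD('a) - 1) = x ^ Suc (CARD('a) - 1)"
    by (subst power_Suc) auto
  also have "Suc (CARD('a) - 1) = CARD('a)"
    by simp
  also have "(\<Prod>y\<in>UNIV-{0}. x * y) = (\<Prod>y\<in>UNIV-{0}. y)"
    by (rule prod.reindex_bij_witness[of _ "\<lambda>y. y / x" "\<lambda>y. x * y"]) (use False in auto)
  finally show ?thesis
    by simp
qed auto

text \<open>Translation by 1 permutes the field, so the sum of all elements equals itself plus
  \<open>CARD('a)\<close> times 1.\<close>

lemma CHAR_dvd_CARD: "CHAR('a::{finite,field}) dvd CARD('a)"
proof -
  have "(\<Sum>x\<in>(UNIV::'a set). x) = (\<Sum>x\<in>UNIV. x + 1)"
    by (rule sum.reindex_bij_witness[of _ "\<lambda>x. x + 1" "\<lambda>x. x - 1"]) auto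
  then have "of_nat CARD('a) = (0::'a)" by (simp add: sum.distrib)
  then show ?thesis by (simp add: of_nat_eq_0_iff_char_dvd)
qed

text \<open>Translation by \<open>s\<close> multiplies the sum by \<open>\<psi> s\<close>. The set
  \<open>A\<close> is a parameter because the lemma is applied to the subfield \<open>Fq\<close> and
  to \<open>HSol G\<close> as well as to the whole field.\<close>

lemma sum_additive_char_eq_0:
  fixes \<psi> :: "'b::ab_group_add \<Rightarrow> complex"
  assumes "finite A" "\<And>x y. x \<in> A \<Longrightarrow> y \<in> A \<Longrightarrow> x + y \<in> A" "\<And>x y. x \<in> A \<Longrightarrow> y \<in> A \<Longrightarrow> \<psi> (x + y) = \<psi> x * \<psi> y"
    and "s \<in> A" "- s \<in> A" "\<psi> s \<noteq> 1"
  shows "(\<Sum>x\<in>A. \<psi> x) = 0"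
proof -
  have "(\<Sum>x\<in>A. \<psi> x) = (\<Sum>x\<in>A. \<psi> (s + x))"
    by (rule sum.reindex_bij_witness[of _ "\<lambda>x. s + x" "\<lambda>x. - s + x"])
      (use assms(4,5) in \<open>auto intro: assms(2) simp del: uminus_add_conv_diff\<close>)
  also have "\<dots> = \<psi> s * (\<Sum>x\<in>A. \<psi> x)"
    using assms by (simp add: sum_distrib_left)
  finally have "(1 - \<psi> s) * (\<Sum>x\<in>A. \<psi> x) = 0" by (simp add: algebra_simps)
  then show ?thesis using assms by simp
qed

locale hermitian_field =
  fixes p rr q :: nat and ty :: "'a::{finite,field} itself"
  assumes prime_p: "prime p" and r_pos: "rr \<ge> 1" and q_def: "q = p ^ rr"
    and card_field: "CARD('a) = q ^ 2"
begin

lemma q_ge_2: "q \<ge> 2"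
proof -
  have "p ^ 1 \<le> p ^ rr" using prime_p r_pos by (intro power_increasing) (use prime_gt_0_nat[OF prime_p] in auto)
  then show ?thesis using prime_ge_2_nat[OF prime_p] q_def by simp
qed

lemma CHAR_eq: "CHAR('a) = p"
proof -
  have pr: "prime CHAR('a)"
    by (intro prime_CHAR_semidom finite_imp_CHAR_pos) auto
  have "CHAR('a) dvd p ^ (rr * 2)"
    using CHAR_dvd_CARD[where ?'a = 'a] card_field q_def by (simp add: power_mult)
  then show ?thesis
    using pr prime_p prime_dvd_power primes_dvd_imp_eq by blast
qed

definition cj :: "'a \<Rightarrow> 'a" where "cj x = x ^ q"

lemma cj_add [simp]: "cj (x + y) = cj x + cj y"
  unfolding cj_def by (rule freshmans_dream'[of _ rr]) (simp_all add: CHAR_eq prime_p q_def)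

lemma cj_0 [simp]: "cj 0 = 0" and cj_1 [simp]: "cj 1 = 1"
  and cj_mult [simp]: "cj (x * y) = cj x * cj y"
  and cj_power [simp]: "cj (x ^ m) = cj x ^ m"
  using q_ge_2 by (auto simp: cj_def power_mult_distrib power_0_left simp flip: power_mult) (simp add: mult.commute)

lemma cj_cj [simp]: "cj (cj x) = x"
  using finite_field_power_CARD[of x] by (simp add: cj_def card_field power2_eq_square power_mult)

lemma cj_minus [simp]: "cj (- x) = - cj x"
  using cj_add[of x "- x"] by (simp del: cj_add add: eq_neg_iff_add_eq_0 add.commute)

lemma cj_diff [simp]: "cj (x - y) = cj x - cj y"
  using cj_add[of x "- y"] by simp

lemma cj_inverse [simp]: "cj (inverse x) = inverse (cj x)"
  by (simp add: cj_def power_inverse)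

lemma cj_divide [simp]: "cj (x / y) = cj x / cj y"
  by (simp add: divide_inverse)

lemma cj_sum [simp]: "cj (sum f A) = (\<Sum>x\<in>A. cj (f x))"
  by (induction A rule: infinite_finite_induct) auto

lemma cj_eq_iff [simp]: "cj x = cj y \<longleftrightarrow> x = y"
  by (metis cj_cj)

lemma cj_eq_0_iff [simp]: "cj x = 0 \<longleftrightarrow> x = 0"
  using cj_eq_iff[of x 0] by simp

definition Fq :: "'a set" where "Fq = {x. cj x = x}"

section \<open>Trace and norm onto the subfield with q elements\<close>

lemma card_roots_le:
  fixes P :: "'a poly"
  assumes "coeff P (degree P) = 1" "degree P = m" "\<And>x. x \<in> A \<Longrightarrow> poly P x = 0"
  shows "card A \<le> m"
proof -
  have "P \<noteq> 0" using assms(1) by auto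
  then have "card {x. poly P x = 0} \<le> m" using card_poly_roots_bound assms by metis
  moreover have "card A \<le> card {x. poly P x = 0}" using assms by (intro card_mono) auto
  ultimately show ?thesis by linarith
qed

lemma card_pow_eq_le:
  assumes "m > 0" shows "card {x::'a. x ^ m = c} \<le> m"
proof (rule card_roots_le)
  show "degree (monom 1 m + [:- c:]) = m"
    using assms by (subst degree_add_eq_left) (auto simp: degree_monom_eq)
  then show "coeff (monom 1 m + [:- c:]) (degree (monom 1 m + [:- c:])) = 1"
    using assms by (auto simp: coeff_pCons split: nat.splits)
qed (auto simp: poly_monom)

lemma card_pow_linear_le:
  assumes "m > 1" shows "card {x::'a. x ^ m = c * x} \<le> m"
proof (rule card_roots_le)
  show "degree (monom 1 m + [:0, - c:]) = m"
    using assms by (subst degree_add_eq_left) (auto simp: degree_monom_eq intro: le_less_trans[OF degree_pCons_le])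
  then show "coeff (monom 1 m + [:0, - c:]) (degree (monom 1 m + [:0, - c:])) = 1"
    using assms by (auto simp: coeff_pCons split: nat.splits)
qed (auto simp: poly_monom mult.commute)

lemma Fq_trace: "x + cj x \<in> Fq" and Fq_norm: "x * cj x \<in> Fq"
  by (auto simp: Fq_def add.commute mult.commute)

text \<open>A nonempty fibre is a coset of the kernel, whose elements are roots of
  \<open>x ^ q + x\<close>.\<close>

lemma card_trace_fibre:
  "card {x. x + cj x = y} \<le> q"
proof (cases "\<exists>x. x + cj x = y")
  case True
  then obtain x0 where x0: "x0 + cj x0 = y" by auto
  have "{x. x + cj x = y} = (+) x0 ` {x. x ^ q = (-1) * x}"
  proof (intro equalityI subsetI)
    fix x assume "x \<in> {x. x + cj x = y}"
    then have "x + cj x = y" by simp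
    then have "cj x = x0 + cj x0 - x" using x0 by (simp add: eq_diff_eq add.commute)
    then have "cj (x - x0) = - (x - x0)" by simp
    then show "x \<in> (+) x0 ` {x. x ^ q = (-1) * x}"
      by (intro image_eqI[of _ _ "x - x0"]) (auto simp: cj_def)
  next
    fix x assume "x \<in> (+) x0 ` {x. x ^ q = (-1) * x}"
    then obtain z where z: "x = x0 + z" "cj z = - z" by (auto simp: cj_def)
    then show "x \<in> {x. x + cj x = y}" using x0 by (simp add: algebra_simps)
  qed
  then have "card {x. x + cj x = y} \<le> card {x::'a. x ^ q = (-1) * x}"
    by (simp only: card_image_le finite)
  also have "\<dots> \<le> q" using card_pow_linear_le q_ge_2 by (metis Suc_1 less_eq_Suc_le)
  finally show ?thesis .
qed auto

lemma card_Fq_le: "card Fq \<le> q"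
  unfolding Fq_def cj_def using card_pow_linear_le[of q 1] q_ge_2 by simp

text \<open>One double count gives both facts: \<open>q * q\<close> elements lie over the image in
  fibres of at most \<open>q\<close>, so the image has at least \<open>q\<close> elements, while
  \<open>Fq\<close>, which contains it, has at most \<open>q\<close>.\<close>

lemma card_Fq: "card Fq = q"
  and trace_surj: "y \<in> Fq \<Longrightarrow> \<exists>x. x + cj x = y"
proof -
  define I where "I = range (\<lambda>x. x + cj x)"
  have sub: "I \<subseteq> Fq" using Fq_trace by (auto simp: I_def)
  have "q * q = card (UNIV :: 'a set)" by (simp add: card_field power2_eq_square)
  also have "\<dots> = (\<Sum>y\<in>I. card {x. x + cj x = y})"
    using sum.group[of "UNIV::'a set" I "\<lambda>x. x + cj x" "\<lambda>_. 1::nat"] by (simp add: I_def)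
  also have "\<dots> \<le> card I * q"
    using sum_bounded_above[of I _ q] card_trace_fibre by auto
  finally have "q \<le> card I" using q_ge_2 by simp
  then have "card I = card Fq" using card_Fq_le card_mono[OF _ sub] by simp
  then have "I = Fq" using sub by (intro card_subset_eq) auto
  show "\<exists>x. x + cj x = y" if "y \<in> Fq"
  proof -
    have "y \<in> I" using that \<open>I = Fq\<close> by simp
    then show ?thesis by (auto simp: I_def)
  qed
  show "card Fq = q" using \<open>card I = card Fq\<close> \<open>q \<le> card I\<close> card_Fq_le by simp
qed

lemma Fq_0 [simp]: "0 \<in> Fq" and Fq_1 [simp]: "1 \<in> Fq"
  and Fq_add: "x \<in> Fq \<Longrightarrow> y \<in> Fq \<Longrightarrow> x + y \<in> Fq"
  and Fq_minus: "x \<in> Fq \<Longrightarrow> - x \<in> Fq"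
  and Fq_inverse: "x \<in> Fq \<Longrightarrow> inverse x \<in> Fq"
  by (auto simp: Fq_def)

text \<open>Exact size by saturation: the \<open>q ^ 2 - 1\<close> nonzero elements lie over
  \<open>q - 1\<close> norms in fibres of at most \<open>q + 1\<close>, so one smaller fibre would
  make the total too small.\<close>

lemma card_norm_fibre:
  assumes "y \<in> Fq" "y \<noteq> 0" shows "card {x. x * cj x = y} = q + 1"
proof (rule ccontr)
  assume ne: "\<not> ?thesis"
  have le: "card {x. x * cj x = c} \<le> q + 1" for c
    using card_pow_eq_le[of "q + 1" c] by (simp add: cj_def)
  have "q * q - 1 = card (UNIV - {0} :: 'a set)" by (simp add: card_field power2_eq_square)
  also have "\<dots> = (\<Sum>c\<in>Fq - {0}. card {x \<in> UNIV - {0}. x * cj x = c})"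
    using sum.group[of "UNIV - {0::'a}" "Fq - {0}" "\<lambda>x. x * cj x" "\<lambda>_. 1::nat"] Fq_norm by force
  also have "\<dots> = (\<Sum>c\<in>Fq - {0}. card {x. x * cj x = c})"
    by (intro sum.cong arg_cong[where f = card]) auto
  also have "\<dots> < (\<Sum>c\<in>Fq - {0}. q + 1)"
    using assms ne le by (intro sum_strict_mono_ex1) (auto simp: le_less)
  also have "\<dots> = (q - 1) * (q + 1)" using card_Fq by (simp add: card_Diff_singleton)
  also have "\<dots> = q * q - 1" by (simp add: algebra_simps diff_mult_distrib)
  finally show False by simp
qed

lemma norm_surj: "y \<in> Fq \<Longrightarrow> \<exists>x. x * cj x = y"
proof (cases "y = 0")
  case False
  assume "y \<in> Fq"
  then have "{x. x * cj x = y} \<noteq> {}" using card_norm_fibre[OF _ False] by force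
  then show ?thesis by auto
qed auto

lemma ex_not_in_Fq: "\<exists>\<theta>. \<theta> \<notin> Fq"
proof (rule ccontr)
  assume "\<not> ?thesis"
  then have "Fq = UNIV" by auto
  then show False using card_Fq card_field q_ge_2 by (simp add: power2_eq_square)
qed

section \<open>Additive characters through the absolute trace\<close>

lemma fixed_by_p_eq_of_nat:
  assumes "(y::'a) ^ p = y" shows "\<exists>j<p. of_nat j = y"
proof -
  have p1: "p > 1" using prime_p prime_gt_1_nat by blast
  let ?R = "of_nat ` {..<p} :: 'a set"
  have "inj_on (of_nat :: nat \<Rightarrow> 'a) {..<p}"
    by (auto simp: inj_on_def of_nat_eq_iff_cong_CHAR CHAR_eq cong_def)
  then have card: "card ?R = p" by (simp add: card_image)
  have "(of_nat j :: 'a) ^ p = of_nat j" for j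
  proof (induction j)
    case 0
    show ?case using p1 by (simp add: power_0_left)
  next
    case (Suc j)
    have "(1 + of_nat j :: 'a) ^ p = 1 ^ p + of_nat j ^ p"
      by (rule freshmans_dream) (simp_all add: CHAR_eq prime_p)
    then show ?case using Suc by (simp only: of_nat_Suc power_one)
  qed
  then have "?R \<subseteq> {x. x ^ p = 1 * x}" by auto
  moreover have "card {x::'a. x ^ p = 1 * x} \<le> p" using card_pow_linear_le p1 by blast
  ultimately have "?R = {x. x ^ p = 1 * x}"
    using card by (metis card_seteq finite)
  then have "y \<in> ?R" using assms by simp
  then show ?thesis by auto
qed

text \<open>The trace down to the prime field: the field has \<open>p ^ (2 * rr)\<close> elements,
  so the Frobenius conjugates are indexed by \<open>i < 2 * rr\<close>.\<close>

definition abs_trace :: "'a \<Rightarrow> 'a" where "abs_trace x = (\<Sum>i<2 * rr. x ^ (p ^ i))"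

lemma abs_trace_add: "abs_trace (x + y) = abs_trace x + abs_trace y"
  unfolding abs_trace_def sum.distrib[symmetric]
  by (intro sum.cong refl freshmans_dream') (auto simp: CHAR_eq prime_p)

lemma abs_trace_power: "abs_trace x ^ p = abs_trace x"
proof -
  have "abs_trace x ^ p = (\<Sum>i<2 * rr. x ^ (p ^ Suc i))"
    unfolding abs_trace_def by (subst freshmans_dream_sum) (auto simp: CHAR_eq prime_p mult.commute simp flip: power_mult)
  also have "\<dots> + x ^ (p ^ 0) = (\<Sum>i<Suc (2 * rr). x ^ (p ^ i))"
    by (subst sum.lessThan_Suc_shift) simp
  also have "\<dots> = abs_trace x + x ^ (p ^ (2 * rr))" by (simp add: abs_trace_def)
  also have "x ^ (p ^ (2 * rr)) = x"
    using finite_field_power_CARD[of x] by (simp add: card_field q_def power_mult[symmetric] mult.commute)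
  finally show ?thesis by simp
qed

text \<open>As a polynomial the trace has degree \<open>p ^ (2 * rr - 1)\<close>, too small to
  vanish on all \<open>p ^ (2 * rr)\<close> elements.\<close>

lemma abs_trace_nonzero: "\<exists>x. abs_trace x \<noteq> 0"
proof (rule ccontr)
  assume "\<not> ?thesis"
  then have z: "abs_trace x = 0" for x by auto
  have p1: "p > 1" using prime_p prime_gt_1_nat by blast
  obtain m where m: "2 * rr = Suc m" using r_pos by (cases "2 * rr") auto
  define P :: "'a poly" where "P = monom 1 (p ^ m) + (\<Sum>i<m. monom 1 (p ^ i))"
  have d: "degree (\<Sum>i<m. monom 1 (p ^ i) :: 'a poly) < p ^ m"
  proof (cases "m = 0")
    case False
    show ?thesis
      by (rule degree_sum_less) (use p1 in \<open>auto simp: degree_monom_eq power_strict_increasing\<close>)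
  qed auto
  have dP: "degree P = p ^ m"
    unfolding P_def using d by (subst degree_add_eq_left) (auto simp: degree_monom_eq)
  moreover have "coeff P (degree P) = 1"
    unfolding dP unfolding P_def using d by (simp add: coeff_eq_0 del: coeff_sum)
  moreover have "poly P x = 0" for x
    using z[of x] by (simp add: P_def poly_monom poly_sum abs_trace_def m add.commute)
  ultimately have "card (UNIV::'a set) \<le> p ^ m" by (intro card_roots_le) auto
  moreover have "card (UNIV::'a set) = p ^ Suc m" by (simp add: card_field q_def power_mult[symmetric] mult.commute m[symmetric])
  moreover have "p ^ m < p ^ Suc m" using p1 by simp
  ultimately show False by linarith
qed

lemma ex_additive_char:
  "\<exists>\<psi> :: 'a \<Rightarrow> complex. (\<forall>x y. \<psi> (x + y) = \<psi> x * \<psi> y) \<and> (\<forall>x. norm (\<psi> x) = 1) \<and> (\<exists>x. \<psi> x \<noteq> 1)"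
proof -
  have p1: "p > 1" using prime_p prime_gt_1_nat by blast
  \<comment> \<open>The trace lies in the prime field and is lifted to a representative below
    \<open>p\<close>, so that it can be put into a complex exponential.\<close>
  define \<iota> where "\<iota> x = (SOME j. j < p \<and> of_nat j = abs_trace x)" for x
  have \<iota>: "\<iota> x < p" "of_nat (\<iota> x) = abs_trace x" for x
    using someI_ex[OF fixed_by_p_eq_of_nat[OF abs_trace_power[of x]]] by (auto simp: \<iota>_def)
  define \<psi> where "\<psi> x = cis (2 * pi * real (\<iota> x) / real p)" for x
  have "\<psi> (x + y) = \<psi> x * \<psi> y" for x y
  proof -
    have "(of_nat (\<iota> (x + y)) :: 'a) = of_nat (\<iota> x + \<iota> y)"
      by (simp add: \<iota> abs_trace_add)
    then have "[\<iota> (x + y) = \<iota> x + \<iota> y] (mod p)"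
      by (simp only: of_nat_eq_iff_cong_CHAR CHAR_eq)
    then have "(\<iota> x + \<iota> y) mod p = \<iota> (x + y)" using \<iota>(1)[of "x + y"] by (simp add: cong_def)
    then obtain k where k: "\<iota> x + \<iota> y = \<iota> (x + y) + p * k" by (metis mod_mult_div_eq)
    have "\<psi> x * \<psi> y = cis (2 * pi * real (\<iota> x + \<iota> y) / real p)"
      by (simp add: \<psi>_def cis_mult add_divide_distrib distrib_left)
    also have "2 * pi * real (\<iota> x + \<iota> y) / real p = 2 * pi * real (\<iota> (x + y)) / real p + 2 * pi * real k"
      using p1 unfolding k by (simp add: field_simps)
    also have "cis \<dots> = \<psi> (x + y)"
      by (simp add: \<psi>_def cis_mult[symmetric] cis_multiple_2pi)
    finally show ?thesis by simp
  qed
  moreover obtain x where "abs_trace x \<noteq> 0" using abs_trace_nonzero by blast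
  then have "\<iota> x \<noteq> 0" using \<iota>(2)[of x] by (metis of_nat_0)
  have "\<psi> x \<noteq> 1"
  proof
    assume "\<psi> x = 1"
    then have "cos (2 * pi * real (\<iota> x) / real p) = 1" by (simp add: \<psi>_def complex_eq_iff)
    then obtain k :: int where "2 * pi * real (\<iota> x) / real p = of_int k * 2 * pi"
      by (auto simp: cos_one_2pi_int)
    then have "real (\<iota> x) = of_int k * real p" using p1 by (simp add: field_simps)
    then have "int (\<iota> x) = k * int p" by (metis of_int_eq_iff of_int_mult of_int_of_nat_eq)
    then have "int p dvd int (\<iota> x)" by simp
    then have "p dvd \<iota> x" by simp
    then show False using \<iota>(1)[of x] \<open>\<iota> x \<noteq> 0\<close> by (simp add: nat_dvd_not_less)
  qed
  ultimately show ?thesis by (intro exI[of _ \<psi>]) (auto simp: \<psi>_def)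
qed

end

section \<open>Hermitian forms over finite fields\<close>

definition smul :: "'k::field \<Rightarrow> ('i \<Rightarrow> 'k) \<Rightarrow> 'i \<Rightarrow> 'k" where
  "smul c x = (\<lambda>i. c * x i)"

lemma smul_apply [simp]: "smul c x i = c * x i"
  by (simp add: smul_def)

lemma sum_fun_apply [simp]: "(sum f A) i = (\<Sum>x\<in>A. f x i)"
  by (induction A rule: infinite_finite_induct) auto

lemma smul_simps [simp]: "smul 0 x = 0" "smul c 0 = 0" "smul 1 x = x" "smul a (smul b x) = smul (a * b) x"
  by (auto simp: fun_eq_iff)

lemma smul_add_right: "smul c (x + y) = smul c x + smul c y"
  and smul_add_left: "smul (a + b) x = smul a x + smul b x"
  and smul_diff_right: "smul c (x - y) = smul c x - smul c y"
  and smul_diff_left: "smul (a - b) x = smul a x - smul b x"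
  and smul_minus_left: "smul (- a) x = - smul a x"
  by (auto simp: fun_eq_iff algebra_simps)

lemma smul_sum_right: "smul c (sum f A) = (\<Sum>i\<in>A. smul c (f i))"
  by (auto simp: fun_eq_iff sum_distrib_left)

interpretation fun_vs: vector_space "smul :: 'k::field \<Rightarrow> ('i \<Rightarrow> 'k) \<Rightarrow> 'i \<Rightarrow> 'k"
  by unfold_locales (auto simp: fun_eq_iff algebra_simps)

interpretation field_vs: vector_space "(*) :: 'k::field \<Rightarrow> 'k \<Rightarrow> 'k"
  by unfold_locales (auto simp: algebra_simps)

interpretation functionals: vector_space_pair "smul :: 'k::field \<Rightarrow> ('i \<Rightarrow> 'k) \<Rightarrow> 'i \<Rightarrow> 'k" "(*) :: 'k \<Rightarrow> 'k \<Rightarrow> 'k"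
  by unfold_locales

text \<open>Spaces of every dimension live in one type of sequences, because the argument passes
  from dimension \<open>n\<close> to \<open>n - (2 * r + d)\<close>.\<close>

definition V :: "nat \<Rightarrow> (nat \<Rightarrow> 'k::zero) set" where "V n = {x. \<forall>i\<ge>n. x i = 0}"

definition tr :: "nat \<Rightarrow> (nat \<Rightarrow> 'k::zero) \<Rightarrow> nat \<Rightarrow> 'k" where "tr n x = (\<lambda>i. if i < n then x i else 0)"

definition ax :: "nat \<Rightarrow> nat \<Rightarrow> 'k::zero_neq_one" where "ax i = (\<lambda>j. if j = i then 1 else 0)"

lemma V_D: "x \<in> V n \<Longrightarrow> n \<le> i \<Longrightarrow> x i = 0"
  by (auto simp: V_def)

lemma V_zero [simp]: "(0 :: nat \<Rightarrow> 'k::field) \<in> V n"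
  and V_add [intro]: "x \<in> V n \<Longrightarrow> y \<in> V n \<Longrightarrow> x + y \<in> V n"
  and V_diff [intro]: "x \<in> V n \<Longrightarrow> y \<in> V n \<Longrightarrow> x - y \<in> V n"
  and V_smul [intro]: "x \<in> V n \<Longrightarrow> smul c x \<in> V n"
  for x y :: "nat \<Rightarrow> 'k::field"
  by (auto simp: V_def)

lemma V_sum [intro]: "(\<And>i. i \<in> A \<Longrightarrow> f i \<in> V n) \<Longrightarrow> sum f A \<in> V n"
  for f :: "'i \<Rightarrow> nat \<Rightarrow> 'k::field"
  by (induction A rule: infinite_finite_induct) auto

lemma tr_in_V [simp]: "tr n x \<in> V n"
  by (auto simp: V_def tr_def)

lemma tr_id: "x \<in> V n \<Longrightarrow> tr n x = x"
  by (auto simp: V_def tr_def fun_eq_iff)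

lemma tr_add: "tr n (x + y) = tr n x + tr n y"
  and tr_smul: "tr n (smul c x) = smul c (tr n x)" for x y :: "nat \<Rightarrow> 'k::field"
  by (auto simp: tr_def fun_eq_iff)

lemma ax_in_V: "i < n \<Longrightarrow> ax i \<in> V n"
  by (auto simp: V_def ax_def)

lemma ax_apply: "ax i j = (if j = i then 1 else 0)"
  by (simp add: ax_def)

lemma V_expand: "x \<in> V n \<Longrightarrow> x = (\<Sum>i<n. smul (x i) (ax i))" for x :: "nat \<Rightarrow> 'k::field"
  by (auto simp: fun_eq_iff ax_apply V_def if_distrib[of "(*) _"] cong: if_cong)

lemma bij_betw_V: "bij_betw (\<lambda>x. restrict x {..<n}) (V n) (PiE {..<n} (\<lambda>_. UNIV :: 'k::zero set))"
  by (rule bij_betw_byWitness[where f' = "\<lambda>f i. if i < n then f i else 0"])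
     (auto simp: V_def fun_eq_iff PiE_def extensional_def)

lemma card_V: "card (V n :: (nat \<Rightarrow> 'k::{zero,finite}) set) = CARD('k) ^ n"
  using bij_betw_same_card[OF bij_betw_V[where ?'k = 'k, of n]] by (simp add: card_PiE)

lemma finite_V [simp]: "finite (V n :: (nat \<Rightarrow> 'k::{zero,finite}) set)"
  using bij_betw_finite[OF bij_betw_V[where ?'k = 'k, of n]] by (simp add: finite_PiE)

section \<open>Linear algebra by counting over a finite field\<close>

definition nonsing :: "nat \<Rightarrow> (nat \<Rightarrow> nat \<Rightarrow> 'k::field) \<Rightarrow> bool" where
  "nonsing m A \<longleftrightarrow> (\<forall>a. (\<forall>i<m. (\<Sum>j<m. A i j * a j) = 0) \<longrightarrow> (\<forall>j<m. a j = 0))"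

lemma nonsingD: "nonsing m A \<Longrightarrow> (\<And>i. i < m \<Longrightarrow> (\<Sum>j<m. A i j * a j) = 0) \<Longrightarrow> j < m \<Longrightarrow> a j = 0"
  by (auto simp: nonsing_def)

lemma nonsing_cong: "(\<And>i j. i < m \<Longrightarrow> j < m \<Longrightarrow> A i j = B i j) \<Longrightarrow> nonsing m A \<longleftrightarrow> nonsing m B"
  unfolding nonsing_def by (intro arg_cong[where f = All] ext) simp

text \<open>The matrix acts injectively on the finite set \<open>V m\<close>, hence surjectively;
  \<open>indep_basis\<close> rests on the same count.\<close>

lemma nonsing_solve:
  fixes A :: "nat \<Rightarrow> nat \<Rightarrow> 'k::{finite,field}"
  assumes "nonsing m A"
  shows "\<exists>a\<in>V m. \<forall>i<m. (\<Sum>j<m. A i j * a j) = c i"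
proof -
  define T where "T a = (\<lambda>i. if i < m then \<Sum>j<m. A i j * a j else 0)" for a
  have "inj_on T (V m)"
  proof (rule inj_onI)
    fix a b assume ab: "a \<in> V m" "b \<in> V m" "T a = T b"
    have "(\<Sum>j<m. A i j * (a - b) j) = 0" if "i < m" for i
      using fun_cong[OF ab(3), of i] that by (simp add: T_def right_diff_distrib sum_subtractf)
    then have "(a - b) j = 0" if "j < m" for j using nonsingD[OF assms _ that, of "a - b"] by blast
    then show "a = b" using ab by (auto simp: fun_eq_iff V_def) (metis not_le)
  qed
  moreover have "T ` V m \<subseteq> V m" by (auto simp: T_def V_def)
  ultimately have "T ` V m = V m" by (intro endo_inj_surj) auto
  moreover have "(\<lambda>i. if i < m then c i else 0) \<in> V m" by (auto simp: V_def)
  ultimately obtain a where "a \<in> V m" "(\<lambda>i. if i < m then c i else 0) = T a" by blast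
  then show ?thesis by (intro bexI[of _ a]) (auto simp: T_def fun_eq_iff, metis)
qed

definition indep :: "nat \<Rightarrow> (nat \<Rightarrow> nat \<Rightarrow> 'k::field) \<Rightarrow> bool" where
  "indep m P \<longleftrightarrow> (\<forall>a. (\<Sum>i<m. smul (a i) (P i)) = 0 \<longrightarrow> (\<forall>i<m. a i = 0))"

lemma indepD: "indep m P \<Longrightarrow> (\<Sum>i<m. smul (a i) (P i)) = 0 \<Longrightarrow> i < m \<Longrightarrow> a i = 0"
  by (auto simp: indep_def)

lemma indep_inj_on_comb:
  assumes "indep m P"
  shows "inj_on (\<lambda>a. \<Sum>i<m. smul (a i) (P i)) (V m)"
proof (rule inj_onI)
  fix a b assume ab: "a \<in> V m" "b \<in> V m" "(\<Sum>i<m. smul (a i) (P i)) = (\<Sum>i<m. smul (b i) (P i))"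
  have "(\<Sum>i<m. smul ((a - b) i) (P i)) = 0"
    using ab(3) by (simp add: smul_diff_left sum_subtractf)
  then have "(a - b) j = 0" if "j < m" for j using indepD[OF assms _ that, of "a - b"] by blast
  then show "a = b" using ab by (auto simp: fun_eq_iff V_def) (metis not_le)
qed

lemma indep_card_le:
  fixes P :: "nat \<Rightarrow> nat \<Rightarrow> 'k::{finite,field}"
  assumes "indep m P" "\<And>i. i < m \<Longrightarrow> P i \<in> V n"
  shows "m \<le> n"
proof -
  have "card (V m :: (nat \<Rightarrow> 'k) set) \<le> card (V n :: (nat \<Rightarrow> 'k) set)"
    by (rule card_inj_on_le[OF indep_inj_on_comb[OF assms(1)]]) (use assms(2) in auto)
  then have le: "CARD('k) ^ m \<le> CARD('k) ^ n" by (simp add: card_V)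
  have "card {0, 1::'k} \<le> CARD('k)" by (intro card_mono) auto
  then have "CARD('k) > 1" by simp
  then show ?thesis using le by simp
qed

lemma indep_basis:
  fixes P :: "nat \<Rightarrow> nat \<Rightarrow> 'k::{finite,field}"
  assumes "indep n P" "\<And>i. i < n \<Longrightarrow> P i \<in> V n" "x \<in> V n"
  shows "\<exists>a\<in>V n. x = (\<Sum>i<n. smul (a i) (P i))"
proof -
  have "(\<lambda>a. \<Sum>i<n. smul (a i) (P i)) ` V n = V n"
    by (rule endo_inj_surj) (use assms indep_inj_on_comb[OF assms(1)] in auto)
  then show ?thesis using assms(3) by blast
qed

lemma indep_functional:
  fixes P :: "nat \<Rightarrow> nat \<Rightarrow> 'k::field"
  assumes "indep m P"
  shows "\<exists>g. (\<forall>x y. g (x + y) = g x + g y) \<and> (\<forall>c x. g (smul c x) = c * g x) \<and> (\<forall>i<m. g (P i) = c i)"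
proof -
  have inj: "inj_on P {..<m}"
  proof (rule inj_onI, rule ccontr)
    fix i j assume ij: "i \<in> {..<m}" "j \<in> {..<m}" "P i = P j" "i \<noteq> j"
    have "(\<Sum>k<m. smul ((\<lambda>k. if k = i then 1 else if k = j then -1 else 0) k) (P k))
        = (\<Sum>k\<in>{i, j}. smul (if k = i then 1 else if k = j then -1 else 0) (P k))"
      by (rule sum.mono_neutral_right) (use ij in auto)
    also have "\<dots> = 0" using ij by (simp add: smul_minus_left)
    finally show False
      using indepD[OF assms, of "\<lambda>k. if k = i then 1 else if k = j then -1 else 0" i] ij by simp
  qed
  \<comment> \<open>Passage from an independent family to an independent set, from which linear maps
    can be extended; \<open>inj\<close> excludes repetitions.\<close>
  have "fun_vs.independent (P ` {..<m})"
  proof (subst fun_vs.independent_explicit_module, intro allI impI)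
    fix t u v assume t: "finite t" "t \<subseteq> P ` {..<m}" "(\<Sum>v\<in>t. smul (u v) v) = 0" "v \<in> t"
    define a where "a i = (if P i \<in> t then u (P i) else 0)" for i
    have "(\<Sum>i<m. smul (a i) (P i)) = (\<Sum>v\<in>P ` {..<m}. smul (if v \<in> t then u v else 0) v)"
      by (subst sum.reindex[OF inj]) (auto simp: a_def)
    also have "\<dots> = (\<Sum>v\<in>t. smul (if v \<in> t then u v else 0) v)"
      by (rule sum.mono_neutral_right) (use t in auto)
    also have "\<dots> = 0" using t(3) by simp
    finally have z: "(\<Sum>i<m. smul (a i) (P i)) = 0" .
    obtain i where "i < m" "v = P i" using t by auto
    then show "u v = 0" using indepD[OF assms z, of i] t(4) by (simp add: a_def)
  qed
  then obtain g where g: "Vector_Spaces.linear smul (*) g" "\<forall>x\<in>P ` {..<m}. g x = c (the_inv_into {..<m} P x)"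
    using functionals.linear_independent_extend[of _ "\<lambda>x. c (the_inv_into {..<m} P x)"] by blast
  then have "g (P i) = c i" if "i < m" for i using that by (simp add: the_inv_into_f_f[OF inj])
  then show ?thesis using g(1)
    by (intro exI[of _ g]) (auto simp: functionals.linear_add functionals.linear_scale)
qed

context hermitian_field
begin

definition herm_form :: "((nat \<Rightarrow> 'a) \<Rightarrow> (nat \<Rightarrow> 'a) \<Rightarrow> 'a) \<Rightarrow> bool" where
  "herm_form B \<longleftrightarrow> (\<forall>x y z. B x (y + z) = B x y + B x z) \<and> (\<forall>c x y. B x (smul c y) = c * B x y)
     \<and> (\<forall>x y. B y x = cj (B x y))"

lemma
  assumes "herm_form B"
  shows hf_add: "B x (y + z) = B x y + B x z"
    and hf_smul: "B x (smul c y) = c * B x y"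
    and hf_sym: "B y x = cj (B x y)"
  using assms unfolding herm_form_def by blast+

lemma
  assumes B: "herm_form B"
  shows hf_0: "B x 0 = 0" and hf_0_left: "B 0 x = 0"
    and hf_minus: "B x (- y) = - B x y"
    and hf_diff: "B x (y - z) = B x y - B x z"
    and hf_add_left: "B (y + z) x = B y x + B z x"
    and hf_smul_left: "B (smul c y) x = cj c * B y x"
    and hf_diff_left: "B (y - z) x = B y x - B z x"
proof -
  show z: "B x 0 = 0" for x using hf_smul[OF B, of x 0 0] by simp
  show "B 0 x = 0" using hf_sym[OF B, of 0 x] z by simp
  show m: "B x (- y) = - B x y" for x y using hf_smul[OF B, of x "-1" y] by (simp add: smul_minus_left)
  show d: "B x (y - z) = B x y - B x z" for x y z using hf_add[OF B, of x y "- z"] m by simp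
  show "B (y + z) x = B y x + B z x"
    by (subst (1 2 3) hf_sym[OF B]) (simp add: hf_add[OF B])
  show "B (smul c y) x = cj c * B y x"
    by (subst (1 2) hf_sym[OF B]) (simp add: hf_smul[OF B])
  show "B (y - z) x = B y x - B z x"
    by (subst (1 2 3) hf_sym[OF B]) (simp add: d)
qed

lemma hf_sum: "herm_form B \<Longrightarrow> B x (sum f A) = (\<Sum>i\<in>A. B x (f i))"
  by (induction A rule: infinite_finite_induct) (auto simp: hf_0 hf_add)

lemma hf_sum_left: "herm_form B \<Longrightarrow> B (sum f A) x = (\<Sum>i\<in>A. B (f i) x)"
  by (induction A rule: infinite_finite_induct) (auto simp: hf_0_left hf_add_left)

definition nondeg :: "nat \<Rightarrow> ((nat \<Rightarrow> 'a) \<Rightarrow> (nat \<Rightarrow> 'a) \<Rightarrow> 'a) \<Rightarrow> bool" where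
  "nondeg n B \<longleftrightarrow> (\<forall>x\<in>V n. (\<forall>y\<in>V n. B x y = 0) \<longrightarrow> x = 0)"

text \<open>Pairing a linear relation with each \<open>P i\<close> gives a vector in the kernel of
  the Gram matrix.\<close>

lemma nonsing_gram_indep:
  assumes B: "herm_form B" and ns: "nonsing m (\<lambda>i j. B (P i) (P j))"
  shows "indep m P"
  unfolding indep_def
proof (intro allI impI)
  fix a i assume z: "(\<Sum>i<m. smul (a i) (P i)) = 0" "i < m"
  have "(\<Sum>j<m. B (P i) (P j) * a j) = B (P i) (\<Sum>i<m. smul (a i) (P i))" for i
    by (simp add: hf_sum[OF B] hf_smul[OF B] mult.commute)
  then have "(\<Sum>j<m. B (P i) (P j) * a j) = 0" for i unfolding z(1) hf_0[OF B] .
  then show "a i = 0" using nonsingD[OF ns _ z(2), of a] by blast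
qed

text \<open>The orthogonal complement of the span of \<open>P\<close> is nonzero by counting and
  nondegenerate because the Gram matrix is nonsingular. If two vectors \<open>y0\<close>,
  \<open>z\<close> in it with nonzero pairing are both isotropic, surjectivity of the trace gives a
  combination with nonzero value, also in characteristic 2. Surjectivity of the norm then scales the
  value to 1.\<close>

lemma ex_unit_orthogonal:
  assumes B: "herm_form B" and nd: "nondeg n B"
    and P: "\<And>i. i < l \<Longrightarrow> P i \<in> V n" and ns: "nonsing l (\<lambda>i j. B (P i) (P j))" and ln: "l < n"
  shows "\<exists>y\<in>V n. B y y = 1 \<and> (\<forall>i<l. B (P i) y = 0)"
proof -
  define T where "T y = (\<lambda>i. if i < l then B (P i) y else 0)" for y
  have "card {0, 1::'a} \<le> card (UNIV :: 'a set)" by (intro card_mono) auto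
  then have "card (UNIV :: 'a set) > 1" by simp
  then have "card (V l :: (nat \<Rightarrow> 'a) set) < card (V n :: (nat \<Rightarrow> 'a) set)"
    using ln by (simp add: card_V)
  moreover have "T ` V n \<subseteq> V l" by (auto simp: T_def V_def)
  ultimately have "\<not> inj_on T (V n)"
    using card_inj_on_le[of T "V n" "V l"] by auto
  then obtain y1 y2 where y12: "y1 \<in> V n" "y2 \<in> V n" "y1 \<noteq> y2" "T y1 = T y2"
    by (auto simp: inj_on_def)
  define y0 where "y0 = y1 - y2"
  have y0: "y0 \<in> V n" "y0 \<noteq> 0" using y12 by (auto simp: y0_def)
  have y0P: "B (P i) y0 = 0" if "i < l" for i
    using fun_cong[OF y12(4), of i] that by (simp add: T_def y0_def hf_diff[OF B])
  obtain z0 where z0: "z0 \<in> V n" "B y0 z0 \<noteq> 0" using nd y0 by (auto simp: nondeg_def)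
  \<comment> \<open>Coefficients of the projection of \<open>z0\<close> to the span of
    \<open>P\<close>; subtracting it makes \<open>z\<close> orthogonal to every \<open>P i\<close>
    and keeps its pairing with \<open>y0\<close>.\<close>
  obtain a where a: "\<And>i. i < l \<Longrightarrow> (\<Sum>j<l. B (P i) (P j) * a j) = B (P i) z0"
    using nonsing_solve[OF ns, of "\<lambda>i. B (P i) z0"] by auto
  define z where "z = z0 - (\<Sum>j<l. smul (a j) (P j))"
  have zV: "z \<in> V n" using z0 P by (auto simp: z_def)
  have zP: "B (P i) z = 0" if "i < l" for i
    using a[OF that] by (simp add: z_def hf_diff[OF B] hf_sum[OF B] hf_smul[OF B] mult.commute)
  have "B y0 (P j) = 0" if "j < l" for j using y0P[OF that] hf_sym[OF B, of y0 "P j"] by simp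
  then have y0z: "B y0 z \<noteq> 0" using z0(2) by (simp add: z_def hf_diff[OF B] hf_sum[OF B] hf_smul[OF B])
  have "\<exists>y\<in>V n. B y y \<noteq> 0 \<and> (\<forall>i<l. B (P i) y = 0)"
  proof (cases "B y0 y0 = 0 \<and> B z z = 0")
    case False
    then show ?thesis using y0 zV y0P zP by blast
  next
    case True
    obtain t where t: "t + cj t = 1" using trace_surj[of 1] by auto
    define c where "c = t / B y0 z"
    have "B (y0 + smul c z) (y0 + smul c z) = c * B y0 z + cj c * B z y0"
      using True by (simp add: hf_add[OF B] hf_add_left[OF B] hf_smul[OF B] hf_smul_left[OF B])
    also have "\<dots> = t + cj t"
      using y0z hf_sym[OF B, of z y0] by (simp add: c_def)
    finally have "B (y0 + smul c z) (y0 + smul c z) \<noteq> 0" using t by simp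
    then show ?thesis using y0 zV y0P zP
      by (intro bexI[of _ "y0 + smul c z"]) (auto simp: hf_add[OF B] hf_smul[OF B])
  qed
  then obtain y where y: "y \<in> V n" "B y y \<noteq> 0" "\<forall>i<l. B (P i) y = 0" by auto
  have "B y y \<in> Fq" using hf_sym[OF B, of y y] by (simp add: Fq_def)
  then obtain s where s: "s * cj s = inverse (B y y)" using norm_surj Fq_inverse by blast
  have "B (smul s y) (smul s y) = (s * cj s) * B y y"
    by (simp add: hf_smul[OF B] hf_smul_left[OF B])
  also have "\<dots> = 1" using y s by simp
  finally show ?thesis using y by (intro bexI[of _ "smul s y"]) (auto simp: hf_smul[OF B])
qed

lemma extend_orthonormal:
  assumes B: "herm_form B" and nd: "nondeg n B"
    and P: "\<And>i. i < l \<Longrightarrow> P i \<in> V n" and ns: "nonsing l (\<lambda>i j. B (P i) (P j))" and "l \<le> k" "k \<le> n"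
  shows "\<exists>P'. (\<forall>i<l. P' i = P i) \<and> (\<forall>i<k. P' i \<in> V n) \<and> nonsing k (\<lambda>i j. B (P' i) (P' j))
    \<and> (\<forall>i<k. \<forall>j<k. l \<le> i \<or> l \<le> j \<longrightarrow> B (P' i) (P' j) = (if i = j then 1 else 0))"
  using \<open>l \<le> k\<close> \<open>k \<le> n\<close>
proof (induction k rule: dec_induct)
  case base
  then show ?case using P ns by (intro exI[of _ P]) auto
next
  case (step k)
  then obtain P' where P': "\<forall>i<l. P' i = P i" "\<forall>i<k. P' i \<in> V n" "nonsing k (\<lambda>i j. B (P' i) (P' j))"
    "\<forall>i<k. \<forall>j<k. l \<le> i \<or> l \<le> j \<longrightarrow> B (P' i) (P' j) = (if i = j then 1 else 0)" by auto
  obtain y where y: "y \<in> V n" "B y y = 1" "\<forall>i<k. B (P' i) y = 0"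
    using ex_unit_orthogonal[OF B nd _ P'(3)] P'(2) step by auto
  have y': "\<forall>i<k. B y (P' i) = 0" using y(3) hf_sym[OF B, of y] by simp
  have "nonsing (Suc k) (\<lambda>i j. B ((P'(k := y)) i) ((P'(k := y)) j))"
    unfolding nonsing_def
  proof (intro allI impI)
    fix a j assume a: "\<forall>i<Suc k. (\<Sum>j<Suc k. B ((P'(k := y)) i) ((P'(k := y)) j) * a j) = 0" and j: "j < Suc k"
    have "a k = 0" using spec[OF a, of k] y y' by simp
    moreover have "a j = 0" if "j < k" for j
    proof (rule nonsingD[OF P'(3) _ that, where a = a])
      fix i assume "i < k"
      then show "(\<Sum>j<k. B (P' i) (P' j) * a j) = 0" using spec[OF a, of i] y by simp
    qed
      ultimately show "a j = 0" using j by (auto simp: less_Suc_eq)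
  qed
  moreover have "\<forall>i<l. (P'(k := y)) i = P i" using P'(1) step by simp
  moreover have "\<forall>i<Suc k. (P'(k := y)) i \<in> V n" using P'(2) y(1) by simp
  moreover have "B ((P'(k := y)) i) ((P'(k := y)) j) = (if i = j then 1 else 0)"
    if "i < Suc k" "j < Suc k" "l \<le> i \<or> l \<le> j" for i j
    using that P'(4)[rule_format, of i j] y y' by (cases "i = k"; cases "j = k") auto
  ultimately show ?case by blast
qed

definition ip :: "nat \<Rightarrow> (nat \<Rightarrow> 'a) \<Rightarrow> (nat \<Rightarrow> 'a) \<Rightarrow> 'a" where
  "ip n x y = (\<Sum>i<n. cj (x i) * y i)"

lemma herm_form_ip: "herm_form (ip n)"
  by (auto simp: herm_form_def ip_def algebra_simps sum.distrib sum_distrib_left)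

lemmas ip_add = hf_add[OF herm_form_ip] and ip_smul = hf_smul[OF herm_form_ip]
  and ip_sym = hf_sym[OF herm_form_ip] and ip_0 = hf_0[OF herm_form_ip]
  and ip_0_left = hf_0_left[OF herm_form_ip] and ip_diff = hf_diff[OF herm_form_ip]
  and ip_add_left = hf_add_left[OF herm_form_ip] and ip_smul_left = hf_smul_left[OF herm_form_ip]
  and ip_diff_left = hf_diff_left[OF herm_form_ip] and ip_sum = hf_sum[OF herm_form_ip]
  and ip_sum_left = hf_sum_left[OF herm_form_ip]

lemma ip_ax_left: "i < n \<Longrightarrow> ip n (ax i) x = x i"
  by (simp add: ip_def ax_apply if_distrib[of cj] if_distrib[of "\<lambda>c. c * _"] cong: if_cong)

lemma ip_ax_right: "i < n \<Longrightarrow> ip n x (ax i) = cj (x i)"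
  using ip_sym[of n x "ax i"] by (simp add: ip_ax_left)

lemma nondeg_ip: "nondeg n (ip n)"
proof -
  have "x = 0" if "x \<in> V n" "\<forall>y\<in>V n. ip n x y = 0" for x
  proof
    fix i show "x i = 0 i"
      using that(2)[rule_format, OF ax_in_V, of i] V_D[OF that(1), of i] ip_ax_right[of i n x]
      by (cases "i < n") auto
  qed
  then show ?thesis by (auto simp: nondeg_def)
qed

text \<open>A functional with the values \<open>cj (c i)\<close> is represented by the vector of its
  conjugated values on the axes, because the form is conjugate-linear in its first argument.\<close>

lemma indep_dual_vector:
  assumes "indep m P" "\<And>i. i < m \<Longrightarrow> P i \<in> V n"
  shows "\<exists>z\<in>V n. \<forall>i<m. ip n (P i) z = c i"
proof -
  obtain g where g: "\<And>x y. g (x + y) = g x + g y" "\<And>c x. g (smul c x) = c * g x" "\<And>i. i < m \<Longrightarrow> g (P i) = cj (c i)"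
    using indep_functional[OF assms(1), of "\<lambda>i. cj (c i)"] by auto
  have g0: "g 0 = 0" using g(2)[of 0 0] by simp
  have gs: "g (sum f A) = (\<Sum>i\<in>A. g (f i))" for f :: "nat \<Rightarrow> nat \<Rightarrow> 'a" and A
    by (induction A rule: infinite_finite_induct) (simp_all only: sum.infinite sum.empty sum.insert g g0 simp_thms)
  define z where "z = (\<lambda>i. if i < n then cj (g (ax i)) else 0)"
  have "ip n x z = cj (g x)" if "x \<in> V n" for x
  proof -
    have "g x = (\<Sum>i<n. x i * g (ax i))"
      by (subst V_expand[OF that]) (simp only: gs g)
    then show ?thesis by (simp add: ip_def z_def)
  qed
  moreover have "z \<in> V n" by (auto simp: z_def V_def)
  ultimately show ?thesis using g(3) assms(2) by (intro bexI[of _ z]) auto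
qed

end

section \<open>Unitary groups and extension of isometries\<close>

definition lin :: "(('i \<Rightarrow> 'k::field) \<Rightarrow> 'i \<Rightarrow> 'k) \<Rightarrow> bool" where
  "lin f \<longleftrightarrow> (\<forall>x y. f (x + y) = f x + f y) \<and> (\<forall>c x. f (smul c x) = smul c (f x))"

lemma lin_add: "lin f \<Longrightarrow> f (x + y) = f x + f y" and lin_smul: "lin f \<Longrightarrow> f (smul c x) = smul c (f x)"
  by (auto simp: lin_def)

lemma lin_0: "lin f \<Longrightarrow> f 0 = 0"
  using lin_smul[of f 0 0] by simp

lemma lin_minus: "lin f \<Longrightarrow> f (- x) = - f x"
  using lin_smul[of f "-1" x] by (simp add: smul_minus_left)

lemma lin_diff: "lin f \<Longrightarrow> f (x - y) = f x - f y"
  by (simp only: diff_conv_add_uminus lin_add lin_minus)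

lemma lin_sum: "lin f \<Longrightarrow> f (sum g A) = (\<Sum>i\<in>A. f (g i))"
  by (induction A rule: infinite_finite_induct) (simp_all only: sum.infinite sum.empty sum.insert lin_0 lin_add simp_thms)

lemma lin_comb: "lin f \<Longrightarrow> f (\<Sum>i\<in>A. smul (a i) (P i)) = (\<Sum>i\<in>A. smul (a i) (f (P i)))"
  by (simp only: lin_sum lin_smul)

lemma lin_id: "lin id" and lin_comp: "lin f \<Longrightarrow> lin g \<Longrightarrow> lin (f \<circ> g)"
  by (auto simp: lin_def)

lemma lin_funpow: "lin f \<Longrightarrow> lin (f ^^ k)"
  by (induction k) (auto simp: lin_id lin_comp)

lemma sum_delta_mult:
  fixes a :: "nat \<Rightarrow> 'k::field"
  shows "(\<Sum>j<n. (if j = k then 1 else 0) * a j) = (if k < n then a k else 0)"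
    and "(\<Sum>j<n. (if k = j then 1 else 0) * a j) = (if k < n then a k else 0)"
  by (simp_all add: if_distrib[of "\<lambda>c. c * _"] cong: if_cong)

text \<open>The index range splits into four blocks: a basis of the radical (\<open>r\<close> vectors), a nondegenerate
  part with Gram matrix \<open>g\<close> (\<open>d\<close> vectors), a basis dual to that of the radical, and orthonormal vectors.\<close>
definition gramJ :: "nat \<Rightarrow> nat \<Rightarrow> (nat \<Rightarrow> nat \<Rightarrow> 'k::field) \<Rightarrow> nat \<Rightarrow> nat \<Rightarrow> 'k" where
  "gramJ r d g i j =
     (if i < r then if j = r + d + i then 1 else 0
      else if i < r + d then if r \<le> j \<and> j < r + d then g (i - r) (j - r) else 0
      else if i < 2 * r + d then if i = r + d + j then 1 else 0
      else if i = j then 1 else 0)"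

text \<open>The rows of the radical block read off the coordinates in its dual block and conversely,
  the orthonormal rows read off their own, and the middle block is left to \<open>g\<close>.\<close>

lemma nonsing_gramJ:
  assumes n: "2 * r + d \<le> n" and g: "nonsing d g"
  shows "nonsing n (gramJ r d g)"
  unfolding nonsing_def
proof (intro allI impI)
  fix a j assume a: "\<forall>i<n. (\<Sum>j<n. gramJ r d g i j * a j) = 0" and j: "j < n"
  have 1: "a (r + d + i) = 0" if "i < r" for i
  proof -
    have "(\<Sum>j<n. gramJ r d g i j * a j) = (\<Sum>j<n. (if j = r + d + i then 1 else 0) * a j)"
      using that by (intro sum.cong) (auto simp: gramJ_def)
    also have "\<dots> = a (r + d + i)" using that n by (simp add: sum_delta_mult)
    finally show ?thesis using a that n by auto
  qed
  have 2: "a k = 0" if "k < r" for k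
  proof -
    have "(\<Sum>j<n. gramJ r d g (r + d + k) j * a j) = (\<Sum>j<n. (if j = k then 1 else 0) * a j)"
      using that by (intro sum.cong) (auto simp: gramJ_def)
    also have "\<dots> = a k" using that n by (simp add: sum_delta_mult)
    finally show ?thesis using a that n by auto
  qed
  have 3: "a i = 0" if "2 * r + d \<le> i" "i < n" for i
  proof -
    have "(\<Sum>j<n. gramJ r d g i j * a j) = (\<Sum>j<n. (if j = i then 1 else 0) * a j)"
      using that by (intro sum.cong) (auto simp: gramJ_def)
    also have "\<dots> = a i" using that n by (simp add: sum_delta_mult)
    finally show ?thesis using a that n by auto
  qed
  have 4: "a (r + l) = 0" if "l < d" for l
  proof (rule nonsingD[OF g _ that, where a = "\<lambda>l. a (r + l)"])
    fix k assume k: "k < d"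
    have "(\<Sum>j<n. gramJ r d g (r + k) j * a j) = (\<Sum>j\<in>{r..<r + d}. gramJ r d g (r + k) j * a j)"
      using k n by (intro sum.mono_neutral_right) (auto simp: gramJ_def)
    also have "\<dots> = (\<Sum>l<d. g k l * a (r + l))"
      by (rule sum.reindex_bij_witness[of _ "\<lambda>l. r + l" "\<lambda>j. j - r"]) (use k in \<open>auto simp: gramJ_def\<close>)
    finally show "(\<Sum>l<d. g k l * a (r + l)) = 0" using a k n by auto
  qed
  consider "j < r" | "r \<le> j" "j < r + d" | "r + d \<le> j" "j < 2 * r + d" | "2 * r + d \<le> j" by linarith
  then show "a j = 0"
    using 1[of "j - (r + d)"] 2[of j] 3[of j] 4[of "j - r"] j by cases auto
qed

context hermitian_field
begin

lemma gramJ_sym: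
  assumes "\<And>i j. i < d \<Longrightarrow> j < d \<Longrightarrow> g j i = cj (g i j)"
  shows "gramJ r d g j i = cj (gramJ r d g i j)"
  by (auto simp: gramJ_def intro!: assms)

lemma ip_tr: "ip n (tr n x) y = ip n x y" "ip n x (tr n y) = ip n x y"
  by (auto simp: ip_def tr_def)

text \<open>The maps act on all sequences and fix those supported beyond \<open>n\<close>, so that \<open>\<circ>\<close>, \<open>id\<close> and \<open>inv\<close>
  are the group operations.\<close>
definition U :: "nat \<Rightarrow> ((nat \<Rightarrow> 'a) \<Rightarrow> nat \<Rightarrow> 'a) set" where
  "U n = {f. lin f \<and> (\<forall>x y. ip n (f x) (f y) = ip n x y) \<and> (\<forall>x\<in>V n. f x \<in> V n) \<and> (\<forall>x. tr n x = 0 \<longrightarrow> f x = x)}"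

lemma U_lin: "f \<in> U n \<Longrightarrow> lin f" and U_ip: "f \<in> U n \<Longrightarrow> ip n (f x) (f y) = ip n x y"
  and U_V: "f \<in> U n \<Longrightarrow> x \<in> V n \<Longrightarrow> f x \<in> V n" and U_fix: "f \<in> U n \<Longrightarrow> tr n x = 0 \<Longrightarrow> f x = x"
  by (auto simp: U_def)

lemma tr_diff_tr: "tr n (x - tr n x) = (0 :: nat \<Rightarrow> 'a)"
  by (auto simp: tr_def fun_eq_iff)

lemma U_split: "f \<in> U n \<Longrightarrow> f x = f (tr n x) + (x - tr n x)"
  using lin_add[OF U_lin, of f n "tr n x" "x - tr n x"] U_fix[OF _ tr_diff_tr, of f n x] by simp

lemma U_id: "id \<in> U n" by (auto simp: U_def lin_id)

lemma U_comp: "f \<in> U n \<Longrightarrow> g \<in> U n \<Longrightarrow> f \<circ> g \<in> U n"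
  by (auto simp: U_def lin_comp)

lemma U_funpow: "f \<in> U n \<Longrightarrow> f ^^ k \<in> U n"
  by (induction k) (auto simp: U_id U_comp)

lemma U_eqI:
  assumes "f \<in> U n" "g \<in> U n" "\<And>x. x \<in> V n \<Longrightarrow> f x = g x" shows "f = g"
proof
  fix x show "f x = g x"
    using U_split[OF assms(1), of x] U_split[OF assms(2), of x] assms(3)[of "tr n x"] by simp
qed

text \<open>Injective because the form is nondegenerate; surjective because \<open>V n\<close> is
  finite and the map is the identity beyond \<open>n\<close>.\<close>

lemma U_bij: assumes "f \<in> U n" shows "bij f"
proof -
  have z: "x = 0" if "f x = 0" for x
  proof -
    have "ip n (tr n x) y = 0" for y
      using U_ip[OF assms, of x y] that by (simp add: ip_0_left ip_tr)
    then have "tr n x = 0" using nondeg_ip[of n] by (auto simp: nondeg_def)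
    then show ?thesis using U_fix[OF assms] that by simp
  qed
  have inj: "inj f"
  proof (rule injI)
    fix x y assume "f x = f y"
    then have "f (x - y) = 0" by (simp add: lin_diff[OF U_lin[OF assms]])
    then have "x - y = 0" by (rule z)
    then show "x = y" by (rule eq_iff_diff_eq_0[THEN iffD2])
  qed
  have "f ` V n = V n"
    by (rule endo_inj_surj) (use U_V[OF assms] inj in \<open>auto simp: inj_on_def inj_def\<close>)
  have "\<exists>u. y = f u" for y
  proof -
    have "tr n y \<in> f ` V n" using \<open>f ` V n = V n\<close> by simp
    then obtain u where u: "tr n y = f u" by auto
    have "f (u + (y - tr n y)) = f u + (y - tr n y)"
      by (simp only: lin_add[OF U_lin[OF assms]] U_fix[OF assms tr_diff_tr])
    then have "y = f (u + (y - tr n y))" using u by simp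
    then show ?thesis by blast
  qed
  then have "surj f" by auto
  then show ?thesis using inj by (simp add: bij_def)
qed

lemma U_inv: assumes f: "f \<in> U n" shows "inv f \<in> U n"
proof -
  note b = U_bij[OF f]
  note s = bij_is_surj[OF b] and i = bij_is_inj[OF b]
  have l: "lin (inv f)"
    unfolding lin_def
  proof (intro conjI allI)
    show "inv f (x + y) = inv f x + inv f y" for x y
      using i by (rule inv_f_eq) (simp add: lin_add[OF U_lin[OF f]] surj_f_inv_f[OF s])
    show "inv f (smul c x) = smul c (inv f x)" for c x
      using i by (rule inv_f_eq) (simp add: lin_smul[OF U_lin[OF f]] surj_f_inv_f[OF s])
  qed
  have fV: "f ` V n = V n"
    by (rule endo_inj_surj) (use U_V[OF f] i in \<open>auto simp: inj_on_def inj_def\<close>)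
  have "ip n (inv f x) (inv f y) = ip n x y" for x y
    using U_ip[OF f, of "inv f x" "inv f y", symmetric] by (simp only: surj_f_inv_f[OF s])
  moreover have "inv f x \<in> V n" if "x \<in> V n" for x
  proof -
    have "x \<in> f ` V n" using that fV by simp
    then obtain u where "u \<in> V n" "x = f u" by auto
    then show ?thesis by (simp add: inv_f_f[OF i])
  qed
  moreover have "inv f x = x" if "tr n x = 0" for x
    using inv_f_eq[OF i, of x x] U_fix[OF f that] by simp
  ultimately show ?thesis using l by (simp add: U_def)
qed

lemma finite_U: "finite (U n)"
proof -
  have "inj_on (\<lambda>f. restrict (\<lambda>i. f (ax i)) {..<n}) (U n)"
  proof (rule inj_onI)
    fix f g assume fg: "f \<in> U n" "g \<in> U n" "restrict (\<lambda>i. f (ax i)) {..<n} = restrict (\<lambda>i. g (ax i)) {..<n}"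
    have e: "f (ax i) = g (ax i)" if "i < n" for i
      using fun_cong[OF fg(3), of i] that by simp
    show "f = g"
    proof (rule U_eqI[OF fg(1,2)])
      fix x :: "nat \<Rightarrow> 'a" assume x: "x \<in> V n"
      show "f x = g x"
        by (subst (1 2) V_expand[OF x]) (simp add: lin_comb[OF U_lin[OF fg(1)]] lin_comb[OF U_lin[OF fg(2)]] e)
    qed
  qed
  moreover have "(\<lambda>f. restrict (\<lambda>i. f (ax i)) {..<n}) ` U n \<subseteq> PiE {..<n} (\<lambda>_. V n)"
    by (auto simp: U_V ax_in_V)
  moreover have "finite (PiE {..<n} (\<lambda>_. V n :: (nat \<Rightarrow> 'a) set))" by (intro finite_PiE) auto
  ultimately show ?thesis using finite_subset finite_imageD by blast
qed

lemma card_U_pos: "card (U n) > 0"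
  using U_id finite_U by (metis card_gt_0_iff empty_iff)

lemma ip_comb: "ip n (\<Sum>i<m. smul (a i) (P i)) (\<Sum>j<m. smul (b j) (P j))
    = (\<Sum>i<m. \<Sum>j<m. cj (a i) * b j * ip n (P i) (P j))"
proof -
  have "ip n (\<Sum>i<m. smul (a i) (P i)) (\<Sum>j<m. smul (b j) (P j))
      = (\<Sum>i<m. cj (a i) * ip n (P i) (\<Sum>j<m. smul (b j) (P j)))"
    by (simp only: ip_sum_left ip_smul_left)
  also have "\<dots> = (\<Sum>i<m. \<Sum>j<m. cj (a i) * b j * ip n (P i) (P j))"
    by (simp only: ip_sum ip_smul sum_distrib_left mult.assoc)
  finally show ?thesis .
qed

text \<open>The last step of Witt extension: partial isometries are first completed to two frames of
  \<open>n\<close> vectors with the same nonsingular Gram matrix, and these can be mapped onto each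
  other.\<close>

lemma ex_isometry:
  assumes P: "\<And>i. i < n \<Longrightarrow> P i \<in> V n" and P': "\<And>i. i < n \<Longrightarrow> P' i \<in> V n"
    and eq: "\<And>i j. i < n \<Longrightarrow> j < n \<Longrightarrow> ip n (P i) (P j) = ip n (P' i) (P' j)"
    and ns: "nonsing n (\<lambda>i j. ip n (P i) (P j))"
  shows "\<exists>f\<in>U n. \<forall>i<n. f (P i) = P' i"
proof -
  have ind: "indep n P" using nonsing_gram_indep[OF herm_form_ip ns] .
  have "\<exists>a\<in>V n. tr n x = (\<Sum>i<n. smul (a i) (P i))" for x
    using indep_basis[OF ind P, of "tr n x"] by auto
  then obtain co where co: "\<And>x. co x \<in> V n" "\<And>x. tr n x = (\<Sum>i<n. smul (co x i) (P i))" by metis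
  have uniq: "co x = a" if "a \<in> V n" "tr n x = (\<Sum>i<n. smul (a i) (P i))" for x a
    using inj_onD[OF indep_inj_on_comb[OF ind], of "co x" a] co[of x] that by simp
  have co_add: "co (x + y) = co x + co y" for x y
    by (rule uniq) (use co in \<open>auto simp: tr_add smul_add_left sum.distrib simp del: sum_fun_apply\<close>)
  have co_smul: "co (smul c x) = smul c (co x)" for c x
  proof (rule uniq)
    show "tr n (smul c x) = (\<Sum>i<n. smul (smul c (co x) i) (P i))"
      unfolding tr_smul co(2)[of x] smul_sum_right by simp
  qed (use co in auto)
  \<comment> \<open>The summand \<open>x - tr n x\<close> makes \<open>f\<close> the identity beyond
    \<open>n\<close>, as \<open>U n\<close> demands.\<close>
  define f where "f x = (\<Sum>i<n. smul (co x i) (P' i)) + (x - tr n x)" for x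
  have fP: "f (P i) = P' i" if "i < n" for i
  proof -
    have "co (P i) = ax i"
    proof (rule uniq)
      show "tr n (P i) = (\<Sum>j<n. smul (ax i j) (P j))"
        using P[OF that] that by (simp add: tr_id ax_apply if_distrib[of "\<lambda>c. smul c _"] cong: if_cong)
    qed (use that ax_in_V in auto)
    then show ?thesis using that P[OF that]
      by (simp add: f_def tr_id ax_apply if_distrib[of "\<lambda>c. smul c _"] cong: if_cong)
  qed
  have "lin f"
    unfolding lin_def
  proof (intro conjI allI)
    show "f (x + y) = f x + f y" for x y
      unfolding f_def co_add tr_add plus_fun_apply smul_add_left sum.distrib by (simp add: algebra_simps)
    show "f (smul c x) = smul c (f x)" for c x
      unfolding f_def co_smul tr_smul smul_add_right smul_sum_right smul_diff_right by simp
  qed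
  moreover have "ip n (f x) (f y) = ip n x y" for x y
  proof -
    have *: "tr n (f x) = (\<Sum>i<n. smul (co x i) (P' i))" for x
    proof -
      have "(\<Sum>i<n. smul (co x i) (P' i)) \<in> V n" using P' by auto
      then show ?thesis unfolding f_def tr_add by (simp add: tr_id tr_diff_tr)
    qed
    have "ip n (f x) (f y) = ip n (tr n (f x)) (tr n (f y))" by (simp add: ip_tr)
    also have "\<dots> = (\<Sum>i<n. \<Sum>j<n. cj (co x i) * co y j * ip n (P' i) (P' j))"
      by (simp only: * ip_comb)
    also have "\<dots> = (\<Sum>i<n. \<Sum>j<n. cj (co x i) * co y j * ip n (P i) (P j))"
      by (intro sum.cong refl) (simp add: eq)
    also have "\<dots> = ip n (tr n x) (tr n y)"
      by (simp only: co(2)[of x] co(2)[of y] ip_comb)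
    finally show ?thesis by (simp add: ip_tr)
  qed
  moreover have "f x \<in> V n" if "x \<in> V n" for x
    unfolding f_def using P' that by (intro V_add V_sum V_diff V_smul) auto
  moreover have "f x = x" if "tr n x = 0" for x
  proof -
    have "co x = 0" by (rule uniq) (simp_all add: that)
    then show ?thesis using that by (simp add: f_def)
  qed
  ultimately show ?thesis using fP by (intro bexI[of _ f]) (auto simp: U_def)
qed

text \<open>The radical vectors have dual vectors \<open>z0\<close> because the ambient form is
  nondegenerate. Subtracting combinations of radical vectors keeps the duality and leaves enough
  freedom to make the dual vectors isotropic and pairwise orthogonal; the rest is completed
  orthonormally.\<close>

lemma ex_adapted_frame:
  assumes W: "\<And>i. i < r + d \<Longrightarrow> W i \<in> V n" and ind: "indep (r + d) W"
    and gram: "\<And>i j. i < r + d \<Longrightarrow> j < r + d \<Longrightarrow> ip n (W i) (W j) = gramJ r d g i j"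
    and g: "nonsing d g"
  shows "2 * r + d \<le> n"
    and "\<exists>P. (\<forall>i<n. P i \<in> V n) \<and> (\<forall>i<r + d. P i = W i) \<and> (\<forall>i<n. \<forall>j<n. ip n (P i) (P j) = gramJ r d g i j)"
proof -
  have "\<exists>z\<in>V n. \<forall>i<r + d. ip n (W i) z = (if i = k then 1 else 0)" for k
    by (rule indep_dual_vector[OF ind W])
  then have "\<forall>k. \<exists>z. z \<in> V n \<and> (\<forall>i<r + d. ip n (W i) z = (if i = k then 1 else 0))" by blast
  from choice[OF this] obtain z0
    where z0: "\<And>k. z0 k \<in> V n" "\<And>i k. i < r + d \<Longrightarrow> ip n (W i) (z0 k) = (if i = k then 1 else 0)"
    by blast
  define c where "c i j = ip n (z0 i) (z0 j)" for i j
  have cs: "c j i = cj (c i j)" for i j unfolding c_def by (rule ip_sym)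
  have "\<exists>t. t + cj t = c i i" for i
    by (rule trace_surj) (simp add: Fq_def cs[symmetric])
  then obtain t where t: "\<And>i. t i + cj (t i) = c i i" by metis
  \<comment> \<open>A solution of \<open>x i j + cj (x j i) = c i j\<close>. Halving
    \<open>c\<close> would fail in characteristic 2, so the off-diagonal part is put above the
    diagonal and the diagonal is split by the trace.\<close>
  define x where "x i j = (if i < j then c i j else if i = j then t i else 0)" for i j
  have x: "x i j + cj (x j i) = c i j" for i j
    using t[of i] by (auto simp: x_def cs[symmetric])
  define z where "z k = z0 k - (\<Sum>l<r. smul (x l k) (W l))" for k
  have zV: "z k \<in> V n" for k using z0(1) W unfolding z_def by (intro V_diff V_sum V_smul) auto
  have WW: "ip n (W i) (W l) = 0" if "i < r + d" "l < r" for i l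
    using gram[OF that(1), of l] that by (auto simp: gramJ_def)
  have Wz: "ip n (W i) (z k) = (if i = k then 1 else 0)" if "i < r + d" for i k
    using z0(2)[OF that] WW[OF that] by (simp add: z_def ip_diff ip_sum ip_smul)
  have zW: "ip n (z k) (W i) = (if i = k then 1 else 0)" if "i < r + d" for i k
    using Wz[OF that, of k] ip_sym[of n "z k" "W i"] by simp
  have zz: "ip n (z i) (z j) = 0" if "i < r" "j < r" for i j
  proof -
    have "ip n (z i) (z j) = ip n (z i) (z0 j) - (\<Sum>l<r. x l j * ip n (z i) (W l))"
      by (simp only: z_def[of j] ip_diff ip_sum ip_smul)
    also have "(\<Sum>l<r. x l j * ip n (z i) (W l)) = (\<Sum>l<r. (if l = i then 1 else 0) * x l j)"
      using zW by (intro sum.cong) auto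
    also have "\<dots> = x i j" using that by (simp add: sum_delta_mult)
    also have "ip n (z i) (z0 j) = c i j - (\<Sum>l<r. cj (x l i) * ip n (W l) (z0 j))"
      by (simp only: z_def[of i] ip_diff_left ip_sum_left ip_smul_left c_def)
    also have "(\<Sum>l<r. cj (x l i) * ip n (W l) (z0 j)) = (\<Sum>l<r. (if l = j then 1 else 0) * cj (x l i))"
      using z0(2) by (intro sum.cong) auto
    also have "\<dots> = cj (x j i)" using that by (simp add: sum_delta_mult)
    finally show ?thesis by (simp add: x[of i j, symmetric])
  qed
  define P0 where "P0 i = (if i < r + d then W i else z (i - (r + d)))" for i
  have P0V: "P0 i \<in> V n" if "i < 2 * r + d" for i using W zV by (auto simp: P0_def)
  have P0g: "ip n (P0 i) (P0 j) = gramJ r d g i j" if "i < 2 * r + d" "j < 2 * r + d" for i j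
  proof -
    consider "i < r + d" "j < r + d" | "i < r + d" "j \<ge> r + d" | "i \<ge> r + d" "j < r + d" | "i \<ge> r + d" "j \<ge> r + d"
      by linarith
    then show ?thesis
    proof cases
      case 1 then show ?thesis using gram by (simp add: P0_def)
    next
      case 2 then show ?thesis using Wz[of i "j - (r + d)"] that by (auto simp: P0_def gramJ_def)
    next
      case 3 then show ?thesis using zW[of j "i - (r + d)"] that by (auto simp: P0_def gramJ_def)
    next
      case 4 then show ?thesis using zz[of "i - (r + d)" "j - (r + d)"] that by (auto simp: P0_def gramJ_def)
    qed
  qed
  have "nonsing (2 * r + d) (gramJ r d g)" by (rule nonsing_gramJ[OF _ g]) simp
  then have ns: "nonsing (2 * r + d) (\<lambda>i j. ip n (P0 i) (P0 j))"
    using P0g by (subst nonsing_cong[of _ _ "gramJ r d g"]) auto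
  show le: "2 * r + d \<le> n"
    using indep_card_le[OF nonsing_gram_indep[OF herm_form_ip ns]] P0V by blast
  obtain P where P: "\<forall>i<2 * r + d. P i = P0 i" "\<forall>i<n. P i \<in> V n"
    "\<forall>i<n. \<forall>j<n. 2 * r + d \<le> i \<or> 2 * r + d \<le> j \<longrightarrow> ip n (P i) (P j) = (if i = j then 1 else 0)"
    using extend_orthonormal[OF herm_form_ip nondeg_ip P0V ns le order_refl] by auto
  have "ip n (P i) (P j) = gramJ r d g i j" if "i < n" "j < n" for i j
  proof (cases "2 * r + d \<le> i \<or> 2 * r + d \<le> j")
    case True
    then have "ip n (P i) (P j) = (if i = j then 1 else 0)" using P(3) that by blast
    also have "\<dots> = gramJ r d g i j" using True by (auto simp: gramJ_def)
    finally show ?thesis .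
  next
    case False
    then show ?thesis using P(1) P0g by simp
  qed
  moreover have "\<forall>i<r + d. P i = W i" using P(1) by (auto simp: P0_def)
  ultimately show "\<exists>P. (\<forall>i<n. P i \<in> V n) \<and> (\<forall>i<r + d. P i = W i) \<and> (\<forall>i<n. \<forall>j<n. ip n (P i) (P j) = gramJ r d g i j)"
    using P(2) by blast
qed

text \<open>The form with matrix \<open>J\<close> has an orthonormal basis \<open>y\<close>, like
  the standard form; the coordinates of the axes in \<open>y\<close> are then vectors with standard
  Gram matrix \<open>J\<close>.\<close>

lemma ex_frame_with_gram:
  assumes ns: "nonsing n J" and sym: "\<And>i j. J j i = cj (J i j)"
  shows "\<exists>P. (\<forall>i<n. P i \<in> V n) \<and> (\<forall>i<n. \<forall>j<n. ip n (P i) (P j) = J i j)"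
proof -
  define B where "B x y = (\<Sum>i<n. \<Sum>j<n. cj (x i) * J i j * y j)" for x y
  have B: "herm_form B"
    unfolding herm_form_def
  proof (intro conjI allI)
    show "B x (y + z) = B x y + B x z" for x y z
      by (simp add: B_def algebra_simps sum.distrib)
    show "B x (smul c y) = c * B x y" for c x y
      by (simp add: B_def sum_distrib_left algebra_simps)
    show "B y x = cj (B x y)" for x y
      unfolding B_def by (subst sum.swap) (simp add: sym[symmetric] mult_ac)
  qed
  have Bax: "B (ax j) x = (\<Sum>i<n. J j i * x i)" if "j < n" for j x
  proof -
    have "B (ax j) x = (\<Sum>k<n. (if k = j then 1 else 0) * (\<Sum>i<n. J k i * x i))"
      unfolding B_def by (intro sum.cong) (auto simp: ax_apply)
    then show ?thesis using that by (simp only: sum_delta_mult if_True)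
  qed
  have Bax2: "B (ax j) (ax i) = J j i" if "j < n" "i < n" for i j
    using Bax[OF that(1), of "ax i"] sum_delta_mult(1)[of i "J j" n] that by (simp add: ax_apply mult.commute)
  have "nondeg n B"
    unfolding nondeg_def
  proof (intro ballI impI)
    fix x :: "nat \<Rightarrow> 'a" assume x: "x \<in> V n" "\<forall>y\<in>V n. B x y = 0"
    have "(\<Sum>i<n. J j i * x i) = 0" if "j < n" for j
    proof -
      have "B x (ax j) = 0" using x(2) ax_in_V[OF that] by (rule bspec)
      then have "B (ax j) x = 0" by (subst hf_sym[OF B]) simp
      then show ?thesis using Bax[OF that] by simp
    qed
    then have "x i = 0" if "i < n" for i using nonsingD[OF ns _ that, of x] by blast
    then show "x = 0" using x(1) by (auto simp: fun_eq_iff V_def) (metis not_le)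
  qed
  \<comment> \<open>The extension starts from the empty family, for which \<open>undefined\<close>
    stands.\<close>
  moreover have "nonsing 0 (\<lambda>i j. B (undefined i) (undefined j))" by (simp add: nonsing_def)
  ultimately obtain y where y: "\<forall>i<n. y i \<in> V n" "nonsing n (\<lambda>i j. B (y i) (y j))"
    "\<forall>i<n. \<forall>j<n. B (y i) (y j) = (if i = j then 1 else 0)"
    using extend_orthonormal[OF B, of n 0 "undefined" n] by auto
  have ind: "indep n y" by (rule nonsing_gram_indep[OF B y(2)])
  have exp: "x = (\<Sum>i<n. smul (B (y i) x) (y i))" if xV: "x \<in> V n" for x
  proof -
    obtain a where a: "x = (\<Sum>i<n. smul (a i) (y i))" using indep_basis[OF ind _ xV] y(1) by blast
    have "B (y i) x = a i" if "i < n" for i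
    proof -
      have "B (y i) x = (\<Sum>j<n. a j * B (y i) (y j))" unfolding a by (simp only: hf_sum[OF B] hf_smul[OF B])
      also have "\<dots> = (\<Sum>j<n. (if i = j then 1 else 0) * a j)" using y(3) that by (intro sum.cong) auto
      finally show ?thesis using that by (simp add: sum_delta_mult)
    qed
    then show ?thesis by (subst a) (intro sum.cong, auto)
  qed
  define P where "P j = (\<lambda>i. if i < n then B (y i) (ax j) else 0)" for j
  have "ip n (P j) (P l) = J j l" if "j < n" "l < n" for j l
  proof -
    have "J j l = B (ax j) (ax l)" using Bax2 that by simp
    also have "\<dots> = (\<Sum>i<n. B (y i) (ax l) * B (ax j) (y i))"
      by (subst exp[OF ax_in_V[OF that(2)]]) (simp only: hf_sum[OF B] hf_smul[OF B])
    also have "\<dots> = ip n (P j) (P l)"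
      unfolding ip_def P_def by (intro sum.cong refl) (subst hf_sym[OF B], simp)
    finally show ?thesis by simp
  qed
  moreover have "P j \<in> V n" for j by (auto simp: P_def V_def)
  ultimately show ?thesis by blast
qed

end

section \<open>Polynomials acting on vectors and power sums\<close>

definition pact :: "(('i \<Rightarrow> 'k::field) \<Rightarrow> 'i \<Rightarrow> 'k) \<Rightarrow> 'k poly \<Rightarrow> ('i \<Rightarrow> 'k) \<Rightarrow> 'i \<Rightarrow> 'k" where
  "pact T F v = (\<Sum>i\<le>degree F. smul (coeff F i) ((T ^^ i) v))"

lemma pact_bound: "degree F \<le> m \<Longrightarrow> pact T F v = (\<Sum>i\<le>m. smul (coeff F i) ((T ^^ i) v))"
  unfolding pact_def by (rule sum.mono_neutral_left) (auto simp: coeff_eq_0 not_le)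

lemma pact_bound_less: "degree F < m \<Longrightarrow> pact T F v = (\<Sum>i<m. smul (coeff F i) ((T ^^ i) v))"
  unfolding pact_def by (rule sum.mono_neutral_left) (auto simp: coeff_eq_0)

lemma pact_0 [simp]: "pact T 0 v = 0" and pact_1 [simp]: "pact T 1 v = v"
  by (auto simp: pact_def)

lemma pact_add: "pact T (F + G) v = pact T F v + pact T G v"
proof -
  let ?m = "max (degree F) (degree G)"
  have "degree (F + G) \<le> ?m" by (rule degree_add_le_max)
  then show ?thesis
    by (simp only: pact_bound[of "F + G" ?m] pact_bound[of F ?m] pact_bound[of G ?m] max.cobounded1 max.cobounded2
        coeff_add smul_add_left sum.distrib)
qed

lemma pact_smult: "pact T (smult c F) v = smul c (pact T F v)"
proof -
  have "pact T (smult c F) v = (\<Sum>i\<le>degree F. smul (coeff (smult c F) i) ((T ^^ i) v))"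
    by (rule pact_bound) (rule degree_smult_le)
  then show ?thesis unfolding pact_def smul_sum_right by simp
qed

lemma pact_minus: "pact T (- F) v = - pact T F v"
  using pact_smult[of T "-1" F v] by (simp add: smul_minus_left)

lemma pact_diff: "pact T (F - G) v = pact T F v - pact T G v"
  using pact_add[of T F "- G" v] by (simp add: pact_minus)

lemma pact_sum: "pact T (sum F A) v = (\<Sum>i\<in>A. pact T (F i) v)"
  by (induction A rule: infinite_finite_induct) (simp_all only: sum.infinite sum.empty sum.insert pact_0 pact_add simp_thms)

lemma pact_monom: "pact T (monom c i) v = smul c ((T ^^ i) v)"
proof -
  have "pact T (monom c i) v = (\<Sum>j\<le>i. smul (coeff (monom c i) j) ((T ^^ j) v))"
    by (rule pact_bound) (rule degree_monom_le)
  also have "\<dots> = (\<Sum>j\<le>i. if j = i then smul c ((T ^^ i) v) else 0)"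
    by (intro sum.cong) auto
  finally show ?thesis by simp
qed

lemma lin_pact: assumes "lin T" shows "lin (pact T F)"
  unfolding lin_def pact_def
proof (intro conjI allI)
  note l = lin_funpow[OF assms]
  show "(\<Sum>i\<le>degree F. smul (coeff F i) ((T ^^ i) (x + y)))
      = (\<Sum>i\<le>degree F. smul (coeff F i) ((T ^^ i) x)) + (\<Sum>i\<le>degree F. smul (coeff F i) ((T ^^ i) y))" for x y
    by (simp only: lin_add[OF l] smul_add_right sum.distrib)
  show "(\<Sum>i\<le>degree F. smul (coeff F i) ((T ^^ i) (smul c x)))
      = smul c (\<Sum>i\<le>degree F. smul (coeff F i) ((T ^^ i) x))" for c x
    unfolding smul_sum_right lin_smul[OF l] by (simp add: mult.commute)
qed

lemma pact_pCons:
  assumes "lin T" shows "pact T (pCons a F) v = smul a v + T (pact T F v)"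
proof -
  have "pact T (pCons a F) v = (\<Sum>i\<le>Suc (degree F). smul (coeff (pCons a F) i) ((T ^^ i) v))"
    by (rule pact_bound) (rule degree_pCons_le)
  also have "\<dots> = smul a v + (\<Sum>i\<le>degree F. smul (coeff F i) ((T ^^ Suc i) v))"
    by (subst sum.atMost_Suc_shift) simp
  also have "(\<Sum>i\<le>degree F. smul (coeff F i) ((T ^^ Suc i) v)) = T (pact T F v)"
    unfolding pact_def lin_comb[OF assms] by simp
  finally show ?thesis .
qed

lemma pact_mult:
  assumes "lin T" shows "pact T (F * G) v = pact T F (pact T G v)"
proof (induction F)
  case (pCons a F)
  have "pact T (pCons a F * G) v = smul a (pact T G v) + (smul 0 v + T (pact T (F * G) v))"
    unfolding mult_pCons_left pact_add pact_smult pact_pCons[OF assms] ..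
  then show ?case by (simp only: pCons pact_pCons[OF assms] smul_simps add_0)
qed (simp_all)

lemma pact_commute: "lin T \<Longrightarrow> pact T F (pact T G v) = pact T G (pact T F v)"
  by (metis pact_mult mult.commute)

lemma pact_funpow: "lin T \<Longrightarrow> (T ^^ k) (pact T F v) = pact T F ((T ^^ k) v)"
  using pact_commute[of T F "monom 1 k" v] by (simp add: pact_monom)

definition polyof :: "nat \<Rightarrow> (nat \<Rightarrow> 'k::field) \<Rightarrow> 'k poly" where
  "polyof m a = (\<Sum>i<m. monom (a i) i)"

lemma coeff_polyof: "coeff (polyof m a) k = (if k < m then a k else 0)"
  unfolding polyof_def coeff_sum by simp

lemma degree_polyof_less: "m > 0 \<Longrightarrow> degree (polyof m a) < m"
  by (metis coeff_polyof degree_0 leading_coeff_0_iff)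

lemma polyof_0: "polyof 0 a = 0"
  by (simp add: polyof_def)

lemma pact_polyof: "pact T (polyof m a) v = (\<Sum>i<m. smul (a i) ((T ^^ i) v))"
  unfolding polyof_def pact_sum pact_monom ..

lemma polyof_eq_0D: "polyof m a = 0 \<Longrightarrow> i < m \<Longrightarrow> a i = 0"
  by (metis coeff_polyof coeff_0)

lemma polyof_coeff: "degree F < m \<or> F = 0 \<Longrightarrow> polyof m (coeff F) = F"
  by (intro poly_eqI) (auto simp: coeff_polyof coeff_eq_0)

lemma polyof_coeff_div:
  fixes D F :: "'k::field poly"
  assumes "D \<noteq> 0" "F \<noteq> 0" "degree F = r + degree D"
  shows "polyof r (coeff ((A mod F) div D)) = (A mod F) div D"
proof (rule polyof_coeff)
  let ?H = "A mod F" and ?Q = "(A mod F) div D"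
  have deg: "?H = 0 \<or> degree ?H < r + degree D" using degree_mod_less[OF assms(2), of A] assms(3) by auto
  show "degree ?Q < r \<or> ?Q = 0"
  proof (rule disjCI)
    assume Q: "?Q \<noteq> 0"
    have 1: "degree (?Q * D) = degree ?Q + degree D" using degree_mult_eq[OF Q assms(1)] .
    have "degree (?H mod D) < degree (?Q * D) \<or> ?H mod D = 0"
      using degree_mod_less[OF assms(1), of ?H] 1 by auto
    then have "degree (?Q * D + ?H mod D) = degree (?Q * D)"
      by (elim disjE) (erule degree_add_eq_left, simp only: add_0_right)
    then have 2: "degree ?H = degree ?Q + degree D" using 1 by simp
    moreover have "?H \<noteq> 0" using Q by auto
    ultimately show "degree ?Q < r" using deg by simp
  qed
qed

text \<open>\<open>psum F l\<close> is the sum of the \<open>l\<close>-th powers of the roots of the monic polynomial \<open>F\<close>,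
  read off from the logarithmic derivative of the reversed polynomial.\<close>
definition psum :: "'k::field poly \<Rightarrow> nat \<Rightarrow> 'k" where
  "psum F l = fps_nth (- (fps_X * fps_deriv (fps_of_poly (reflect_poly F))) * inverse (fps_of_poly (reflect_poly F))) l"

lemma nth_neg_X_deriv: "fps_nth (- (fps_X * fps_deriv A)) i = - of_nat i * fps_nth A i"
  for A :: "'k::field fps"
  by (cases i) (simp_all add: algebra_simps)

lemma nth_rev: "fps_nth (fps_of_poly (reflect_poly F)) i = (if i \<le> degree F then coeff F (degree F - i) else 0)"
  by (simp add: coeff_reflect_poly)

text \<open>Logarithmic differentiation turns products into sums.\<close>

lemma psum_mult:
  fixes F G :: "'k::field poly"
  assumes "F \<noteq> 0" "G \<noteq> 0"
  shows "psum (F * G) l = psum F l + psum G l"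
proof -
  define A B where "A = fps_of_poly (reflect_poly F)" and "B = fps_of_poly (reflect_poly G)"
  have nz: "fps_nth A 0 \<noteq> 0" "fps_nth B 0 \<noteq> 0" using assms unfolding A_def B_def nth_rev by auto
  have "- (fps_X * fps_deriv (A * B)) * inverse (A * B)
      = - (fps_X * fps_deriv A) * inverse A * (B * inverse B) + - (fps_X * fps_deriv B) * inverse B * (A * inverse A)"
    using nz by (simp add: fps_inverse_mult algebra_simps)
  also have "\<dots> = - (fps_X * fps_deriv A) * inverse A + - (fps_X * fps_deriv B) * inverse B"
    using nz by (simp add: inverse_mult_eq_1')
  finally show ?thesis
    unfolding psum_def reflect_poly_mult fps_of_poly_mult A_def B_def by simp
qed

text \<open>Newton's identities form a single power series equation. It determines
  \<open>\<tau>\<close> because the constant term of the reversed polynomial is the leading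
  coefficient of \<open>F\<close>, hence nonzero.\<close>

lemma psum_unique:
  fixes F :: "'k::field poly"
  assumes "F \<noteq> 0" and newton: "\<And>i. (\<Sum>l\<le>i. fps_nth (fps_of_poly (reflect_poly F)) l * \<tau> (i - l))
      = - of_nat i * fps_nth (fps_of_poly (reflect_poly F)) i"
  shows "\<tau> l = psum F l"
proof -
  define A where "A = fps_of_poly (reflect_poly F)"
  have nz: "fps_nth A 0 \<noteq> 0" using assms unfolding A_def nth_rev by auto
  have "A * Abs_fps \<tau> = - (fps_X * fps_deriv A)"
  proof (rule fps_ext)
    fix i
    show "fps_nth (A * Abs_fps \<tau>) i = fps_nth (- (fps_X * fps_deriv A)) i"
      unfolding nth_neg_X_deriv using newton[of i] by (simp add: fps_mult_nth A_def[symmetric] atLeast0AtMost)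
  qed
  then have "A * inverse A * Abs_fps \<tau> = - (fps_X * fps_deriv A) * inverse A"
    by (metis mult.assoc mult.commute)
  then have "Abs_fps \<tau> = - (fps_X * fps_deriv A) * inverse A"
    using nz by (simp add: inverse_mult_eq_1')
  then show ?thesis unfolding psum_def A_def[symmetric] by (metis fps_nth_Abs_fps)
qed

lemma psum_newton:
  fixes F :: "'k::field poly"
  assumes "F \<noteq> 0"
  shows "(\<Sum>l\<le>i. fps_nth (fps_of_poly (reflect_poly F)) l * psum F (i - l))
      = - of_nat i * fps_nth (fps_of_poly (reflect_poly F)) i"
proof -
  define A where "A = fps_of_poly (reflect_poly F)"
  have nz: "fps_nth A 0 \<noteq> 0" using assms unfolding A_def nth_rev by auto
  have P: "Abs_fps (psum F) = - (fps_X * fps_deriv A) * inverse A"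
    by (rule fps_ext) (simp add: psum_def A_def)
  have "A * Abs_fps (psum F) = - (fps_X * fps_deriv A) * (A * inverse A)"
    unfolding P by (simp only: mult_ac)
  also have "\<dots> = - (fps_X * fps_deriv A)" using nz by (simp add: inverse_mult_eq_1')
  finally have "fps_nth (A * Abs_fps (psum F)) i = fps_nth (- (fps_X * fps_deriv A)) i" by simp
  then show ?thesis
    unfolding nth_neg_X_deriv by (simp add: fps_mult_nth A_def[symmetric] atLeast0AtMost)
qed

section \<open>Dual functionals, spans and traces in coordinates\<close>

definition linf :: "(('i \<Rightarrow> 'k::field) \<Rightarrow> 'k) \<Rightarrow> bool" where
  "linf g \<longleftrightarrow> (\<forall>x y. g (x + y) = g x + g y) \<and> (\<forall>c x. g (smul c x) = c * g x)"

lemma linf_add: "linf g \<Longrightarrow> g (x + y) = g x + g y" and linf_smul: "linf g \<Longrightarrow> g (smul c x) = c * g x"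
  by (auto simp: linf_def)

lemma linf_0: "linf g \<Longrightarrow> g 0 = 0"
  using linf_smul[of g 0 0] by simp

lemma linf_sum: "linf g \<Longrightarrow> g (sum h A) = (\<Sum>i\<in>A. g (h i))"
  by (induction A rule: infinite_finite_induct) (simp_all only: sum.infinite sum.empty sum.insert linf_0 linf_add simp_thms)

lemma linf_comb: "linf g \<Longrightarrow> g (\<Sum>i\<in>A. smul (a i) (P i)) = (\<Sum>i\<in>A. a i * g (P i))"
  by (simp only: linf_sum linf_smul)

lemma indep_dual_functionals:
  assumes "indep m P"
  shows "\<exists>\<xi>. (\<forall>i. linf (\<xi> i)) \<and> (\<forall>i. \<forall>j<m. \<xi> i (P j) = (if i = j then 1 else 0))"
proof -
  have "\<forall>i. \<exists>g. linf g \<and> (\<forall>j<m. g (P j) = (if i = j then 1 else 0))"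
    using indep_functional[OF assms, of "\<lambda>j. if _ = j then 1 else 0"] unfolding linf_def by (simp add: conj_assoc)
  then show ?thesis by metis
qed

definition spn :: "nat \<Rightarrow> (nat \<Rightarrow> 'i \<Rightarrow> 'k::field) \<Rightarrow> ('i \<Rightarrow> 'k) set" where
  "spn m P = range (\<lambda>a. \<Sum>i<m. smul (a i) (P i))"

lemma spn_I: "x = (\<Sum>i<m. smul (a i) (P i)) \<Longrightarrow> x \<in> spn m P"
  by (auto simp: spn_def)

lemma spn_E: "x \<in> spn m P \<Longrightarrow> (\<And>a. x = (\<Sum>i<m. smul (a i) (P i)) \<Longrightarrow> thesis) \<Longrightarrow> thesis"
  by (auto simp: spn_def)

lemma spn_0: "0 \<in> spn m P"
  by (rule spn_I[of _ "\<lambda>_. 0"]) simp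

lemma spn_add: "x \<in> spn m P \<Longrightarrow> y \<in> spn m P \<Longrightarrow> x + y \<in> spn m P"
  by (elim spn_E, rule spn_I[of _ "\<lambda>i. _ i + _ i"]) (simp add: smul_add_left sum.distrib del: sum_fun_apply)

lemma spn_smul: "x \<in> spn m P \<Longrightarrow> smul c x \<in> spn m P"
  by (elim spn_E, rule spn_I[of _ "\<lambda>i. c * _ i"]) (simp add: smul_sum_right del: sum_fun_apply)

lemma spn_sum: "(\<And>i. i \<in> A \<Longrightarrow> f i \<in> spn m P) \<Longrightarrow> sum f A \<in> spn m P"
  by (induction A rule: infinite_finite_induct) (auto simp: spn_0 spn_add simp del: sum_fun_apply)

lemma spn_base: assumes "i < m" shows "P i \<in> spn m P"
proof (rule spn_I[of _ "\<lambda>j. if j = i then 1 else 0"])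
  have "(\<Sum>j<m. smul (if j = i then 1 else 0) (P j)) = (\<Sum>j<m. if j = i then P i else 0)"
    by (intro sum.cong) auto
  then show "P i = (\<Sum>j<m. smul (if j = i then 1 else 0) (P j))" using assms by simp
qed

lemma spn_mono: "(\<And>i. i < m \<Longrightarrow> P i \<in> spn k Q) \<Longrightarrow> spn m P \<subseteq> spn k Q"
  by (auto elim!: spn_E intro!: spn_sum spn_smul simp del: sum_fun_apply)

lemma spn_expand:
  assumes "\<And>i. linf (\<xi> i)" "\<And>i j. j < m \<Longrightarrow> \<xi> i (P j) = (if i = j then 1 else 0)" "x \<in> spn m P"
  shows "x = (\<Sum>i<m. smul (\<xi> i x) (P i))"
proof -
  obtain a where a: "x = (\<Sum>i<m. smul (a i) (P i))" using assms(3) by (rule spn_E)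
  have "\<xi> i x = a i" if "i < m" for i
  proof -
    have "\<xi> i x = (\<Sum>j<m. a j * \<xi> i (P j))" unfolding a by (rule linf_comb[OF assms(1)])
    also have "\<dots> = (\<Sum>j<m. (if j = i then 1 else 0) * a j)" by (intro sum.cong) (auto simp: assms(2))
    finally show ?thesis using that by (simp add: sum_delta_mult)
  qed
  then show ?thesis by (subst a) (intro sum.cong, auto)
qed

text \<open>Basis independence of the trace: expanding \<open>L (w i)\<close> in the second frame
  and swapping the sums reassembles \<open>L (w' j)\<close>. As \<open>S\<close> may be a proper
  subspace, this covers the trace on the cyclic space as well as that on \<open>V n\<close>.\<close>

lemma trace_change_of_frame:
  assumes L: "lin L" and \<xi>: "\<And>i. linf (\<xi> i)" and \<xi>': "\<And>i. linf (\<xi>' i)"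
    and exp: "\<And>x. x \<in> S \<Longrightarrow> x = (\<Sum>i<m. smul (\<xi> i x) (w i))"
    and exp': "\<And>x. x \<in> S \<Longrightarrow> x = (\<Sum>i<m'. smul (\<xi>' i x) (w' i))"
    and w: "\<And>i. i < m \<Longrightarrow> w i \<in> S" and w': "\<And>i. i < m' \<Longrightarrow> w' i \<in> S" and LS: "\<And>x. x \<in> S \<Longrightarrow> L x \<in> S"
  shows "(\<Sum>i<m. \<xi> i (L (w i))) = (\<Sum>i<m'. \<xi>' i (L (w' i)))"
proof -
  have "(\<Sum>i<m. \<xi> i (L (w i))) = (\<Sum>i<m. \<Sum>j<m'. \<xi>' j (L (w i)) * \<xi> i (w' j))"
  proof (intro sum.cong refl)
    fix i assume "i \<in> {..<m}"
    then show "\<xi> i (L (w i)) = (\<Sum>j<m'. \<xi>' j (L (w i)) * \<xi> i (w' j))"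
      by (subst exp'[OF LS[OF w]]) (simp_all only: linf_comb[OF \<xi>] lessThan_iff)
  qed
  also have "\<dots> = (\<Sum>j<m'. \<Sum>i<m. \<xi> i (w' j) * \<xi>' j (L (w i)))"
    by (subst sum.swap) (simp only: mult.commute)
  also have "\<dots> = (\<Sum>j<m'. \<xi>' j (L (w' j)))"
  proof (intro sum.cong refl)
    fix j assume "j \<in> {..<m'}"
    then have "L (w' j) = (\<Sum>i<m. smul (\<xi> i (w' j)) (L (w i)))"
      using lin_comb[OF L] exp[OF w', of j] by (metis lessThan_iff)
    then show "(\<Sum>i<m. \<xi> i (w' j) * \<xi>' j (L (w i))) = \<xi>' j (L (w' j))"
      by (simp only: linf_comb[OF \<xi>'])
  qed
  finally show ?thesis .
qed

text \<open>The sums \<open>\<tau>\<close> of diagonal coefficients satisfy Newton's identities for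
  \<open>F\<close>, which determine them.\<close>

lemma cyclic_trace:
  fixes F :: "'k::field poly"
  assumes L: "lin L" and F: "lead_coeff F = 1" "degree F = m" and ann: "pact L F v = 0"
    and \<xi>: "\<And>i. i < m \<Longrightarrow> linf (\<xi> i)" and dual: "\<And>i j. i < m \<Longrightarrow> j < m \<Longrightarrow> \<xi> i ((L ^^ j) v) = (if i = j then 1 else 0)"
    and l: "l \<ge> 1"
  shows "(\<Sum>i<m. \<xi> i ((L ^^ l) ((L ^^ i) v))) = psum F l"
proof -
  define a where "a i = fps_nth (fps_of_poly (reflect_poly F)) i" for i
  have a: "a i = (if i \<le> m then coeff F (m - i) else 0)" for i unfolding a_def nth_rev F(2) ..
  define x where "x j = (L ^^ j) v" for j
  \<comment> \<open>Index 0 is set to 0 to agree with \<open>psum F 0\<close>; the trace of the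
    identity would be \<open>m\<close>.\<close>
  define \<tau> where "\<tau> i = (if i = 0 then 0 else \<Sum>j<m. \<xi> j (x (i + j)))" for i
  have rel: "(\<Sum>l\<le>m. smul (a l) (x (m + k - l))) = 0" for k
  proof -
    have "(\<Sum>l\<le>m. smul (a l) (x (m + k - l))) = (\<Sum>i\<le>m. smul (coeff F i) (x (i + k)))"
      by (rule sum.reindex_bij_witness[of _ "\<lambda>i. m - i" "\<lambda>i. m - i"]) (auto simp: a)
    also have "\<dots> = pact L F (x k)"
      unfolding pact_def F(2) x_def by (simp add: funpow_add)
    also have "\<dots> = 0"
      unfolding x_def pact_funpow[OF L, symmetric] ann by (rule lin_0[OF lin_funpow[OF L]])
    finally show ?thesis .
  qed
  \<comment> \<open>If \<open>j + i < m\<close>, duality leaves only the term \<open>l = i\<close>.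
    Otherwise the sum extends to the full relation \<open>rel\<close>, since additional indices
    \<open>l > i\<close> have \<open>i + j - l < j\<close>, where \<open>\<xi> j\<close>
    vanishes.\<close>
  have diag: "(\<Sum>l\<le>i. a l * \<xi> j (x (i - l + j))) = (if j + i < m then a i else 0)" if "j < m" for i j
  proof (cases "j + i < m")
    case True
    have "(\<Sum>l\<le>i. a l * \<xi> j (x (i - l + j))) = (\<Sum>l\<le>i. if l = i then a i else 0)"
      using True that by (intro sum.cong refl) (auto simp: x_def dual)
    then show ?thesis using True by simp
  next
    case False
    have eq: "(\<Sum>l\<le>i. a l * \<xi> j (x (i - l + j))) = (\<Sum>l\<le>min i m. a l * \<xi> j (x (i + j - l)))"
      by (rule sum.mono_neutral_cong_right) (auto simp: a)
    have "0 = \<xi> j (\<Sum>l\<le>m. smul (a l) (x (m + (i + j - m) - l)))"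
      unfolding rel linf_0[OF \<xi>[OF that]] ..
    also have "\<dots> = (\<Sum>l\<le>m. a l * \<xi> j (x (i + j - l)))"
      using False by (simp add: linf_comb[OF \<xi>[OF that]] del: sum_fun_apply)
    also have "\<dots> = (\<Sum>l\<le>min i m. a l * \<xi> j (x (i + j - l)))"
    proof (rule sum.mono_neutral_right)
      show "\<forall>l\<in>{..m} - {..min i m}. a l * \<xi> j (x (i + j - l)) = 0"
      proof
        fix l assume "l \<in> {..m} - {..min i m}"
        then have "i < l" "l \<le> m" by auto
        then have "\<xi> j (x (i + j - l)) = 0" using False that by (simp add: x_def dual)
        then show "a l * \<xi> j (x (i + j - l)) = 0" by simp
      qed
    qed auto
    finally show ?thesis using eq False by simp
  qed
  have tr: "(\<Sum>l\<le>i. a l * (\<Sum>j<m. \<xi> j (x (i - l + j)))) = of_nat (m - i) * a i" for i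
  proof -
    have "(\<Sum>l\<le>i. a l * (\<Sum>j<m. \<xi> j (x (i - l + j)))) = (\<Sum>j<m. \<Sum>l\<le>i. a l * \<xi> j (x (i - l + j)))"
      unfolding sum_distrib_left by (rule sum.swap)
    also have "\<dots> = (\<Sum>j<m. if j + i < m then a i else 0)" by (intro sum.cong refl) (rule diag, simp)
    also have "\<dots> = (\<Sum>j<m - i. a i)"
      by (rule sum.mono_neutral_cong_right) auto
    finally show ?thesis by simp
  qed
  have "(\<Sum>l\<le>i. a l * \<tau> (i - l)) = - of_nat i * a i" for i
  proof -
    have d0: "(\<Sum>j<m. \<xi> j (x j)) = of_nat m" by (simp add: x_def dual)
    have "(\<Sum>l\<le>i. a l * \<tau> (i - l)) = (\<Sum>l<i. a l * (\<Sum>j<m. \<xi> j (x (i - l + j))))"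
      by (rule sum.mono_neutral_cong_right) (auto simp: \<tau>_def)
    also have "\<dots> = of_nat (m - i) * a i - a i * of_nat m"
      using tr[of i] d0 by (simp add: lessThan_Suc_atMost[symmetric] eq_diff_eq)
    also have "\<dots> = - of_nat i * a i"
      by (cases "i \<le> m") (auto simp: of_nat_diff algebra_simps a)
    finally show ?thesis .
  qed
  then have "\<tau> l = psum F l"
    unfolding a_def by (intro psum_unique) (use F in auto)
  then show ?thesis using l by (simp add: \<tau>_def x_def funpow_add)
qed

section \<open>Minimal polynomials of vectors\<close>

definition is_minpoly :: "(('i \<Rightarrow> 'k::field) \<Rightarrow> 'i \<Rightarrow> 'k) \<Rightarrow> ('i \<Rightarrow> 'k) \<Rightarrow> 'k poly \<Rightarrow> bool" where
  "is_minpoly T v F \<longleftrightarrow> lead_coeff F = 1 \<and> (\<forall>G. pact T G v = 0 \<longleftrightarrow> F dvd G)"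

lemma ex_minpoly:
  fixes F0 :: "'k::field poly"
  assumes T: "lin T" and F0: "F0 \<noteq> 0" "pact T F0 v = 0"
  shows "\<exists>F. is_minpoly T v F"
proof -
  obtain F1 where F1: "F1 \<noteq> 0" "pact T F1 v = 0" "\<And>G. G \<noteq> 0 \<Longrightarrow> pact T G v = 0 \<Longrightarrow> degree F1 \<le> degree G"
    using F0 ex_has_least_nat[of "\<lambda>F. F \<noteq> 0 \<and> pact T F v = 0" F0 degree] by blast
  define F where "F = smult (inverse (lead_coeff F1)) F1"
  have F: "lead_coeff F = 1" "degree F = degree F1" "pact T F v = 0"
    using F1 by (auto simp: F_def pact_smult)
  have "F dvd G" if "pact T G v = 0" for G
  proof -
    have "pact T (G - (G div F) * F) v = 0"
      unfolding pact_diff pact_mult[OF T] F(3) that by (simp add: lin_0[OF lin_pact[OF T]])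
    then have z: "pact T (G mod F) v = 0" by (simp add: minus_div_mult_eq_mod)
    have "G mod F = 0"
    proof (rule ccontr)
      assume "G mod F \<noteq> 0"
      moreover have "F \<noteq> 0" using F(1) by auto
      ultimately show False using F1(3)[OF _ z] degree_mod_less[of F G] F(2) by auto
    qed
    then show ?thesis by auto
  qed
  moreover have "pact T G v = 0" if FG: "F dvd G" for G
  proof -
    obtain H where "G = H * F" using FG by (metis dvd_def mult.commute)
    then show ?thesis using F(3) by (simp add: pact_mult[OF T] lin_0[OF lin_pact[OF T]])
  qed
  ultimately show ?thesis using F(1) unfolding is_minpoly_def by blast
qed

lemma monic_dvd_antisym:
  fixes F G :: "'k::field poly"
  assumes "lead_coeff F = 1" "lead_coeff G = 1" "F dvd G" "degree G \<le> degree F"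
  shows "F = G"
proof -
  obtain H where H: "G = F * H" using assms(3) by (rule dvdE)
  have "F \<noteq> 0" "H \<noteq> 0" using assms(1,2) H by auto
  then have "degree H = 0" using assms(4) by (simp add: H degree_mult_eq)
  then obtain c where "H = [:c:]" by (rule degree_eq_zeroE)
  moreover have "lead_coeff H = 1" using assms(1,2) unfolding H lead_coeff_mult by simp
  ultimately show ?thesis using H by simp
qed

lemma is_minpoly_monic: "is_minpoly T v F \<Longrightarrow> lead_coeff F = 1"
  and is_minpoly_iff: "is_minpoly T v F \<Longrightarrow> pact T G v = 0 \<longleftrightarrow> F dvd G"
  unfolding is_minpoly_def by blast+

lemma is_minpoly_ann: "is_minpoly T v F \<Longrightarrow> pact T F v = 0"
  by (simp add: is_minpoly_iff)

lemma is_minpoly_unique: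
  assumes F: "is_minpoly T v F" and G: "is_minpoly T v G" shows "F = G"
proof (rule monic_dvd_antisym)
  have "G dvd F" using is_minpoly_iff[OF G] is_minpoly_ann[OF F] by blast
  moreover have "F \<noteq> 0" using is_minpoly_monic[OF F] by auto
  ultimately show "degree G \<le> degree F" by (rule dvd_imp_degree_le)
  show "F dvd G" using is_minpoly_iff[OF F] is_minpoly_ann[OF G] by blast
qed (rule is_minpoly_monic[OF F] is_minpoly_monic[OF G])+

lemma is_minpoly_small:
  assumes "is_minpoly T v F" "pact T G v = 0" "degree G < degree F" shows "G = 0"
  using assms(3) dvd_imp_degree_le[of F G] is_minpoly_iff[OF assms(1), of G] assms(2) by linarith

text \<open>A factor \<open>X\<close> could be cancelled because \<open>T\<close> is injective,
  against minimality.\<close>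

lemma is_minpoly_coeff_0:
  assumes F: "is_minpoly T v F" and T: "lin T" "\<And>x. T x = 0 \<Longrightarrow> x = 0"
  shows "coeff F 0 \<noteq> 0"
proof
  assume "coeff F 0 = 0"
  then obtain G where G: "F = pCons 0 G" by (metis coeff_pCons_0 pCons_cases)
  then have nz: "G \<noteq> 0" using is_minpoly_monic[OF F] by auto
  have "T (pact T G v) = 0" using is_minpoly_ann[OF F] unfolding G pact_pCons[OF T(1)] by simp
  then have "pact T G v = 0" by (rule T(2))
  then have "F dvd G" using is_minpoly_iff[OF F] by blast
  then have "degree F \<le> degree G" using nz by (rule dvd_imp_degree_le)
  then show False using nz by (simp add: G)
qed

section \<open>Krylov frames\<close>

text \<open>Under the shift, the minimal polynomial of a sequence is that of the shortest recurrence
  it satisfies. The index set is \<open>int\<close> because isometries are invertible.\<close>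

definition sh :: "(int \<Rightarrow> 'k) \<Rightarrow> int \<Rightarrow> 'k" where "sh s = (\<lambda>j. s (j + 1))"

lemma lin_sh: "lin (sh :: (int \<Rightarrow> 'k::field) \<Rightarrow> _)"
  by (auto simp: lin_def sh_def)

lemma sh_pow: "(sh ^^ i) s j = s (j + int i)"
  by (induction i arbitrary: j) (auto simp: sh_def algebra_simps)

lemma sh_eq_0D: "sh s = 0 \<Longrightarrow> s = (0 :: int \<Rightarrow> 'k::field)"
proof
  fix j assume "sh s = 0"
  then have "sh s (j - 1) = 0" by (simp only: zero_fun_apply)
  then show "s j = 0 j" by (simp add: sh_def)
qed

lemma pact_sh: "pact sh F s j = (\<Sum>i\<le>degree F. coeff F i * s (j + int i))"
  by (simp add: pact_def sh_pow)

text \<open>A window of \<open>degree D\<close> zeros propagates upwards through the leading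
  coefficient and downwards through the nonzero constant coefficient.\<close>

lemma recurrence_zero:
  fixes D :: "'k::field poly"
  assumes D: "lead_coeff D = 1" "coeff D 0 \<noteq> 0" and rec: "pact sh D t = 0"
    and z: "\<And>i. i < degree D \<Longrightarrow> t (c + int i) = 0"
  shows "t = 0"
proof -
  let ?d = "degree D"
  have rec': "(\<Sum>i\<le>?d. coeff D i * t (j + int i)) = 0" for j
    using fun_cong[OF rec, of j] by (simp add: pact_sh)
  have up: "t (c + int k) = 0" for k
  proof (induction k rule: less_induct)
    case (less k)
    show ?case
    proof (cases "k < ?d")
      case False
      have "0 = (\<Sum>i\<le>?d. coeff D i * t (c + int (k - ?d) + int i))" using rec' by simp
      also have "\<dots> = t (c + int k) + (\<Sum>i<?d. coeff D i * t (c + int (k - ?d) + int i))"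
        using False D(1) by (simp add: lessThan_Suc_atMost[symmetric] of_nat_diff)
      also have "(\<Sum>i<?d. coeff D i * t (c + int (k - ?d) + int i)) = 0"
      proof (intro sum.neutral ballI)
        fix i assume "i \<in> {..<?d}"
        then have "t (c + int (k - ?d + i)) = 0" using False by (intro less) auto
        then show "coeff D i * t (c + int (k - ?d) + int i) = 0" by (simp add: add.assoc)
      qed
      finally show ?thesis by simp
    qed (rule z)
  qed
  have down: "t (c - int k) = 0" for k
  proof (induction k rule: less_induct)
    case (less k)
    have "0 = (\<Sum>i\<le>?d. coeff D i * t (c - int k + int i))" using rec' by simp
    also have "\<dots> = coeff D 0 * t (c - int k) + (\<Sum>i\<in>{1..?d}. coeff D i * t (c - int k + int i))"
      by (subst sum.atMost_shift) (simp add: sum.atLeast1_atMost_eq)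
    also have "(\<Sum>i\<in>{1..?d}. coeff D i * t (c - int k + int i)) = 0"
    proof (intro sum.neutral ballI)
      fix i assume i: "i \<in> {1..?d}"
      have "t (c - int k + int i) = 0"
      proof (cases "i \<le> k")
        case True
        then have "t (c - int (k - i)) = 0" using i by (intro less) auto
        then show ?thesis using True by (simp add: of_nat_diff algebra_simps)
      next
        case False
        then show ?thesis using up[of "i - k"] by (simp add: of_nat_diff algebra_simps)
      qed
      then show "coeff D i * t (c - int k + int i) = 0" by simp
    qed
    finally show ?case using D(2) by simp
  qed
  show ?thesis
  proof
    fix j show "t j = 0 j"
      using up[of "nat (j - c)"] down[of "nat (c - j)"] by (cases "j \<ge> c") auto
  qed
qed

definition toep :: "(int \<Rightarrow> 'k) \<Rightarrow> nat \<Rightarrow> nat \<Rightarrow> 'k" where "toep s i j = s (int j - int i)"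

text \<open>A kernel vector \<open>a\<close> is a polynomial of degree below
  \<open>degree D\<close>. Applied to \<open>s\<close> it gives a sequence that satisfies the
  recurrence \<open>D\<close> and vanishes at \<open>degree D\<close> consecutive places, hence
  everywhere; by minimality of \<open>D\<close> the polynomial is 0.\<close>

lemma nonsing_toep:
  fixes D :: "'k::field poly"
  assumes D: "is_minpoly sh s D"
  shows "nonsing (degree D) (toep s)"
  unfolding nonsing_def
proof (intro allI impI)
  let ?d = "degree D"
  fix a j assume a: "\<forall>i<?d. (\<Sum>j<?d. toep s i j * a j) = 0" and j: "j < ?d"
  define t where "t = pact sh (polyof ?d a) s"
  have t: "t (- int i) = 0" if "i < ?d" for i
  proof -
    have "t (- int i) = (\<Sum>j<?d. toep s i j * a j)"
      unfolding t_def pact_polyof by (simp add: sh_pow toep_def mult.commute)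
    then show ?thesis using a that by simp
  qed
  have "t = 0"
  proof (rule recurrence_zero)
    show "lead_coeff D = 1" using is_minpoly_monic[OF D] .
    show "coeff D 0 \<noteq> 0" by (rule is_minpoly_coeff_0[OF D lin_sh sh_eq_0D])
    show "pact sh D t = 0" unfolding t_def
      by (subst pact_commute[OF lin_sh]) (simp add: is_minpoly_ann[OF D] lin_0[OF lin_pact[OF lin_sh]])
    show "t (- int (?d - 1) + int i) = 0" if "i < ?d" for i
      using t[of "?d - 1 - i"] that by (simp add: of_nat_diff algebra_simps)
  qed
  moreover have "degree (polyof ?d a) < ?d" using j by (intro degree_polyof_less) linarith
  ultimately have "polyof ?d a = 0" unfolding t_def by (intro is_minpoly_small[OF D])
  then show "a j = 0" using j by (rule polyof_eq_0D)
qed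

lemma sum_lessThan_add: "(\<Sum>i<r + d. f i) = (\<Sum>i<r. f i) + (\<Sum>i<d. f (r + i :: nat))"
  for f :: "nat \<Rightarrow> 'b::comm_monoid_add"
  by (induction d) (auto simp: add.assoc)

text \<open>A basis of the cyclic space of \<open>v\<close> adapted to its radical, which is generated by \<open>D(f) v\<close>.\<close>
definition Wfr :: "nat \<Rightarrow> 'k::field poly \<Rightarrow> ((nat \<Rightarrow> 'k) \<Rightarrow> nat \<Rightarrow> 'k) \<Rightarrow> (nat \<Rightarrow> 'k) \<Rightarrow> nat \<Rightarrow> nat \<Rightarrow> 'k" where
  "Wfr r D f v i = (if i < r then (f ^^ i) (pact f D v) else (f ^^ (i - r)) v)"

lemma comb_Wfr:
  assumes "lin f"
  shows "(\<Sum>i<r + d. smul (a i) (Wfr r D f v i)) = pact f (polyof r a * D + polyof d (\<lambda>i. a (r + i))) v"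
  unfolding sum_lessThan_add pact_add pact_mult[OF assms] pact_polyof by (simp add: Wfr_def)

lemma deg_comb_less:
  assumes "degree D = d" "d + r > 0"
  shows "degree (polyof r a * D + polyof d b) < r + d"
proof (cases "r = 0")
  case True
  then show ?thesis using assms degree_polyof_less[of d b] by (simp add: polyof_0)
next
  case False
  have "degree (polyof r a * D) < r + d"
    using degree_mult_le[of "polyof r a" D] degree_polyof_less[of r a] False assms by linarith
  moreover have "degree (polyof d b) < r + d"
    using degree_polyof_less[of d b] False by (cases "d = 0") (auto simp: polyof_0)
  ultimately show ?thesis by (rule degree_add_less)
qed

text \<open>A relation is a polynomial \<open>A * D + B\<close> of degree below that of
  \<open>F\<close> which annihilates \<open>v\<close>, so it is 0; division with remainder by
  \<open>D\<close> separates \<open>A\<close> from \<open>B\<close>.\<close>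

lemma indep_Wfr:
  fixes D F :: "'k::field poly"
  assumes f: "lin f" and F: "is_minpoly f v F" and D: "D \<noteq> 0" and deg: "degree D = d" "degree F = r + d"
  shows "indep (r + d) (Wfr r D f v)"
  unfolding indep_def
proof (intro allI impI)
  fix a i assume z: "(\<Sum>i<r + d. smul (a i) (Wfr r D f v i)) = 0" and i: "i < r + d"
  let ?A = "polyof r a" and ?B = "polyof d (\<lambda>i. a (r + i))"
  have "degree (?A * D + ?B) < degree F"
    unfolding deg(2) by (rule deg_comb_less[OF deg(1)]) (use i in linarith)
  then have G: "?A * D + ?B = 0"
    using z unfolding comb_Wfr[OF f] by (intro is_minpoly_small[OF F])
  have B: "?B = 0"
  proof (cases "d = 0")
    case False
    have "?B = - (?A * D)" using G by (simp add: eq_neg_iff_add_eq_0 add.commute)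
    then have "D dvd ?B" by simp
    then show ?thesis using degree_polyof_less[of d "\<lambda>i. a (r + i)"] False deg dvd_imp_degree_le[of D ?B] by linarith
  qed (simp add: polyof_0)
  then have "?A = 0" using G D by simp
  then have "a i = 0" if "i < r" using polyof_eq_0D that by blast
  moreover have "a i = 0" if "r \<le> i"
    using polyof_eq_0D[OF B, of "i - r"] that i by auto
  ultimately show "a i = 0" by linarith
qed

context hermitian_field
begin

definition herm_seq :: "(int \<Rightarrow> 'a) \<Rightarrow> bool" where
  "herm_seq s \<longleftrightarrow> (\<forall>j. s (- j) = cj (s j))"

text \<open>\<open>\<langle>v, f^j v\<rangle>\<close> for all integers \<open>j\<close>, written without \<open>inv f\<close>.\<close>
definition sq :: "nat \<Rightarrow> ((nat \<Rightarrow> 'a) \<Rightarrow> nat \<Rightarrow> 'a) \<Rightarrow> (nat \<Rightarrow> 'a) \<Rightarrow> int \<Rightarrow> 'a" where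
  "sq n f v j = (if j \<ge> 0 then ip n v ((f ^^ nat j) v) else ip n ((f ^^ nat (- j)) v) v)"

lemma ip_funpow:
  assumes "f \<in> U n" shows "ip n ((f ^^ a) v) ((f ^^ b) v) = sq n f v (int b - int a)"
proof (cases "a \<le> b")
  case True
  then obtain c where b: "b = a + c" using le_Suc_ex by blast
  show ?thesis unfolding b funpow_add comp_apply U_ip[OF U_funpow[OF assms]] by (simp add: sq_def)
next
  case False
  then obtain c where a: "a = b + c" using le_Suc_ex nat_le_linear by blast
  then have "c > 0" using False by simp
  then show ?thesis unfolding a funpow_add comp_apply U_ip[OF U_funpow[OF assms]] by (simp add: sq_def)
qed

lemma herm_seq_sq: "herm_seq (sq n f v)"
  unfolding herm_seq_def sq_def using ip_sym[of n] by (auto simp flip: ip_sym)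

lemma ip_funpow_pact:
  assumes "f \<in> U n"
  shows "ip n ((f ^^ a) v) ((f ^^ b) (pact f G v)) = pact sh G (sq n f v) (int b - int a)"
proof -
  have "ip n ((f ^^ a) v) ((f ^^ b) (pact f G v)) = (\<Sum>i\<le>degree G. coeff G i * ip n ((f ^^ a) v) ((f ^^ (b + i)) v))"
    unfolding pact_def lin_comb[OF lin_funpow[OF U_lin[OF assms]]] ip_sum ip_smul funpow_add comp_apply ..
  also have "\<dots> = pact sh G (sq n f v) (int b - int a)"
    unfolding ip_funpow[OF assms] pact_sh by (simp add: algebra_simps)
  finally show ?thesis .
qed

lemma pact_sh_sq:
  assumes "f \<in> U n" "pact f G v = 0" shows "pact sh G (sq n f v) = 0"
proof
  fix j :: int
  have "pact sh G (sq n f v) j = ip n ((f ^^ nat (- j)) v) ((f ^^ nat j) (pact f G v))"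
    unfolding ip_funpow_pact[OF assms(1)] by (cases "j \<ge> 0") auto
  then show "pact sh G (sq n f v) j = 0 j"
    by (simp add: assms(2) lin_0[OF lin_funpow[OF U_lin[OF assms(1)]]] ip_0)
qed

lemma toep_herm: "herm_seq s \<Longrightarrow> toep s j i = cj (toep s i j)"
  unfolding herm_seq_def toep_def by (metis minus_diff_eq)

text \<open>Since \<open>D\<close> annihilates the sequence, \<open>D(f) v\<close> and its images
  are orthogonal to the whole cyclic space; the remaining vectors have a Toeplitz Gram
  matrix.\<close>

lemma gram_Wfr:
  assumes f: "f \<in> U n" and D: "pact sh D (sq n f v) = 0" and ij: "i < r + d" "j < r + d"
  shows "ip n (Wfr r D f v i) (Wfr r D f v j) = gramJ r d (toep (sq n f v)) i j"
proof -
  note lf = U_lin[OF f]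
  have 1: "ip n ((f ^^ k) v) ((f ^^ l) (pact f D v)) = 0" for k l
    unfolding ip_funpow_pact[OF f] D by simp
  have 2: "ip n (pact f G v) ((f ^^ l) (pact f D v)) = 0" for G l
    unfolding pact_def[of f G] ip_sum_left ip_smul_left 1 by simp
  have 3: "ip n ((f ^^ l) (pact f D v)) (pact f G v) = 0" for G l
    by (subst ip_sym) (simp add: 2)
  have 4: "(f ^^ k) v = pact f (monom 1 k) v" for k by (simp add: pact_monom)
  show ?thesis
  proof (cases "i < r")
    case True
    then have "ip n (Wfr r D f v i) (Wfr r D f v j) = 0"
      using 3[of i "monom 1 j * D"] 3[of i "monom 1 (j - r)"]
      by (auto simp: Wfr_def pact_mult[OF lf] pact_monom)
    then show ?thesis using True ij by (auto simp: gramJ_def)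
  next
    case False
    show ?thesis
    proof (cases "j < r")
      case True
      then show ?thesis using False ij 1 by (auto simp: Wfr_def gramJ_def)
    next
      case j: False
      then show ?thesis using False ij by (auto simp: Wfr_def gramJ_def ip_funpow[OF f] toep_def of_nat_diff)
    qed
  qed
qed

end

definition trU :: "nat \<Rightarrow> ((nat \<Rightarrow> 'k::field) \<Rightarrow> nat \<Rightarrow> 'k) \<Rightarrow> 'k" where
  "trU n f = (\<Sum>i<n. f (ax i) i)"

locale orthonormal_frame = hermitian_field p rr q ty
  for p rr q and ty :: "'a::{finite,field} itself" +
  fixes n n1 :: nat and Y :: "nat \<Rightarrow> nat \<Rightarrow> 'a"
  assumes YV: "i < n1 \<Longrightarrow> Y i \<in> V n"
    and Yo: "i < n1 \<Longrightarrow> j < n1 \<Longrightarrow> ip n (Y i) (Y j) = (if i = j then 1 else 0)"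
begin

text \<open>\<open>\<iota>\<close> embeds the standard space of dimension \<open>n1\<close>
  isometrically onto the span of \<open>Y\<close>, and \<open>\<pi>\<close> is its adjoint;
  \<open>ext h\<close> lets \<open>h\<close> act on that span and fixes its orthogonal complement.
  That \<open>compress f\<close> is again an isometry needs the setting of
  \<open>cyclic_frame\<close>.\<close>

definition \<iota> :: "(nat \<Rightarrow> 'a) \<Rightarrow> nat \<Rightarrow> 'a" where "\<iota> x = (\<Sum>i<n1. smul (x i) (Y i))"
definition \<pi> :: "(nat \<Rightarrow> 'a) \<Rightarrow> nat \<Rightarrow> 'a" where "\<pi> x = (\<lambda>i. if i < n1 then ip n (Y i) x else 0)"
definition compress :: "((nat \<Rightarrow> 'a) \<Rightarrow> nat \<Rightarrow> 'a) \<Rightarrow> (nat \<Rightarrow> 'a) \<Rightarrow> nat \<Rightarrow> 'a" where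
  "compress f x = \<pi> (f (\<iota> x)) + (x - tr n1 x)"
definition ext :: "((nat \<Rightarrow> 'a) \<Rightarrow> nat \<Rightarrow> 'a) \<Rightarrow> (nat \<Rightarrow> 'a) \<Rightarrow> nat \<Rightarrow> 'a" where
  "ext h x = x - \<iota> (\<pi> x) + \<iota> (h (\<pi> x))"

lemma lin_\<iota>: "lin \<iota>"
  unfolding lin_def \<iota>_def by (simp add: smul_add_left sum.distrib smul_sum_right del: sum_fun_apply)

lemma lin_\<pi>: "lin \<pi>"
  unfolding lin_def \<pi>_def by (auto simp: fun_eq_iff ip_add ip_smul)

lemma \<iota>_V [simp]: "\<iota> x \<in> V n"
  unfolding \<iota>_def using YV by (intro V_sum V_smul) auto

lemma \<pi>_V [simp]: "\<pi> x \<in> V n1"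
  by (auto simp: \<pi>_def V_def)

lemma \<iota>_tr: "\<iota> (tr n1 x) = \<iota> x"
  unfolding \<iota>_def tr_def by (intro sum.cong) auto

lemma \<pi>_tr: "\<pi> (tr n x) = \<pi> x"
  by (auto simp: \<pi>_def ip_tr fun_eq_iff)

lemma ip_\<iota>: "ip n (\<iota> a) x = ip n1 a (\<pi> x)"
  unfolding \<iota>_def ip_sum_left ip_smul_left by (auto simp: ip_def[of n1] \<pi>_def)

lemma ip_\<iota>_right: "ip n x (\<iota> a) = ip n1 (\<pi> x) a"
  using ip_\<iota>[of a x] ip_sym[of n x "\<iota> a"] ip_sym[of n1 "\<pi> x" a] by simp

lemma \<pi>_\<iota>: "\<pi> (\<iota> a) = tr n1 a"
proof
  fix i
  have "ip n (Y i) (\<iota> a) = a i" if "i < n1"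
  proof -
    have "ip n (Y i) (\<iota> a) = (\<Sum>j<n1. a j * ip n (Y i) (Y j))" unfolding \<iota>_def ip_sum ip_smul ..
    also have "\<dots> = (\<Sum>j<n1. (if i = j then 1 else 0) * a j)" using that by (intro sum.cong) (auto simp: Yo)
    finally show ?thesis using that by (simp add: sum_delta_mult)
  qed
  then show "\<pi> (\<iota> a) i = tr n1 a i" by (simp add: \<pi>_def tr_def)
qed

lemma \<iota>_ax: "i < n1 \<Longrightarrow> \<iota> (ax i) = Y i"
proof -
  assume "i < n1"
  have "\<iota> (ax i) = (\<Sum>j<n1. if j = i then Y i else 0)" unfolding \<iota>_def by (intro sum.cong) (auto simp: ax_apply)
  then show ?thesis using \<open>i < n1\<close> by simp
qed

lemma ext_U:
  assumes h: "h \<in> U n1" shows "ext h \<in> U n"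
proof -
  note lh = U_lin[OF h]
  have "lin (ext h)"
    unfolding lin_def ext_def
    by (auto simp: lin_add[OF lin_\<pi>] lin_add[OF lin_\<iota>] lin_add[OF lh] lin_smul[OF lin_\<pi>] lin_smul[OF lin_\<iota>] lin_smul[OF lh]
        smul_add_right smul_diff_right algebra_simps simp del: plus_fun_apply)
  moreover have "ip n (ext h x) (ext h y) = ip n x y" for x y
  proof -
    have o: "ip n (x - \<iota> (\<pi> x)) (\<iota> a) = 0" for x a
      by (simp add: ip_diff_left ip_\<iota>_right \<pi>_\<iota> ip_tr)
    have o': "ip n (\<iota> a) (x - \<iota> (\<pi> x)) = 0" for x a
      by (subst ip_sym) (simp add: o)
    have i: "ip n (\<iota> a) (\<iota> b) = ip n1 a b" for a b by (simp add: ip_\<iota> \<pi>_\<iota> ip_tr)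
    have "ip n (ext h x) (ext h y) = ip n (x - \<iota> (\<pi> x)) (y - \<iota> (\<pi> y)) + ip n1 (h (\<pi> x)) (h (\<pi> y))"
      unfolding ext_def ip_add ip_add_left by (simp only: o o' i add_0 add_0_right)
    also have "ip n1 (h (\<pi> x)) (h (\<pi> y)) = ip n (\<iota> (\<pi> x)) (\<iota> (\<pi> y))" by (simp only: U_ip[OF h] i)
    also have "ip n (x - \<iota> (\<pi> x)) (y - \<iota> (\<pi> y)) + \<dots> = ip n ((x - \<iota> (\<pi> x)) + \<iota> (\<pi> x)) ((y - \<iota> (\<pi> y)) + \<iota> (\<pi> y))"
      unfolding ip_add ip_add_left by (simp only: o o' add_0 add_0_right)
    finally show ?thesis by (simp only: diff_add_cancel)
  qed
  moreover have "ext h x \<in> V n" if "x \<in> V n" for x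
    unfolding ext_def using that by (intro V_add V_diff) auto
  moreover have "ext h x = x" if "tr n x = 0" for x
  proof -
    have "\<pi> x = 0" using \<pi>_tr[of x] that lin_0[OF lin_\<pi>] by simp
    then show ?thesis unfolding ext_def by (simp add: lin_0[OF lin_\<iota>] lin_0[OF lh])
  qed
  ultimately show ?thesis by (simp add: U_def)
qed

lemma ext_\<iota>: "h \<in> U n1 \<Longrightarrow> ext h (\<iota> x) = \<iota> (h x)"
  using U_split[of h n1 x] \<iota>_tr[of "h x"] \<iota>_tr[of x] lin_add[OF lin_\<iota>, of "h (tr n1 x)" "x - tr n1 x"] lin_diff[OF lin_\<iota>, of x "tr n1 x"]
  unfolding ext_def \<pi>_\<iota> by simp

lemma ext_fix:
  assumes "h \<in> U n1" "\<pi> x = 0" shows "ext h x = x"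
  unfolding ext_def assms(2) by (simp add: lin_0[OF lin_\<iota>] lin_0[OF U_lin[OF assms(1)]])

lemma lin_compress:
  assumes "lin f" shows "lin (compress f)"
  unfolding lin_def compress_def
proof (intro conjI allI)
  show "\<pi> (f (\<iota> (x + y))) + (x + y - tr n1 (x + y))
      = \<pi> (f (\<iota> x)) + (x - tr n1 x) + (\<pi> (f (\<iota> y)) + (y - tr n1 y))" for x y
    unfolding lin_add[OF lin_\<pi>] lin_add[OF lin_\<iota>] lin_add[OF assms] tr_add by (simp only: add_ac add_diff_add)
  show "\<pi> (f (\<iota> (smul c x))) + (smul c x - tr n1 (smul c x)) = smul c (\<pi> (f (\<iota> x)) + (x - tr n1 x))" for c x
    unfolding lin_smul[OF lin_\<pi>] lin_smul[OF lin_\<iota>] lin_smul[OF assms] tr_smul smul_add_right smul_diff_right ..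
qed

text \<open>Right translation by \<open>ext h\<close> becomes right translation by \<open>h\<close>
  in the smaller group, which is what allows averaging over \<open>U n1\<close>.\<close>

lemma compress_ext: "h \<in> U n1 \<Longrightarrow> compress (f \<circ> ext h) = compress f \<circ> h"
proof
  fix x assume h: "h \<in> U n1"
  have 1: "h x = h (tr n1 x) + (x - tr n1 x)" by (rule U_split[OF h])
  have "tr n1 (h x) = h (tr n1 x)"
    unfolding 1 tr_add tr_diff_tr using U_V[OF h, of "tr n1 x"] by (simp add: tr_id)
  then have "h x - tr n1 (h x) = x - tr n1 x" using 1 by (metis add_diff_cancel_left')
  then show "compress (f \<circ> ext h) x = (compress f \<circ> h) x"
    unfolding compress_def comp_apply ext_\<iota>[OF h] by simp
qed

end

section \<open>Traces along the flag of a cyclic subspace\<close>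

text \<open>The monic polynomial whose roots are the inverses of those of \<open>B\<close>.\<close>

definition monic_rev :: "'k::field poly \<Rightarrow> 'k poly" where
  "monic_rev B = smult (inverse (coeff B 0)) (reflect_poly B)"

lemma monic_rev:
  assumes "coeff B 0 \<noteq> 0"
  shows "lead_coeff (monic_rev B) = 1" "degree (monic_rev B) = degree B"
proof -
  show d: "degree (monic_rev B) = degree B" using assms by (simp add: monic_rev_def)
  show "lead_coeff (monic_rev B) = 1" unfolding d using assms by (simp add: monic_rev_def coeff_reflect_poly)
qed

text \<open>The frame \<open>P\<close> is a parameter next to \<open>f\<close> because one frame
  serves every isometry that agrees with \<open>f\<close> on the cyclic space, see
  \<open>transfer\<close>.\<close>

locale cyclic_frame = hermitian_field p rr q ty
  for p rr q and ty :: "'a::{finite,field} itself" +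
  fixes n r d :: nat and f v F D P
  assumes fU: "f \<in> U n" and vV: "v \<in> V n"
    and minF: "is_minpoly f v F" and minD: "is_minpoly sh (sq n f v) D"
    and degD: "degree D = d" and degF: "degree F = r + d" and le_n: "2 * r + d \<le> n"
    and PV: "i < n \<Longrightarrow> P i \<in> V n" and PW: "i < r + d \<Longrightarrow> P i = Wfr r D f v i"
    and Pg: "i < n \<Longrightarrow> j < n \<Longrightarrow> ip n (P i) (P j) = gramJ r d (toep (sq n f v)) i j"
begin

abbreviation "n1 \<equiv> n - (2 * r + d)"

lemma lin_f: "lin f" by (rule U_lin[OF fU])

sublocale orthonormal_frame p rr q ty n n1 "\<lambda>i. P (2 * r + d + i)"
  by unfold_locales (auto simp: PV Pg gramJ_def)

definition B where "B = F div D"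
definition u where "u = pact f D v"

lemma D_nz: "D \<noteq> 0" using is_minpoly_monic[OF minD] by auto

lemma F_nz: "F \<noteq> 0" using is_minpoly_monic[OF minF] by auto

lemma F_eq: "F = B * D"
proof -
  have "D dvd F" using is_minpoly_iff[OF minD] pact_sh_sq[OF fU is_minpoly_ann[OF minF]] by blast
  then show ?thesis by (simp add: B_def)
qed

lemma B_nz: "B \<noteq> 0" using F_nz F_eq by auto

lemma deg_B: "degree B = r"
  using degF degD degree_mult_eq[OF B_nz D_nz] by (simp add: F_eq[symmetric])

lemma f_eq_0D: "f x = 0 \<Longrightarrow> x = 0"
  using U_bij[OF fU] lin_0[OF lin_f] by (metis bij_is_inj injD)

lemma B_0: "coeff B 0 \<noteq> 0"
proof -
  have "coeff F 0 \<noteq> 0" by (rule is_minpoly_coeff_0[OF minF lin_f f_eq_0D])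
  then have "coeff (B * D) 0 \<noteq> 0" by (simp only: F_eq[symmetric] not_False_eq_True)
  then show ?thesis by (auto simp: coeff_mult_0)
qed

lemma B_ann: "pact f B u = 0"
proof -
  have "pact f (B * D) v = 0" using is_minpoly_ann[OF minF] by (simp only: F_eq[symmetric])
  then show ?thesis unfolding u_def pact_mult[OF lin_f] .
qed

lemma pact_mod: "pact f G x = pact f (G mod H) x" if "pact f H x = 0" for G H x
proof -
  have "pact f G x = pact f (G div H * H + G mod H) x" by simp
  also have "\<dots> = pact f (G mod H) x"
    unfolding pact_add pact_mult[OF lin_f] that by (simp add: lin_0[OF lin_pact[OF lin_f]])
  finally show ?thesis .
qed

lemma comb_P: "(\<Sum>i<r + d. smul (a i) (P i)) = pact f (polyof r a * D + polyof d (\<lambda>i. a (r + i))) v"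
  unfolding comb_Wfr[OF lin_f, symmetric] by (intro sum.cong) (auto simp: PW)

lemma polyof_mod:
  assumes "G \<noteq> 0" "degree G = m" shows "polyof m (coeff (H mod G)) = H mod G"
  using degree_mod_less[OF assms(1), of H] assms by (intro polyof_coeff) auto

lemma W_span: "spn (r + d) P = range (\<lambda>G. pact f G v)"
proof (intro equalityI subsetI)
  fix x assume "x \<in> range (\<lambda>G. pact f G v)"
  then obtain G where G: "x = pact f G v" by auto
  define H where "H = G mod F"
  define a where "a i = (if i < r then coeff (H div D) i else coeff (H mod D) (i - r))" for i
  have "polyof r a = polyof r (coeff (H div D))" by (simp add: polyof_def a_def)
  also have "\<dots> = H div D" unfolding H_def by (rule polyof_coeff_div) (use D_nz F_nz degF degD in auto)
  finally have 1: "polyof r a = H div D" .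
  have "polyof d (\<lambda>i. a (r + i)) = H mod D"
    using polyof_mod[OF D_nz degD, of H] by (simp add: a_def)
  then have "(\<Sum>i<r + d. smul (a i) (P i)) = pact f H v"
    unfolding comb_P 1 by simp
  also have "\<dots> = x" unfolding G H_def by (rule pact_mod[symmetric, OF is_minpoly_ann[OF minF]])
  finally show "x \<in> spn (r + d) P" by (intro spn_I) (rule sym)
qed (auto elim!: spn_E simp: comb_P)

lemma P_u: "i < r \<Longrightarrow> P i = (f ^^ i) u"
  by (simp add: PW Wfr_def u_def)

lemma R_span: "spn r P = range (\<lambda>G. pact f G u)"
proof -
  have c: "(\<Sum>i<r. smul (a i) (P i)) = pact f (polyof r a) u" for a
    unfolding pact_polyof by (intro sum.cong) (auto simp: P_u)
  show ?thesis
  proof (intro equalityI subsetI)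
    fix x assume "x \<in> range (\<lambda>G. pact f G u)"
    then obtain G where G: "x = pact f G u" by auto
    have "(\<Sum>i<r. smul (coeff (G mod B) i) (P i)) = pact f (G mod B) u"
      unfolding c polyof_mod[OF B_nz deg_B] ..
    also have "\<dots> = x" unfolding G by (rule pact_mod[symmetric, OF B_ann])
    finally show "x \<in> spn r P" by (intro spn_I) (rule sym)
  qed (auto elim!: spn_E simp: c)
qed

lemma f_pact: "f (pact f G x) = pact f (pCons 0 G) x"
  by (simp add: pact_pCons[OF lin_f])

lemma f_W: "x \<in> spn (r + d) P \<Longrightarrow> f x \<in> spn (r + d) P"
  unfolding W_span by (auto simp: f_pact)

lemma f_R: "x \<in> spn r P \<Longrightarrow> f x \<in> spn r P"
  unfolding R_span by (auto simp: f_pact)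

lemma f_W_surj: "x \<in> spn (r + d) P \<Longrightarrow> \<exists>w\<in>spn (r + d) P. x = f w"
proof -
  have "spn (r + d) P \<subseteq> V n"
    using PV le_n by (auto elim!: spn_E intro!: V_sum V_smul)
  then have "finite (spn (r + d) P)" by (rule finite_subset) simp
  then have "f ` spn (r + d) P = spn (r + d) P"
    by (rule endo_inj_surj) (use f_W bij_is_inj[OF U_bij[OF fU]] in \<open>auto simp: inj_on_def inj_def\<close>)
  then show "x \<in> spn (r + d) P \<Longrightarrow> \<exists>w\<in>spn (r + d) P. x = f w" by (metis imageE)
qed

lemma nonsing_g: "nonsing d (toep (sq n f v))"
  using nonsing_toep[OF minD] unfolding degD .

lemma indep_P: "indep n P"
proof (rule nonsing_gram_indep[OF herm_form_ip])
  show "nonsing n (\<lambda>i j. ip n (P i) (P j))"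
    using nonsing_gramJ[OF le_n nonsing_g] by (subst nonsing_cong[of n _ "gramJ r d (toep (sq n f v))"]) (auto simp: Pg)
qed

definition xi where "xi = (SOME \<xi>. (\<forall>i. linf (\<xi> i)) \<and> (\<forall>i. \<forall>j<n. \<xi> i (P j) = (if i = j then 1 else 0)))"

lemma xi_lin: "linf (xi i)" and xi_P: "j < n \<Longrightarrow> xi i (P j) = (if i = j then 1 else 0)"
  using someI_ex[OF indep_dual_functionals[OF indep_P]] unfolding xi_def by blast+

lemma expand_P: assumes "x \<in> V n" shows "x = (\<Sum>i<n. smul (xi i x) (P i))"
proof -
  obtain a where a: "x = (\<Sum>i<n. smul (a i) (P i))" using indep_basis[OF indep_P PV assms] by blast
  show ?thesis by (rule spn_expand[OF xi_lin xi_P spn_I[OF a]])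
qed

lemma ip_P: assumes "i < n" "x \<in> V n"
  shows "ip n (P i) x = (\<Sum>j<n. gramJ r d (toep (sq n f v)) i j * xi j x)"
proof -
  have "ip n (P i) x = (\<Sum>j<n. xi j x * ip n (P i) (P j))"
    by (subst expand_P[OF assms(2)]) (simp only: ip_sum ip_smul)
  then show ?thesis using assms(1) by (simp add: Pg mult.commute)
qed

lemma ip_P_u: assumes "i < r" "x \<in> V n" shows "ip n (P i) x = xi (r + d + i) x"
proof -
  have "ip n (P i) x = (\<Sum>j<n. (if j = r + d + i then 1 else 0) * xi j x)"
    using assms le_n by (subst ip_P) (auto simp: gramJ_def)
  then show ?thesis using assms le_n by (simp add: sum_delta_mult)
qed

lemma ip_P_y: assumes "i < n1" "x \<in> V n" shows "ip n (P (2 * r + d + i)) x = xi (2 * r + d + i) x"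
proof -
  have "ip n (P (2 * r + d + i)) x = (\<Sum>j<n. (if 2 * r + d + i = j then 1 else 0) * xi j x)"
    using assms le_n by (subst ip_P) (auto simp: gramJ_def)
  then show ?thesis using assms le_n by (simp add: sum_delta_mult)
qed

lemma ip_P_x: assumes "i < d" "x \<in> V n"
  shows "ip n (P (r + i)) x = (\<Sum>j<d. toep (sq n f v) i j * xi (r + j) x)"
proof -
  have "ip n (P (r + i)) x = (\<Sum>j<n. gramJ r d (toep (sq n f v)) (r + i) j * xi j x)"
    using assms le_n by (intro ip_P) auto
  also have "\<dots> = (\<Sum>j\<in>{r..<r + d}. gramJ r d (toep (sq n f v)) (r + i) j * xi j x)"
    using assms le_n by (intro sum.mono_neutral_right) (auto simp: gramJ_def)
  also have "\<dots> = (\<Sum>j<d. toep (sq n f v) i j * xi (r + j) x)"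
    by (rule sum.reindex_bij_witness[of _ "\<lambda>l. r + l" "\<lambda>j. j - r"]) (use assms in \<open>auto simp: gramJ_def\<close>)
  finally show ?thesis .
qed

text \<open>The orthogonal complement of the cyclic space; by \<open>RY_decomp\<close> it is the
  radical plus the span of the orthonormal block.\<close>

definition RY where "RY = {x \<in> V n. \<forall>i<r + d. ip n (P i) x = 0}"

lemma RY_W: assumes "x \<in> RY" "w \<in> spn (r + d) P" shows "ip n w x = 0"
proof -
  obtain a where "w = (\<Sum>i<r + d. smul (a i) (P i))" using assms(2) by (rule spn_E)
  then have "ip n w x = (\<Sum>i<r + d. cj (a i) * ip n (P i) x)" by (simp only: ip_sum_left ip_smul_left)
  then show ?thesis using assms(1) by (simp add: RY_def)
qed

lemma R_sub_W: "spn r P \<subseteq> spn (r + d) P"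
  by (rule spn_mono) (simp add: spn_base)

lemma f_RY: assumes "x \<in> RY" shows "f x \<in> RY"
proof -
  have "ip n (P i) (f x) = 0" if i: "i < r + d" for i
  proof -
    obtain w where w: "w \<in> spn (r + d) P" "P i = f w" using f_W_surj[OF spn_base[OF i]] by blast
    show ?thesis unfolding w(2) U_ip[OF fU] by (rule RY_W[OF assms w(1)])
  qed
  then show ?thesis using assms U_V[OF fU] by (auto simp: RY_def)
qed

lemma \<pi>_R: assumes "x \<in> spn r P" shows "\<pi> x = 0"
proof -
  obtain a where a: "x = (\<Sum>i<r. smul (a i) (P i))" using assms by (rule spn_E)
  have "ip n (P (2 * r + d + i)) x = 0" if "i < n1" for i
    unfolding a ip_sum ip_smul using that by (intro sum.neutral) (auto simp: Pg gramJ_def)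
  then show ?thesis by (auto simp: \<pi>_def fun_eq_iff)
qed

text \<open>Orthogonality to the radical kills the coordinates in the dual block, and orthogonality
  to the middle block kills those in the middle block, whose Gram matrix is nonsingular.\<close>

lemma RY_decomp: assumes "x \<in> RY" shows "\<exists>\<rho>\<in>spn r P. x = \<rho> + \<iota> (\<pi> x)"
proof -
  have xV: "x \<in> V n" and x0: "\<And>i. i < r + d \<Longrightarrow> ip n (P i) x = 0" using assms by (auto simp: RY_def)
  have z: "xi (r + d + i) x = 0" if "i < r" for i using ip_P_u[OF that xV] x0[of i] that by simp
  have w: "xi (r + i) x = 0" if "i < d" for i
  proof (rule nonsingD[OF nonsing_g _ that, where a = "\<lambda>i. xi (r + i) x"])
    fix k assume k: "k < d"
    show "(\<Sum>j<d. toep (sq n f v) k j * xi (r + j) x) = 0"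
      using ip_P_x[OF k xV] x0[of "r + k"] k by simp
  qed
  have "(\<Sum>i<n. smul (xi i x) (P i)) = (\<Sum>i<r + d + r + n1. smul (xi i x) (P i))"
    using le_n by (intro sum.cong) auto
  also have "\<dots> = (\<Sum>i<r. smul (xi i x) (P i)) + (\<Sum>i<n1. smul (xi (r + d + r + i) x) (P (r + d + r + i)))"
    unfolding sum_lessThan_add by (simp add: z w del: sum_fun_apply)
  also have "r + d + r = 2 * r + d" by simp
  also have "(\<Sum>i<n1. smul (xi (2 * r + d + i) x) (P (2 * r + d + i))) = \<iota> (\<pi> x)"
    unfolding \<iota>_def by (intro sum.cong refl) (simp add: \<pi>_def ip_P_y[OF _ xV])
  finally have "x = (\<Sum>i<r. smul (xi i x) (P i)) + \<iota> (\<pi> x)" by (rule trans[OF expand_P[OF xV]])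
  then show ?thesis by (intro bexI[of _ "\<Sum>i<r. smul (xi i x) (P i)"]) (auto intro: spn_I)
qed

lemma \<iota>_RY: "\<iota> x \<in> RY"
proof -
  have "ip n (P i) (\<iota> x) = 0" if "i < r + d" for i
    unfolding \<iota>_def ip_sum ip_smul using that le_n by (intro sum.neutral) (auto simp: Pg gramJ_def)
  then show ?thesis by (simp add: RY_def)
qed

text \<open>\<open>\<pi>\<close> annihilates the \<open>f\<close>-stable radical, so
  \<open>compress f\<close> is the map induced by \<open>f\<close> on \<open>RY\<close> modulo the
  radical; hence it is an isometry and compatible with powers.\<close>

lemma \<pi>_f: assumes "x \<in> RY" shows "\<pi> (f (\<iota> (\<pi> x))) = \<pi> (f x)"
proof -
  obtain \<rho> where \<rho>: "\<rho> \<in> spn r P" "x = \<rho> + \<iota> (\<pi> x)" using RY_decomp[OF assms] by blast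
  have "\<pi> (f x) = \<pi> (f (\<rho> + \<iota> (\<pi> x)))" using \<rho>(2) by (rule arg_cong)
  also have "\<dots> = \<pi> (f \<rho>) + \<pi> (f (\<iota> (\<pi> x)))" by (simp only: lin_add[OF lin_f] lin_add[OF lin_\<pi>])
  also have "\<pi> (f \<rho>) = 0" by (rule \<pi>_R[OF f_R[OF \<rho>(1)]])
  finally show ?thesis by simp
qed

lemma compress_V: "x \<in> V n1 \<Longrightarrow> compress f x = \<pi> (f (\<iota> x))"
  by (simp add: compress_def tr_id)

lemma compress_pow:
  assumes "x \<in> V n1"
  shows "(compress f ^^ l) x = \<pi> ((f ^^ l) (\<iota> x)) \<and> (f ^^ l) (\<iota> x) \<in> RY"
proof (induction l)
  case 0
  then show ?case using assms \<iota>_RY by (simp add: \<pi>_\<iota> tr_id)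
next
  case (Suc l)
  have "compress f (\<pi> ((f ^^ l) (\<iota> x))) = \<pi> (f ((f ^^ l) (\<iota> x)))"
    unfolding compress_V[OF \<pi>_V] using \<pi>_f Suc by blast
  then show ?case using Suc f_RY by simp
qed

lemma ip_\<pi>: assumes "a \<in> RY" "b \<in> RY" shows "ip n1 (\<pi> a) (\<pi> b) = ip n a b"
proof -
  obtain \<rho> where \<rho>: "\<rho> \<in> spn r P" "a = \<rho> + \<iota> (\<pi> a)" using RY_decomp[OF assms(1)] by blast
  have "ip n a b = ip n (\<rho> + \<iota> (\<pi> a)) b" using \<rho>(2) by (rule arg_cong)
  also have "\<dots> = ip n \<rho> b + ip n1 (\<pi> a) (\<pi> b)" unfolding ip_add_left ip_\<iota> ..
  also have "ip n \<rho> b = 0" using RY_W[OF assms(2)] \<rho>(1) R_sub_W by blast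
  finally show ?thesis by simp
qed

lemma compress_U: "compress f \<in> U n1"
proof -
  have "lin (compress f)" by (rule lin_compress[OF lin_f])
  moreover have "ip n1 (compress f x) (compress f y) = ip n1 x y" for x y
  proof -
    have t: "tr n1 (compress f x) = \<pi> (f (\<iota> x))" for x
      unfolding compress_def tr_add tr_diff_tr by (simp add: tr_id)
    have "ip n1 (compress f x) (compress f y) = ip n1 (tr n1 (compress f x)) (tr n1 (compress f y))" by (simp only: ip_tr)
    also have "\<dots> = ip n (\<iota> x) (\<iota> y)"
      unfolding t by (simp only: ip_\<pi>[OF f_RY[OF \<iota>_RY] f_RY[OF \<iota>_RY]] U_ip[OF fU])
    also have "\<dots> = ip n1 x y" by (simp only: ip_\<iota> \<pi>_\<iota> ip_tr)
    finally show ?thesis .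
  qed
  moreover have "compress f x \<in> V n1" if "x \<in> V n1" for x unfolding compress_V[OF that] by simp
  moreover have "compress f x = x" if "tr n1 x = 0" for x
  proof -
    have "\<iota> x = 0" using \<iota>_tr[of x] that lin_0[OF lin_\<iota>] by simp
    then show ?thesis unfolding compress_def that by (simp add: lin_0[OF lin_f] lin_0[OF lin_\<pi>])
  qed
  ultimately show ?thesis by (simp add: U_def)
qed

lemma trU_xi: assumes "g \<in> U n" shows "trU n g = (\<Sum>i<n. xi i (g (P i)))"
  unfolding trU_def
proof (rule trace_change_of_frame[OF U_lin[OF assms] _ xi_lin, where S = "V n"])
  show "linf (\<lambda>x. x i)" for i by (auto simp: linf_def)
qed (use V_expand expand_P ax_in_V PV U_V[OF assms] in auto)

text \<open>\<open>cyclic_trace\<close> applies in the Krylov basis \<open>(f ^^ i) v\<close>, and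
  the trace does not change on passing to the adapted frame.\<close>

lemma trace_W: assumes "l \<ge> 1" shows "(\<Sum>i<r + d. xi i ((f ^^ l) (P i))) = psum F l"
proof -
  have indc: "indep (r + d) (\<lambda>i. (f ^^ i) v)"
    unfolding indep_def
  proof (intro allI impI)
    fix a i assume a: "(\<Sum>i<r + d. smul (a i) ((f ^^ i) v)) = 0" and i: "i < r + d"
    have "polyof (r + d) a = 0"
      using a i unfolding pact_polyof[symmetric] by (intro is_minpoly_small[OF minF]) (auto simp: degF intro: degree_polyof_less)
    then show "a i = 0" using i by (rule polyof_eq_0D)
  qed
  obtain \<xi> where \<xi>: "\<And>i. linf (\<xi> i)" "\<And>i j. j < r + d \<Longrightarrow> \<xi> i ((f ^^ j) v) = (if i = j then 1 else 0)"
    using indep_dual_functionals[OF indc] by blast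
  have cyc: "spn (r + d) P \<subseteq> spn (r + d) (\<lambda>i. (f ^^ i) v)"
  proof
    fix x assume "x \<in> spn (r + d) P"
    then obtain G where "x = pact f G v" unfolding W_span by auto
    also have "\<dots> = pact f (polyof (r + d) (coeff (G mod F))) v"
      unfolding polyof_mod[OF F_nz degF] by (rule pact_mod[OF is_minpoly_ann[OF minF]])
    finally show "x \<in> spn (r + d) (\<lambda>i. (f ^^ i) v)" unfolding pact_polyof by (rule spn_I)
  qed
  have "(\<Sum>i<r + d. xi i ((f ^^ l) (P i))) = (\<Sum>i<r + d. \<xi> i ((f ^^ l) ((f ^^ i) v)))"
  proof (rule trace_change_of_frame[OF lin_funpow[OF lin_f] xi_lin \<xi>(1), where S = "spn (r + d) P"])
    show "x = (\<Sum>i<r + d. smul (xi i x) (P i))" if "x \<in> spn (r + d) P" for x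
      by (rule spn_expand[OF xi_lin xi_P that]) (use le_n in auto)
    show "x = (\<Sum>i<r + d. smul (\<xi> i x) ((f ^^ i) v))" if "x \<in> spn (r + d) P" for x
      by (rule spn_expand[OF \<xi>]) (use cyc that in auto)
    show "P i \<in> spn (r + d) P" if "i < r + d" for i by (rule spn_base[OF that])
    show "(f ^^ i) v \<in> spn (r + d) P" for i unfolding W_span by (rule range_eqI[of _ _ "monom 1 i"]) (simp add: pact_monom)
    show "(f ^^ l) x \<in> spn (r + d) P" if "x \<in> spn (r + d) P" for x
      by (induction l) (use that f_W in auto)
  qed
  also have "\<dots> = psum F l"
    by (rule cyclic_trace[OF lin_f is_minpoly_monic[OF minF] degF is_minpoly_ann[OF minF] \<xi> assms])
  finally show ?thesis .
qed

lemma inv_f: "f (inv f x) = x" "inv f (f x) = x"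
  using U_bij[OF fU] by (simp_all add: bij_is_surj surj_f_inv_f bij_is_inj)

lemma inv_pow_f_pow: "(inv f ^^ i) ((f ^^ (i + j)) x) = (f ^^ j) x"
proof (induction i arbitrary: j)
  case (Suc i)
  then show ?case using Suc[of "Suc j"] by (simp add: inv_f)
qed simp

lemma inv_pow_commute: "f ((inv f ^^ i) x) = (inv f ^^ i) (f x)"
proof (induction i)
  case (Suc i)
  then show ?case by (simp add: inv_f Suc[symmetric])
qed simp

lemma ip_inv_pow: "ip n a ((f ^^ l) b) = ip n ((inv f ^^ l) a) b"
proof (induction l arbitrary: a)
  case (Suc l)
  have "ip n a ((f ^^ Suc l) b) = ip n (f (inv f a)) (f ((f ^^ l) b))" by (simp add: inv_f)
  also have "\<dots> = ip n (inv f a) ((f ^^ l) b)" by (rule U_ip[OF fU])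
  also have "\<dots> = ip n ((inv f ^^ Suc l) a) b" unfolding Suc by (simp add: funpow_swap1)
  finally show ?case .
qed simp

text \<open>The space modulo the orthogonal complement of the radical is dual to the radical, so \<open>f^l\<close> acts on it with
  the conjugate of the trace of \<open>f^{-l}\<close> on the radical.\<close>
lemma trace_z:
  assumes "l \<ge> 1" shows "(\<Sum>i<r. xi (r + d + i) ((f ^^ l) (P (r + d + i)))) = cj (psum (monic_rev B) l)"
proof -
  note mr = monic_rev[OF B_0]
  \<comment> \<open>The last Krylov vector of the radical is cyclic for the inverse of
    \<open>f\<close>, whose powers list the \<open>P i\<close> backwards; hence the index
    \<open>r - 1 - i\<close>.\<close>
  define v' where "v' = (f ^^ (r - 1)) u"
  have lg: "lin (inv f)" by (rule U_lin[OF U_inv[OF fU]])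
  have P': "(inv f ^^ j) v' = P (r - 1 - j)" if "j < r" for j
    using inv_pow_f_pow[of j "r - 1 - j" u] that by (simp add: v'_def P_u)
  \<comment> \<open>For \<open>r = 0\<close> the exponent \<open>r - 1\<close> is truncated, so the
    zero vector is put in for that case.\<close>
  have "(\<Sum>i<r. ip n (P (r + d + (r - 1 - i))) ((inv f ^^ l) ((inv f ^^ i) (if r = 0 then 0 else v')))) = psum (monic_rev B) l"
  proof (rule cyclic_trace[OF lg mr(1) _ _ _ _ assms])
    show "degree (monic_rev B) = r" unfolding mr deg_B ..
    show "linf (ip n (P (r + d + (r - 1 - i))))" for i by (simp add: linf_def ip_add ip_smul)
    show "ip n (P (r + d + (r - 1 - i))) ((inv f ^^ j) (if r = 0 then 0 else v')) = (if i = j then 1 else 0)"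
      if "i < r" "j < r" for i j
      using that le_n by (auto simp: P' Pg gramJ_def)
    show "pact (inv f) (monic_rev B) (if r = 0 then 0 else v') = 0"
    proof (cases "r = 0")
      case False
      have fv': "f v' = (f ^^ r) u" using False unfolding v'_def by (cases r) auto
      \<comment> \<open>One application of \<open>f\<close> turns \<open>v'\<close> into
        \<open>(f ^^ r) u\<close>, and the reversed polynomial in the inverse becomes
        \<open>B(f) u\<close>.\<close>
      have "f (pact (inv f) (reflect_poly B) v') = (\<Sum>i\<le>r. smul (coeff B (r - i)) (f ((inv f ^^ i) v')))"
        unfolding pact_def lin_comb[OF lin_f] degree_reflect_poly_eq[OF B_0] deg_B
        by (intro sum.cong) (auto simp: coeff_reflect_poly deg_B)
      also have "\<dots> = (\<Sum>i\<le>r. smul (coeff B (r - i)) ((f ^^ (r - i)) u))"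
      proof (intro sum.cong refl)
        fix i assume "i \<in> {..r}"
        then show "smul (coeff B (r - i)) (f ((inv f ^^ i) v')) = smul (coeff B (r - i)) ((f ^^ (r - i)) u)"
          using inv_pow_f_pow[of i "r - i" u] unfolding inv_pow_commute fv' by simp
      qed
      also have "\<dots> = pact f B u"
        unfolding pact_def deg_B by (rule sum.reindex_bij_witness[of _ "\<lambda>i. r - i" "\<lambda>i. r - i"]) auto
      finally have "pact (inv f) (reflect_poly B) v' = 0" using B_ann f_eq_0D by simp
      then show ?thesis using False by (simp add: monic_rev_def pact_smult)
    qed (simp add: lin_0[OF lin_pact[OF lg]])
  qed
  also have "(\<Sum>i<r. ip n (P (r + d + (r - 1 - i))) ((inv f ^^ l) ((inv f ^^ i) (if r = 0 then 0 else v'))))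
      = (\<Sum>i<r. ip n (P (r + d + i)) ((inv f ^^ l) (P i)))"
    by (rule sum.reindex_bij_witness[of _ "\<lambda>i. r - 1 - i" "\<lambda>i. r - 1 - i"]) (auto simp: P')
  finally have "psum (monic_rev B) l = (\<Sum>i<r. ip n (P (r + d + i)) ((inv f ^^ l) (P i)))" ..
  then have "cj (psum (monic_rev B) l) = (\<Sum>i<r. ip n (P i) ((f ^^ l) (P (r + d + i))))"
    by (simp add: ip_inv_pow ip_sym[of n "(inv f ^^ l) _", symmetric])
  also have "\<dots> = (\<Sum>i<r. xi (r + d + i) ((f ^^ l) (P (r + d + i))))"
    using le_n by (intro sum.cong refl ip_P_u U_V[OF U_funpow[OF fU]] PV) auto
  finally show ?thesis ..
qed

lemma trace_y: "(\<Sum>i<n1. xi (2 * r + d + i) ((f ^^ l) (P (2 * r + d + i)))) = trU n1 (compress f ^^ l)"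
  unfolding trU_def
proof (intro sum.cong refl)
  fix i assume "i \<in> {..<n1}"
  then have i: "i < n1" by simp
  have "(compress f ^^ l) (ax i) i = \<pi> ((f ^^ l) (\<iota> (ax i))) i"
    using compress_pow[OF ax_in_V[OF i], of l] by simp
  also have "\<dots> = ip n (P (2 * r + d + i)) ((f ^^ l) (P (2 * r + d + i)))"
    using i by (simp add: \<iota>_ax \<pi>_def)
  also have "\<dots> = xi (2 * r + d + i) ((f ^^ l) (P (2 * r + d + i)))"
    using i by (intro ip_P_y U_V[OF U_funpow[OF fU]] PV) auto
  finally show "xi (2 * r + d + i) ((f ^^ l) (P (2 * r + d + i))) = (compress f ^^ l) (ax i) i" ..
qed

text \<open>\<open>f\<close> preserves the flag formed by the cyclic space, the orthogonal
  complement of the radical, and the whole space. The successive quotients are the cyclic space,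
  \<open>RY\<close> modulo the radical, and the conjugate dual of the radical; their traces are the
  block sums of the diagonal in the frame.\<close>

theorem trace_decomposition:
  assumes "l \<ge> 1"
  shows "trU n (f ^^ l) = psum F l + cj (psum (monic_rev B) l) + trU n1 (compress f ^^ l)"
proof -
  have "trU n (f ^^ l) = (\<Sum>i<r + d + r + n1. xi i ((f ^^ l) (P i)))"
    unfolding trU_xi[OF U_funpow[OF fU]] using le_n by (intro sum.cong) auto
  also have "\<dots> = (\<Sum>i<r + d. xi i ((f ^^ l) (P i))) + (\<Sum>i<r. xi (r + d + i) ((f ^^ l) (P (r + d + i))))
      + (\<Sum>i<n1. xi (2 * r + d + i) ((f ^^ l) (P (2 * r + d + i))))"
    unfolding sum_lessThan_add[of _ "r + d + r" n1] sum_lessThan_add[of _ "r + d" r]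
    by (simp add: mult_2 add_ac)
  finally show ?thesis unfolding trace_W[OF assms] trace_z[OF assms] trace_y .
qed

end

section \<open>Averaging over all pairs of a fixed type\<close>

context hermitian_field
begin

lemma ex_cyclic_frame:
  assumes f: "f \<in> U n" and v: "v \<in> V n" and F: "is_minpoly f v F" and D: "is_minpoly sh (sq n f v) D"
    and deg: "degree D = d" "degree F = r + d"
  shows "2 * r + d \<le> n" and "\<exists>P. cyclic_frame p rr q n r d f v F D P"
proof -
  note lf = U_lin[OF f]
  have D0: "D \<noteq> 0" using is_minpoly_monic[OF D] by auto
  have "pact f D v \<in> V n"
    unfolding pact_def using U_V[OF U_funpow[OF f] v] by (intro V_sum V_smul)
  then have WV: "Wfr r D f v i \<in> V n" for i
    unfolding Wfr_def using U_V[OF U_funpow[OF f]] v by simp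
  have ns: "nonsing d (toep (sq n f v))" using nonsing_toep[OF D] deg by simp
  note a = ex_adapted_frame[OF WV indep_Wfr[OF lf F D0 deg] gram_Wfr[OF f is_minpoly_ann[OF D]] ns]
  show le: "2 * r + d \<le> n" using a(1) by blast
  obtain P where P: "\<forall>i<n. P i \<in> V n" "\<forall>i<r + d. P i = Wfr r D f v i"
    "\<forall>i<n. \<forall>j<n. ip n (P i) (P j) = gramJ r d (toep (sq n f v)) i j" using a(2) by blast
  have "cyclic_frame p rr q n r d f v F D P"
    by unfold_locales (use f v F D deg le P in auto)
  then show "\<exists>P. cyclic_frame p rr q n r d f v F D P" by blast
qed

lemma sum_U_translate:
  assumes a: "a \<in> U m"
  shows "(\<Sum>h\<in>U m. \<phi> (a \<circ> h)) = (\<Sum>h\<in>U m. \<phi> h)"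
proof -
  have 1: "inv a \<circ> (a \<circ> h) = h" "a \<circ> (inv a \<circ> h) = h" for h :: "(nat \<Rightarrow> 'a) \<Rightarrow> nat \<Rightarrow> 'a"
    using U_bij[OF a] by (auto simp: fun_eq_iff bij_is_inj bij_is_surj surj_f_inv_f)
  show ?thesis
    by (rule sum.reindex_bij_witness[of _ "\<lambda>h. inv a \<circ> h" "\<lambda>h. a \<circ> h"])
       (use a in \<open>simp_all only: 1 U_comp U_inv\<close>)
qed

lemma inv_cancel: assumes "g \<in> U n" shows "inv g (g x) = x" "g (inv g x) = x"
  using U_bij[OF assms] by (auto simp: bij_is_inj bij_is_surj surj_f_inv_f)

lemma conj_funpow: assumes "g \<in> U n" shows "((g \<circ> K \<circ> inv g) ^^ l) x = g ((K ^^ l) (inv g x))"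
  by (induction l) (auto simp: inv_cancel[OF assms])

lemma trU_conj:
  assumes g: "g \<in> U n" and K: "K \<in> U n"
  shows "trU n (g \<circ> K \<circ> inv g) = trU n K"
proof -
  let ?L = "g \<circ> K \<circ> inv g"
  have L: "?L \<in> U n" using g K by (intro U_comp U_inv)
  have lig: "lin (inv g)" by (rule U_lin[OF U_inv[OF g]])
  have "(\<Sum>i<n. (?L (ax i)) i) = (\<Sum>i<n. (inv g (?L (g (ax i)))) i)"
  proof (rule trace_change_of_frame[OF U_lin[OF L], where S = "V n" and \<xi> = "\<lambda>i x. x i" and \<xi>' = "\<lambda>i x. inv g x i"])
    show "linf (\<lambda>x::nat \<Rightarrow> 'a. x i)" "linf (\<lambda>x. inv g x i)" for i
      by (auto simp: linf_def lin_add[OF lig] lin_smul[OF lig])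
    show "x = (\<Sum>i<n. smul (x i) (ax i))" if "x \<in> V n" for x :: "nat \<Rightarrow> 'a" by (rule V_expand[OF that])
    show "x = (\<Sum>i<n. smul (inv g x i) (g (ax i)))" if "x \<in> V n" for x
    proof -
      have "g (inv g x) = g (\<Sum>i<n. smul (inv g x i) (ax i))"
        by (rule arg_cong[where f = g], rule V_expand) (rule U_V[OF U_inv[OF g] that])
      then show ?thesis unfolding lin_comb[OF U_lin[OF g]] inv_cancel[OF g] .
    qed
    show "ax i \<in> V n" "g (ax i) \<in> V n" if "i < n" for i using ax_in_V[OF that] U_V[OF g] by auto
    show "?L x \<in> V n" if "x \<in> V n" for x by (rule U_V[OF L that])
  qed
  also have "\<dots> = (\<Sum>i<n. K (ax i) i)" by (simp add: inv_cancel[OF g])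
  finally show ?thesis by (simp add: trU_def)
qed

lemma trU_conj_pow:
  assumes g: "g \<in> U n" and K: "K \<in> U n"
  shows "trU n ((g \<circ> K \<circ> inv g) ^^ l) = trU n (K ^^ l)"
proof -
  have "(g \<circ> K \<circ> inv g) ^^ l = g \<circ> (K ^^ l) \<circ> inv g" by (rule ext) (simp add: conj_funpow[OF g])
  then show ?thesis using trU_conj[OF g U_funpow[OF K]] by simp
qed

lemma pact_conj:
  assumes "g \<in> U n" shows "pact (g \<circ> K \<circ> inv g) G (g v) = g (pact K G v)"
  unfolding pact_def lin_comb[OF U_lin[OF assms]] conj_funpow[OF assms] inv_cancel[OF assms] ..

lemma is_minpoly_conj:
  assumes "g \<in> U n" shows "is_minpoly (g \<circ> K \<circ> inv g) (g v) F \<longleftrightarrow> is_minpoly K v F"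
proof -
  have "pact (g \<circ> K \<circ> inv g) G (g v) = 0 \<longleftrightarrow> pact K G v = 0" for G
    unfolding pact_conj[OF assms] using inv_cancel(1)[OF assms] lin_0[OF U_lin[OF assms]] by metis
  then show ?thesis unfolding is_minpoly_def by simp
qed

lemma sq_conj:
  assumes "g \<in> U n" shows "sq n (g \<circ> K \<circ> inv g) (g v) = sq n K v"
  unfolding sq_def conj_funpow[OF assms] inv_cancel[OF assms] U_ip[OF assms] ..

end

context cyclic_frame
begin

text \<open>Minimal polynomial, sequence and frame see \<open>f\<close> only on the cyclic
  space.\<close>

lemma transfer:
  assumes K: "K \<in> U n" and agree: "\<And>i. i < r + d \<Longrightarrow> K ((f ^^ i) v) = f ((f ^^ i) v)"
  shows "cyclic_frame p rr q n r d K v F D P"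
    and "(K ^^ i) v = (f ^^ i) v"
proof -
  have eqW: "K x = f x" if "x \<in> spn (r + d) P" for x
  proof -
    obtain G where "x = pact f G v" using \<open>x \<in> _\<close> unfolding W_span by auto
    also have "\<dots> = pact f (polyof (r + d) (coeff (G mod F))) v"
      unfolding polyof_mod[OF F_nz degF] by (rule pact_mod[OF is_minpoly_ann[OF minF]])
    finally have x: "x = (\<Sum>i<r + d. smul (coeff (G mod F) i) ((f ^^ i) v))" unfolding pact_polyof .
    show ?thesis unfolding x lin_comb[OF lin_f] lin_comb[OF U_lin[OF K]] by (intro sum.cong refl) (simp add: agree)
  qed
  have pow: "(K ^^ i) x = (f ^^ i) x \<and> (f ^^ i) x \<in> spn (r + d) P" if "x \<in> spn (r + d) P" for i x
    by (induction i) (use that eqW f_W in auto)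
  have vW: "v \<in> spn (r + d) P" unfolding W_span by (rule range_eqI[of _ _ 1]) simp
  show powv: "(K ^^ i) v = (f ^^ i) v" for i using pow[OF vW] by blast
  have pactv: "pact K G v = pact f G v" for G unfolding pact_def powv ..
  have sqv: "sq n K v = sq n f v" unfolding sq_def powv ..
  have DW: "pact f D v \<in> spn (r + d) P" unfolding W_span by blast
  have W: "Wfr r D K v i = Wfr r D f v i" for i
    unfolding Wfr_def pactv powv using pow[OF DW] by simp
  show "cyclic_frame p rr q n r d K v F D P"
    by unfold_locales
      (use K vV minF minD degD degF le_n PV PW Pg in \<open>auto simp: sqv W is_minpoly_def pactv\<close>)
qed

lemma \<pi>_W: assumes "x \<in> spn (r + d) P" shows "\<pi> x = 0"
proof -
  obtain a where a: "x = (\<Sum>i<r + d. smul (a i) (P i))" using assms by (rule spn_E)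
  have "ip n (P (2 * r + d + i)) x = 0" if "i < n1" for i
    unfolding a ip_sum ip_smul using that by (intro sum.neutral) (auto simp: Pg gramJ_def)
  then show ?thesis by (auto simp: \<pi>_def fun_eq_iff)
qed

text \<open>The pointwise stabiliser of the cyclic space; the isometries \<open>f \<circ> g\<close>
  with \<open>g\<close> in it are those that agree with \<open>f\<close> there.\<close>

definition Stab where "Stab = {g \<in> U n. \<forall>i<r + d. g ((f ^^ i) v) = (f ^^ i) v}"

lemma ext_Stab: assumes "h \<in> U n1" shows "ext h \<in> Stab"
proof -
  have "(f ^^ i) v \<in> spn (r + d) P" for i
    unfolding W_span by (rule range_eqI[of _ _ "monom 1 i"]) (simp add: pact_monom)
  then show ?thesis using ext_U[OF assms] ext_fix[OF assms] \<pi>_W by (simp add: Stab_def)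
qed

lemma finite_Stab: "finite Stab" unfolding Stab_def using finite_U by simp

lemma Stab_comp: "g \<in> Stab \<Longrightarrow> h \<in> Stab \<Longrightarrow> g \<circ> h \<in> Stab"
  by (auto simp: Stab_def U_comp)

lemma Stab_U: "g \<in> Stab \<Longrightarrow> g \<in> U n" by (simp add: Stab_def)

lemma card_Stab_pos: "card Stab > 0"
proof -
  have "id \<in> Stab" by (simp add: Stab_def U_id)
  then show ?thesis using finite_Stab by (metis card_gt_0_iff empty_iff)
qed

lemma sum_Stab_translate:
  assumes e: "e \<in> Stab" shows "(\<Sum>g\<in>Stab. \<phi> (g \<circ> e)) = (\<Sum>g\<in>Stab. \<phi> g)"
proof (rule sum.reindex_bij_betw)
  have inj: "inj_on (\<lambda>g. g \<circ> e) Stab"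
    using bij_is_surj[OF U_bij[OF Stab_U[OF e]]] by (auto intro!: inj_onI simp: fun_eq_iff) (metis surjD)
  moreover have "(\<lambda>g. g \<circ> e) ` Stab \<subseteq> Stab" using Stab_comp[OF _ e] by auto
  ultimately have "(\<lambda>g. g \<circ> e) ` Stab = Stab" by (intro endo_inj_surj finite_Stab)
  then show "bij_betw (\<lambda>g. g \<circ> e) Stab Stab" using inj by (simp add: bij_betw_def)
qed

end

locale trace_character = hermitian_field p rr q ty
  for p rr q and ty :: "'a::{finite,field} itself" +
  fixes \<psi> :: "'a \<Rightarrow> complex" and I :: "nat set" and c :: "nat \<Rightarrow> 'a" and b :: "nat \<Rightarrow> nat"
  assumes \<psi>_add: "\<psi> (x + y) = \<psi> x * \<psi> y" and \<psi>_norm: "norm (\<psi> x) = 1"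
    and b_pos: "i \<in> I \<Longrightarrow> b i \<ge> 1"
begin

text \<open>\<open>tc\<close> and \<open>pc\<close> are the character on isometries and on polynomials; \<open>rc B\<close> is the contribution of the dual
  of the radical, on which the isometry has characteristic polynomial the conjugate reversal of \<open>B\<close>.\<close>
definition tsum :: "(nat \<Rightarrow> 'a) \<Rightarrow> 'a" where "tsum \<tau> = (\<Sum>i\<in>I. c i * \<tau> (b i))"
definition tc :: "nat \<Rightarrow> ((nat \<Rightarrow> 'a) \<Rightarrow> nat \<Rightarrow> 'a) \<Rightarrow> complex" where "tc n f = \<psi> (tsum (\<lambda>l. trU n (f ^^ l)))"
definition pc :: "'a poly \<Rightarrow> complex" where "pc F = \<psi> (tsum (psum F))"
definition rc :: "'a poly \<Rightarrow> complex" where "rc B = \<psi> (tsum (\<lambda>l. cj (psum (monic_rev B) l)))"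
definition E :: "nat \<Rightarrow> complex" where "E n = (\<Sum>f\<in>U n. tc n f) / of_nat (card (U n))"

lemma tsum_add: "tsum (\<lambda>l. \<tau> l + \<sigma> l) = tsum \<tau> + tsum \<sigma>"
  by (simp add: tsum_def distrib_left sum.distrib)

lemma tsum_cong: "(\<And>l. l \<ge> 1 \<Longrightarrow> \<tau> l = \<sigma> l) \<Longrightarrow> tsum \<tau> = tsum \<sigma>"
  unfolding tsum_def using b_pos by (intro sum.cong refl) simp

lemma sum_tc_U: "(\<Sum>f\<in>U n. tc n f) = of_nat (card (U n)) * E n"
  using card_U_pos[of n] by (simp add: E_def)

lemma tc_conj: "g \<in> U n \<Longrightarrow> K \<in> U n \<Longrightarrow> tc n (g \<circ> K \<circ> inv g) = tc n K"
  by (simp add: tc_def trU_conj_pow)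

lemma tc_decomp:
  assumes "cyclic_frame p rr q n r d f v F D P"
  shows "tc n f = pc F * rc (F div D) * tc (n - (2 * r + d)) (orthonormal_frame.compress q n (n - (2 * r + d)) (\<lambda>i. P (2 * r + d + i)) f)"
proof -
  interpret cyclic_frame p rr q ty n r d f v F D P by fact
  have "tsum (\<lambda>l. trU n (f ^^ l)) = tsum (\<lambda>l. psum F l + cj (psum (monic_rev B) l) + trU n1 (compress f ^^ l))"
    by (rule tsum_cong) (rule trace_decomposition)
  then show ?thesis by (simp add: tc_def pc_def rc_def tsum_add \<psi>_add B_def)
qed

text \<open>\<open>Stab\<close> contains a copy of \<open>U n1\<close>, over which one can average: this replaces the induced isometry
  \<open>compress f\<close> by a uniformly random one.\<close>
lemma stab_sum:
  assumes "cyclic_frame p rr q n r d f v F D P"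
  shows "(\<Sum>g\<in>cyclic_frame.Stab q n r d f v. tc n (f \<circ> g))
    = of_nat (card (cyclic_frame.Stab q n r d f v)) * (pc F * rc (F div D) * E (n - (2 * r + d)))"
proof -
  interpret cyclic_frame p rr q ty n r d f v F D P by fact
  let ?C = "pc F * rc (F div D)"
  \<comment> \<open>\<open>f \<circ> g\<close> has the same frame, and composing with
    \<open>ext h\<close> translates its induced isometry by \<open>h\<close>; summing over
    \<open>h\<close> removes the dependence on \<open>g\<close>.\<close>
  have each: "(\<Sum>h\<in>U n1. tc n (f \<circ> g \<circ> ext h)) = ?C * (of_nat (card (U n1)) * E n1)" if g: "g \<in> Stab" for g
  proof -
    have fr: "cyclic_frame p rr q n r d (f \<circ> g) v F D P"
      by (rule transfer(1)) (use g fU in \<open>auto simp: Stab_def U_comp\<close>)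
    then interpret K: cyclic_frame p rr q ty n r d "f \<circ> g" v F D P .
    have "(\<Sum>h\<in>U n1. tc n (f \<circ> g \<circ> ext h)) = (\<Sum>h\<in>U n1. ?C * tc n1 (compress (f \<circ> g) \<circ> h))"
    proof (intro sum.cong refl)
      fix h assume h: "h \<in> U n1"
      have "cyclic_frame p rr q n r d (f \<circ> (g \<circ> ext h)) v F D P"
        by (rule transfer(1)) (use Stab_comp[OF g ext_Stab[OF h]] fU in \<open>auto simp: Stab_def U_comp\<close>)
      from tc_decomp[OF this] show "tc n (f \<circ> g \<circ> ext h) = ?C * tc n1 (compress (f \<circ> g) \<circ> h)"
        using compress_ext[OF h, of "f \<circ> g"] by (simp add: comp_assoc)
    qed
    also have "\<dots> = ?C * (\<Sum>h\<in>U n1. tc n1 h)"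
      unfolding sum_distrib_left[symmetric] by (simp add: sum_U_translate[OF K.compress_U])
    finally show ?thesis unfolding sum_tc_U .
  qed
  \<comment> \<open>Replacing \<open>g\<close> by \<open>g \<circ> ext h\<close> permutes
    \<open>Stab\<close>, so the sum may be averaged over \<open>h\<close> too.\<close>
  have "of_nat (card (U n1)) * (\<Sum>g\<in>Stab. tc n (f \<circ> g)) = (\<Sum>h\<in>U n1. \<Sum>g\<in>Stab. tc n (f \<circ> g))"
    by simp
  also have "\<dots> = (\<Sum>h\<in>U n1. \<Sum>g\<in>Stab. tc n (f \<circ> g \<circ> ext h))"
  proof (rule sum.cong[OF refl])
    fix h assume "h \<in> U n1"
    then show "(\<Sum>g\<in>Stab. tc n (f \<circ> g)) = (\<Sum>g\<in>Stab. tc n (f \<circ> g \<circ> ext h))"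
      using sum_Stab_translate[OF ext_Stab, of h "\<lambda>g. tc n (f \<circ> g)"] by (simp add: comp_assoc)
  qed
  also have "\<dots> = (\<Sum>g\<in>Stab. ?C * (of_nat (card (U n1)) * E n1))"
    by (subst sum.swap) (simp add: each)
  also have "\<dots> = of_nat (card (U n1)) * (of_nat (card Stab) * (?C * E n1))" by simp
  finally show ?thesis using card_U_pos[of n1] by simp
qed

text \<open>Every pair of the type of \<open>(f0, v0)\<close> is \<open>(g f0 k g^{-1}, g v0)\<close> with \<open>k \<in> Stab\<close>, in \<open>|Stab|\<close> many ways.\<close>
lemma type_sum:
  assumes f0: "f0 \<in> U n" and v0: "v0 \<in> V n" and F: "is_minpoly f0 v0 F" and D: "is_minpoly sh (sq n f0 v0) D"
    and deg: "degree D = d" "degree F = r + d"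
  defines "X \<equiv> {(f, v). f \<in> U n \<and> v \<in> V n \<and> is_minpoly f v F \<and> sq n f v = sq n f0 v0}"
  shows "(\<Sum>(f, v)\<in>X. tc n f) = of_nat (card (U n)) * (pc F * rc (F div D) * E (n - (2 * r + d)))"
proof -
  obtain P where "cyclic_frame p rr q n r d f0 v0 F D P"
    using ex_cyclic_frame(2)[OF f0 v0 F D deg] by blast
  then interpret C: cyclic_frame p rr q ty n r d f0 v0 F D P .
  \<comment> \<open>Incidence relation for a double count: \<open>g\<close> carries the Krylov
    vectors of the base pair to those of \<open>x\<close>. The clause \<open>g v0 = snd x\<close>
    matters for \<open>r + d = 0\<close>, where the other one is void.\<close>
  define R where "R x g \<longleftrightarrow> (\<forall>i<r + d. g ((f0 ^^ i) v0) = (fst x ^^ i) (snd x)) \<and> g v0 = snd x" for x :: "((nat \<Rightarrow> 'a) \<Rightarrow> nat \<Rightarrow> 'a) \<times> (nat \<Rightarrow> 'a)" and g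
  have finX: "finite X"
    by (rule finite_subset[of _ "U n \<times> V n"]) (auto simp: X_def finite_U)
  have Rpow: "g ((f0 ^^ i) v0) = (f ^^ i) v" if x: "(f, v) \<in> X" and R: "R (f, v) g" and g: "g \<in> U n" for f v g i
  proof -
    have lf: "lin f" and mF: "is_minpoly f v F" using x U_lin by (auto simp: X_def)
    let ?G = "monom 1 i mod F"
    have G0: "pact f0 (monom 1 i) v0 = pact f0 ?G v0"
      by (rule C.pact_mod[OF is_minpoly_ann[OF F]])
    have "pact f (monom 1 i - ?G) v = 0"
      unfolding is_minpoly_iff[OF mF] by (simp add: minus_mod_eq_mult_div)
    then have G: "pact f (monom 1 i) v = pact f ?G v" unfolding pact_diff by simp
    have p: "polyof (r + d) (coeff ?G) = ?G" by (rule C.polyof_mod[OF C.F_nz C.degF])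
    have "g (pact f0 (polyof (r + d) (coeff ?G)) v0) = pact f (polyof (r + d) (coeff ?G)) v"
      unfolding pact_polyof lin_comb[OF U_lin[OF g]] using R by (intro sum.cong refl) (simp add: R_def)
    then have "g (pact f0 (monom 1 i) v0) = pact f (monom 1 i) v" unfolding p G G0 .
    then show ?thesis by (simp add: pact_monom)
  qed
  \<comment> \<open>The admissible \<open>g\<close> form a coset of \<open>Stab\<close>. One exists
    because equal sequences give the frames of both pairs the same Gram matrix.\<close>
  have cardR: "card {g \<in> U n. R x g} = card C.Stab" if x: "x \<in> X" for x
  proof -
    obtain f v where fv: "x = (f, v)" by force
    have f: "f \<in> U n" "v \<in> V n" "is_minpoly f v F" "sq n f v = sq n f0 v0" using x by (auto simp: fv X_def)
    obtain P' where "cyclic_frame p rr q n r d f v F D P'"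
      using ex_cyclic_frame(2)[OF f(1-3) _ deg] D f(4) by auto
    then interpret C': cyclic_frame p rr q ty n r d f v F D P' .
    have "\<exists>g\<in>U n. \<forall>i<n. g (P i) = P' i"
    proof (rule ex_isometry)
      show "nonsing n (\<lambda>i j. ip n (P i) (P j))"
        using nonsing_gramJ[OF C.le_n C.nonsing_g]
        by (subst nonsing_cong[of n _ "gramJ r d (toep (sq n f0 v0))"]) (auto simp: C.Pg)
    qed (auto simp: C.PV C'.PV C.Pg C'.Pg f(4))
    then obtain g1 where g1: "g1 \<in> U n" "\<And>i. i < n \<Longrightarrow> g1 (P i) = P' i" by blast
    \<comment> \<open>\<open>g1\<close> is given on frame vectors only. The expansion of a Krylov
      vector in the frame is a congruence modulo \<open>F\<close>, so it holds for \<open>f\<close>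
      as it does for \<open>f0\<close>.\<close>
    have g1p: "g1 ((f0 ^^ i) v0) = (f ^^ i) v" for i
    proof -
      have "(f0 ^^ i) v0 \<in> spn (r + d) P"
        unfolding C.W_span by (rule range_eqI[of _ _ "monom 1 i"]) (simp add: pact_monom)
      then obtain a where a: "(f0 ^^ i) v0 = (\<Sum>i<r + d. smul (a i) (P i))" by (rule spn_E)
      let ?H = "polyof r a * D + polyof d (\<lambda>i. a (r + i))"
      have "pact f0 (monom 1 i - ?H) v0 = 0"
        unfolding pact_diff C.comb_P[symmetric] a[symmetric] by (simp add: pact_monom)
      then have "pact f (monom 1 i - ?H) v = 0"
        using is_minpoly_iff[OF F] is_minpoly_iff[OF f(3)] by blast
      then have "(f ^^ i) v = (\<Sum>i<r + d. smul (a i) (P' i))"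
        unfolding pact_diff C'.comb_P by (simp add: pact_monom)
      also have "\<dots> = g1 ((f0 ^^ i) v0)"
        unfolding a lin_comb[OF U_lin[OF g1(1)]] using C.le_n by (intro sum.cong refl) (simp add: g1(2))
      finally show ?thesis ..
    qed
    have g1v: "g1 v0 = v" using g1p[of 0] by simp
    have "bij_betw (\<lambda>k. g1 \<circ> k) C.Stab {g \<in> U n. R x g}"
    proof (rule bij_betw_byWitness[where f' = "\<lambda>g. inv g1 \<circ> g"])
      have "inv g1 \<circ> g \<in> C.Stab" if "g \<in> U n" "R x g" for g
        using that U_inv[OF g1(1)] U_comp g1p inv_cancel[OF g1(1)]
        by (simp add: C.Stab_def R_def fv) (metis (no_types, lifting) inv_cancel(1) g1(1) g1p)
      then show "(\<lambda>g. inv g1 \<circ> g) ` {g \<in> U n. R x g} \<subseteq> C.Stab" by blast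
      have Sv: "k v0 = v0" if "k \<in> C.Stab" for k
      proof (cases "r + d = 0")
        case True
        then have "F = 1" using C.degF is_minpoly_monic[OF F] by (metis degree_eq_zeroE lead_coeff_pCons(2) one_pCons pCons_0_0 add_is_0 coeff_pCons_0)
        then have "v0 = 0" using is_minpoly_ann[OF F] by simp
        then show ?thesis using lin_0[OF U_lin[OF C.Stab_U[OF that]]] by simp
      next
        case False
        then show ?thesis using that by (auto simp: C.Stab_def dest: spec[of _ 0])
      qed
      have "g1 \<circ> k \<in> U n \<and> R x (g1 \<circ> k)" if k: "k \<in> C.Stab" for k
      proof
        show "g1 \<circ> k \<in> U n" by (rule U_comp[OF g1(1) C.Stab_U[OF k]])
        have "k ((f0 ^^ i) v0) = (f0 ^^ i) v0" if "i < r + d" for i using k that by (simp add: C.Stab_def)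
        then show "R x (g1 \<circ> k)" by (simp add: R_def fv Sv[OF k] g1v g1p)
      qed
      then show "(\<lambda>k. g1 \<circ> k) ` C.Stab \<subseteq> {g \<in> U n. R x g}" by blast
    qed (simp_all add: fun_eq_iff inv_cancel[OF g1(1)])
    then show ?thesis by (simp add: bij_betw_same_card)
  qed
  \<comment> \<open>Conjugating back by \<open>g\<close> turns the pairs related to it into
    \<open>(f0 \<circ> k, v0)\<close> with \<open>k\<close> in \<open>Stab\<close>.\<close>
  have inner: "(\<Sum>x\<in>{x \<in> X. R x g}. tc n (fst x)) = (\<Sum>k\<in>C.Stab. tc n (f0 \<circ> k))" if g: "g \<in> U n" for g
  proof (rule sum.reindex_bij_witness[of _ "\<lambda>k. (g \<circ> (f0 \<circ> k) \<circ> inv g, g v0)" "\<lambda>x. inv f0 \<circ> (inv g \<circ> fst x \<circ> g)"])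
    note cs = inv_cancel[OF g] inv_cancel[OF f0]
    fix x assume xX: "x \<in> {x \<in> X. R x g}"
    obtain f v where fv: "x = (f, v)" by (cases x)
    have x: "(f, v) \<in> X" "R (f, v) g" using xX by (simp_all add: fv)
    have fU: "f \<in> U n" using x by (simp add: X_def)
    show "(g \<circ> (f0 \<circ> (inv f0 \<circ> (inv g \<circ> fst x \<circ> g))) \<circ> inv g, g v0) = x"
      using x by (auto simp: fv fun_eq_iff cs R_def)
    have "(inv f0 \<circ> (inv g \<circ> f \<circ> g)) ((f0 ^^ i) v0) = (f0 ^^ i) v0" for i
      using Rpow[OF x g, of i] Rpow[OF x g, of "Suc i"] by simp (metis cs)
    moreover have "inv f0 \<circ> (inv g \<circ> f \<circ> g) \<in> U n" using fU g f0 by (intro U_comp U_inv)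
    ultimately show "inv f0 \<circ> (inv g \<circ> fst x \<circ> g) \<in> C.Stab" by (simp add: C.Stab_def fv)
    show "tc n (f0 \<circ> (inv f0 \<circ> (inv g \<circ> fst x \<circ> g))) = tc n (fst x)"
    proof -
      have "f0 \<circ> (inv f0 \<circ> (inv g \<circ> f \<circ> g)) = inv g \<circ> f \<circ> inv (inv g)"
        using U_bij[OF g] by (auto simp: fun_eq_iff cs inv_inv_eq)
      then show ?thesis using tc_conj[OF U_inv[OF g] fU] by (simp add: fv)
    qed
  next
    fix k assume k: "k \<in> C.Stab"
    note cs = inv_cancel[OF g] inv_cancel[OF f0]
    show "inv f0 \<circ> (inv g \<circ> fst (g \<circ> (f0 \<circ> k) \<circ> inv g, g v0) \<circ> g) = k"
      by (auto simp: fun_eq_iff cs)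
    have KU: "f0 \<circ> k \<in> U n" using U_comp[OF f0 C.Stab_U[OF k]] .
    have fr: "cyclic_frame p rr q n r d (f0 \<circ> k) v0 F D P" and pw: "((f0 \<circ> k) ^^ i) v0 = (f0 ^^ i) v0" for i
      by (rule C.transfer[OF KU], use k in \<open>auto simp: C.Stab_def\<close>)+
    interpret K: cyclic_frame p rr q ty n r d "f0 \<circ> k" v0 F D P by (rule fr)
    have "sq n (f0 \<circ> k) v0 = sq n f0 v0" unfolding sq_def pw ..
    then have "(g \<circ> (f0 \<circ> k) \<circ> inv g, g v0) \<in> X"
      unfolding X_def using is_minpoly_conj[OF g] sq_conj[OF g] K.minF U_V[OF g v0] U_comp[OF U_comp[OF g KU] U_inv[OF g]] by simp
    moreover have "R (g \<circ> (f0 \<circ> k) \<circ> inv g, g v0) g"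
      unfolding R_def fst_conv snd_conv conj_funpow[OF g] cs pw by simp
    ultimately show "(g \<circ> (f0 \<circ> k) \<circ> inv g, g v0) \<in> {x \<in> X. R x g}" by simp
  qed
  have "of_nat (card C.Stab) * (\<Sum>x\<in>X. tc n (fst x)) = (\<Sum>x\<in>X. \<Sum>g\<in>{g \<in> U n. R x g}. tc n (fst x))"
    by (simp add: cardR sum_distrib_left)
  also have "\<dots> = (\<Sum>g\<in>U n. \<Sum>x\<in>{x \<in> X. R x g}. tc n (fst x))"
    by (rule sum.swap_restrict[OF finX finite_U])
  also have "\<dots> = of_nat (card (U n)) * (\<Sum>k\<in>C.Stab. tc n (f0 \<circ> k))" by (simp add: inner)
  also have "\<dots> = of_nat (card C.Stab) * (of_nat (card (U n)) * (pc F * rc (F div D) * E (n - (2 * r + d))))"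
    unfolding stab_sum[OF C.cyclic_frame_axioms] by simp
  finally show ?thesis using C.card_Stab_pos by (simp add: case_prod_unfold)
qed

end

section \<open>Realising every type\<close>

lemma indep_mono:
  assumes "indep n P" "m \<le> n" shows "indep m P"
  unfolding indep_def
proof (intro allI impI)
  fix a i assume a: "(\<Sum>i<m. smul (a i) (P i)) = 0" and i: "i < m"
  have "(\<Sum>i<n. smul (if i < m then a i else 0) (P i)) = (\<Sum>i<m. smul (a i) (P i))"
    by (rule sum.mono_neutral_cong_right) (use assms(2) in auto)
  then have "(if i < m then a i else 0) = 0"
    using indepD[OF assms(1), of "\<lambda>i. if i < m then a i else 0" i] a i assms(2) by simp
  then show "a i = 0" using i by simp
qed

lemma dvd_pCons_0D:
  fixes F H :: "'k::field poly"
  assumes "coeff F 0 \<noteq> 0" "F dvd pCons 0 H" shows "F dvd H"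
proof -
  obtain K where K: "pCons 0 H = F * K" using assms(2) by (rule dvdE)
  have "coeff F 0 * coeff K 0 = 0" using arg_cong[OF K, of "\<lambda>p. coeff p 0"] by (simp add: coeff_mult_0)
  then have "coeff K 0 = 0" using assms(1) by simp
  then obtain K' where "K = pCons 0 K'" by (metis coeff_pCons_0 pCons_cases)
  then have "pCons 0 H = pCons 0 (F * K')" using K by simp
  then show ?thesis by simp
qed

lemma finite_polys: "finite {F :: 'k::{finite,field} poly. degree F \<le> m}"
proof (rule finite_subset)
  show "{F :: 'k poly. degree F \<le> m} \<subseteq> polyof (Suc m) ` V (Suc m)"
  proof
    fix F :: "'k poly" assume "F \<in> {F. degree F \<le> m}"
    then have d: "degree F \<le> m" by simp
    then have "polyof (Suc m) (coeff F) = F" by (intro polyof_coeff) simp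
    moreover have "coeff F \<in> V (Suc m)" using d by (auto simp: V_def coeff_eq_0)
    ultimately show "F \<in> polyof (Suc m) ` V (Suc m)" by (metis imageI)
  qed
qed simp

context hermitian_field
begin

text \<open>The value which the pairing of \<open>A(f) v\<close> with \<open>B(f) v\<close> must
  take if that of \<open>v\<close> with \<open>f^j v\<close> is \<open>s j\<close>. The variant
  \<open>frm0\<close> has no truncation bound and is written through the action of
  \<open>sh\<close>, so that reduction modulo \<open>D\<close> applies.\<close>

definition frm :: "(int \<Rightarrow> 'a) \<Rightarrow> nat \<Rightarrow> 'a poly \<Rightarrow> 'a poly \<Rightarrow> 'a" where
  "frm s N A B = (\<Sum>i<N. \<Sum>j<N. cj (coeff A i) * coeff B j * s (int j - int i))"

definition frm0 :: "(int \<Rightarrow> 'a) \<Rightarrow> 'a poly \<Rightarrow> 'a poly \<Rightarrow> 'a" where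
  "frm0 s A B = (\<Sum>i\<le>degree A. cj (coeff A i) * pact sh B s (- int i))"

lemma frm0_frm:
  assumes "A = 0 \<or> degree A < N" "B = 0 \<or> degree B < N"
  shows "frm0 s A B = frm s N A B"
proof -
  have pB: "pact sh B s j = (\<Sum>k<N. coeff B k * s (j + int k))" for j
  proof (cases "B = 0")
    case False
    then show ?thesis using assms(2) by (subst pact_bound_less[of B N]) (auto simp: sh_pow)
  qed simp
  have "frm0 s A B = (\<Sum>i<N. cj (coeff A i) * pact sh B s (- int i))"
  proof (cases "A = 0")
    case False
    then show ?thesis
      using assms(1) unfolding frm0_def by (intro sum.mono_neutral_left) (auto simp: coeff_eq_0)
  qed (simp add: frm0_def)
  also have "\<dots> = frm s N A B"
    unfolding pB frm_def sum_distrib_left by (simp add: mult.assoc add.commute)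
  finally show ?thesis .
qed

lemma frm_sym: "herm_seq s \<Longrightarrow> frm s N B A = cj (frm s N A B)"
proof -
  assume s: "herm_seq s"
  have "cj (s (int j - int i)) = s (int i - int j)" for i j
    using s unfolding herm_seq_def by (metis minus_diff_eq)
  then have "cj (frm s N A B) = (\<Sum>i<N. \<Sum>j<N. coeff A i * cj (coeff B j) * s (int i - int j))"
    unfolding frm_def by simp
  also have "\<dots> = frm s N B A" unfolding frm_def by (subst sum.swap) (simp add: mult_ac)
  finally show ?thesis by simp
qed

lemma frm0_sym: assumes "herm_seq s" shows "frm0 s B A = cj (frm0 s A B)"
proof -
  let ?N = "Suc (max (degree A) (degree B))"
  have 1: "frm0 s B A = frm s ?N B A" by (rule frm0_frm) auto
  have 2: "frm0 s A B = frm s ?N A B" by (rule frm0_frm) auto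
  show ?thesis unfolding 1 2 by (rule frm_sym[OF assms])
qed

text \<open>The coefficients of the form depend on \<open>j - i\<close> only, so multiplication by
  the variable preserves it.\<close>

lemma frm0_shift: "frm0 s (pCons 0 A) (pCons 0 B) = frm0 s A B"
proof -
  let ?N = "Suc (max (degree A) (degree B))"
  have "frm0 s (pCons 0 A) (pCons 0 B) = frm s (Suc ?N) (pCons 0 A) (pCons 0 B)"
    by (rule frm0_frm) (auto simp: degree_pCons_eq_if)
  also have "\<dots> = frm s ?N A B"
    unfolding frm_def sum.lessThan_Suc_shift[of _ ?N] by simp
  also have "\<dots> = frm0 s A B" by (rule frm0_frm[symmetric]) auto
  finally show ?thesis .
qed

lemma frm0_mod:
  assumes s: "herm_seq s" and D: "pact sh D s = 0"
  shows "frm0 s A B = frm0 s (A mod D) (B mod D)"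
proof -
  have m: "pact sh G s = pact sh (G mod D) s" for G
  proof -
    have "pact sh G s = pact sh (G div D * D + G mod D) s" by simp
    also have "\<dots> = pact sh (G mod D) s"
      unfolding pact_add pact_mult[OF lin_sh] D by (simp add: lin_0[OF lin_pact[OF lin_sh]])
    finally show ?thesis .
  qed
  have r: "frm0 s A B = frm0 s A (B mod D)" for A B unfolding frm0_def m[of B] ..
  show ?thesis
    unfolding r[of A B] frm0_sym[OF s, of A "B mod D"] r[of "B mod D" A] frm0_sym[OF s, of "A mod D" "B mod D"] by simp
qed

text \<open>In the proof \<open>\<Phi>\<close> realises the quotient of the polynomial ring by \<open>F\<close>, with the form determined by \<open>s\<close>,
  inside the standard space; multiplication by the variable then extends to an isometry.\<close>
lemma ex_type:
  assumes F: "lead_coeff F = 1" "coeff F 0 \<noteq> 0" and s: "herm_seq s" and D: "is_minpoly sh s D" and FD: "D dvd F"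
    and deg: "degree D = d" "degree F = r + d" and n: "2 * r + d \<le> n"
  shows "\<exists>f\<in>U n. \<exists>v\<in>V n. is_minpoly f v F \<and> sq n f v = s"
proof -
  let ?g = "toep s"
  have D0: "D \<noteq> 0" using is_minpoly_monic[OF D] by auto
  have F0: "F \<noteq> 0" using F(1) by auto
  have ns: "nonsing d ?g" using nonsing_toep[OF D] deg by simp
  have ge: "gramJ r d ?g j i = cj (gramJ r d ?g i j)" for i j by (rule gramJ_sym) (rule toep_herm[OF s])
  obtain P where P: "\<And>i. i < n \<Longrightarrow> P i \<in> V n" "\<And>i j. i < n \<Longrightarrow> j < n \<Longrightarrow> ip n (P i) (P j) = gramJ r d ?g i j"
    using ex_frame_with_gram[OF nonsing_gramJ[OF n ns] ge] by blast
  have nsP: "nonsing n (\<lambda>i j. ip n (P i) (P j))"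
    using nonsing_gramJ[OF n ns] by (subst nonsing_cong[of n _ "gramJ r d ?g"]) (auto simp: P)
  have ind: "indep (r + d) P"
    by (rule indep_mono[OF nonsing_gram_indep[OF herm_form_ip nsP]]) (use n in auto)
  \<comment> \<open>Coordinates modulo \<open>F\<close> in the basis \<open>X^i D\<close> for
    \<open>i < r\<close>, then \<open>X^j\<close> for \<open>j < d\<close>, matching the radical and
    middle blocks of the frame.\<close>
  define co where "co A i = (if i < r then coeff ((A mod F) div D) i else coeff (A mod D) (i - r))" for A i
  define \<Phi> where "\<Phi> A = (\<Sum>i<r + d. smul (co A i) (P i))" for A
  have co_add: "co (A + B) i = co A i + co B i" for A B i
    by (simp add: co_def poly_mod_add_left poly_div_add_left)
  have co_smult: "co (smult x A) i = x * co A i" for x A i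
    by (simp add: co_def mod_smult_left div_smult_left)
  have \<Phi>_add: "\<Phi> (A + B) = \<Phi> A + \<Phi> B" for A B
    unfolding \<Phi>_def co_add smul_add_left sum.distrib ..
  have \<Phi>_smult: "\<Phi> (smult x A) = smul x (\<Phi> A)" for x A
    unfolding \<Phi>_def co_smult smul_sum_right by simp
  have \<Phi>_0: "\<Phi> 0 = 0" using \<Phi>_smult[of 0 0] by simp
  have \<Phi>_sum: "\<Phi> (sum X A) = (\<Sum>i\<in>A. \<Phi> (X i))" for X :: "nat \<Rightarrow> 'a poly" and A
    by (induction A rule: infinite_finite_induct) (simp_all only: sum.infinite sum.empty sum.insert \<Phi>_0 \<Phi>_add simp_thms)
  have mm: "A mod F mod D = A mod D" for A using FD by (rule mod_mod_cancel)
  have expand: "polyof r (co A) * D + polyof d (\<lambda>i. co A (r + i)) = A mod F" for A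
  proof -
    have "polyof r (co A) = polyof r (coeff ((A mod F) div D))" by (simp add: polyof_def co_def)
    then have 1: "polyof r (co A) = (A mod F) div D"
      using polyof_coeff_div[of D F r A] D0 F0 deg by simp
    have "polyof d (coeff (A mod D)) = A mod D"
      using degree_mod_less[OF D0, of A] deg by (intro polyof_coeff) auto
    then have 2: "polyof d (\<lambda>i. co A (r + i)) = A mod F mod D" by (simp add: co_def mm)
    show ?thesis unfolding 1 2 by simp
  qed
  have \<Phi>_eq_0: "\<Phi> A = 0 \<longleftrightarrow> F dvd A" for A
  proof
    assume "\<Phi> A = 0"
    then have z: "co A i = 0" if "i < r + d" for i using indepD[OF ind _ that, of "co A"] unfolding \<Phi>_def by blast
    have "polyof r (co A) = 0" "polyof d (\<lambda>i. co A (r + i)) = 0" using z by (simp_all add: polyof_def)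
    then have "A mod F = 0" using expand[of A] by simp
    then show "F dvd A" by auto
  next
    assume FA: "F dvd A"
    then have "A mod F = 0" "A mod D = 0" using FD dvd_trans by (auto simp: mod_eq_0_iff_dvd)
    then have "co A i = 0" for i by (simp add: co_def)
    then show "\<Phi> A = 0" by (simp add: \<Phi>_def)
  qed
  have form: "ip n (\<Phi> A) (\<Phi> B) = frm0 s A B" for A B
  proof -
    have "ip n (\<Phi> A) (\<Phi> B) = (\<Sum>i<r + d. \<Sum>j<r + d. cj (co A i) * co B j * gramJ r d ?g i j)"
      unfolding \<Phi>_def ip_comb using n by (intro sum.cong refl) (simp add: P)
    also have "\<dots> = frm s d (A mod D) (B mod D)"
      unfolding sum_lessThan_add frm_def by (simp add: gramJ_def co_def toep_def)
    also have "\<dots> = frm0 s (A mod D) (B mod D)"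
      using degree_mod_less[OF D0, of A] degree_mod_less[OF D0, of B] deg by (intro frm0_frm[symmetric]) auto
    also have "\<dots> = frm0 s A B" by (rule frm0_mod[OF s is_minpoly_ann[OF D], symmetric])
    finally show ?thesis .
  qed
  define e where "e i = (if i < r then monom 1 i * D else monom 1 (i - r))" for i :: nat
  have e_comb: "(\<Sum>i<r + d. smult (a i) (e i)) = polyof r a * D + polyof d (\<lambda>i. a (r + i))" for a
    unfolding sum_lessThan_add by (simp add: e_def polyof_def sum_distrib_right smult_monom flip: mult_smult_left)
  have \<Phi>_e: "\<Phi> (e i) = P i" if "i < r + d" for i
  proof -
    have "co (e i) j = (if j = i then 1 else 0)" if "j < r + d" for j
    proof (cases "i < r")
      case True
      have "degree (monom 1 i * D) < degree F"
        using degree_mult_le[of "monom 1 i" D] degree_monom_le[of "1::'a" i] True deg by simp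
      then show ?thesis using True that D0 by (auto simp: co_def e_def mod_poly_less)
    next
      case False
      then have l: "degree (monom (1::'a) (i - r)) < d" using \<open>i < r + d\<close> by (simp add: degree_monom_eq)
      then have "degree (monom (1::'a) (i - r)) < degree F" using deg by simp
      then show ?thesis using False that l deg by (auto simp: co_def e_def mod_poly_less div_poly_less)
    qed
    then have "\<Phi> (e i) = (\<Sum>j<r + d. if j = i then P i else 0)" unfolding \<Phi>_def by (intro sum.cong refl) auto
    then show ?thesis using that by simp
  qed
  \<comment> \<open>The frame after multiplication by the variable. Its Gram matrix is unchanged by
    \<open>frm0_shift\<close>, and it stays independent because the variable is invertible modulo
    \<open>F\<close>.\<close>
  define W' where "W' i = \<Phi> (pCons 0 (e i))" for i
  have comb_W': "(\<Sum>i<r + d. smul (a i) (W' i)) = \<Phi> (pCons 0 (\<Sum>i<r + d. smult (a i) (e i)))" for a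
  proof -
    have "pCons 0 (\<Sum>i<r + d. smult (a i) (e i)) = (\<Sum>i<r + d. smult (a i) (pCons 0 (e i)))"
      by (rule poly_eqI) (simp add: coeff_sum coeff_pCons split: nat.split)
    then show ?thesis unfolding W'_def by (simp only: \<Phi>_sum \<Phi>_smult)
  qed
  have \<Phi>_V: "\<Phi> A \<in> V n" for A
    unfolding \<Phi>_def using P(1) n by (intro V_sum V_smul) auto
  have W'V: "W' i \<in> V n" for i unfolding W'_def by (rule \<Phi>_V)
  have W'g: "ip n (W' i) (W' j) = gramJ r d ?g i j" if "i < r + d" "j < r + d" for i j
  proof -
    have "ip n (W' i) (W' j) = ip n (\<Phi> (e i)) (\<Phi> (e j))" unfolding W'_def form frm0_shift ..
    also have "\<dots> = gramJ r d ?g i j" using that n by (simp add: \<Phi>_e P(2))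
    finally show ?thesis .
  qed
  have W'i: "indep (r + d) W'"
    unfolding indep_def
  proof (intro allI impI)
    fix a i assume a: "(\<Sum>i<r + d. smul (a i) (W' i)) = 0" and i: "i < r + d"
    then have "F dvd pCons 0 (\<Sum>i<r + d. smult (a i) (e i))" unfolding comb_W' \<Phi>_eq_0 by blast
    then have "F dvd (\<Sum>i<r + d. smult (a i) (e i))" by (rule dvd_pCons_0D[OF F(2)])
    then have "\<Phi> (\<Sum>i<r + d. smult (a i) (e i)) = 0" unfolding \<Phi>_eq_0 .
    then have "(\<Sum>i<r + d. smul (a i) (\<Phi> (e i))) = 0" by (simp only: \<Phi>_sum \<Phi>_smult)
    moreover have "(\<Sum>i<r + d. smul (a i) (\<Phi> (e i))) = (\<Sum>i<r + d. smul (a i) (P i))"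
      by (intro sum.cong refl) (simp add: \<Phi>_e)
    ultimately have "(\<Sum>i<r + d. smul (a i) (P i)) = 0" by (simp only:)
    then show "a i = 0" using indepD[OF ind _ i, of a] by blast
  qed
  obtain P' where P': "\<And>i. i < n \<Longrightarrow> P' i \<in> V n" "\<And>i. i < r + d \<Longrightarrow> P' i = W' i"
    "\<And>i j. i < n \<Longrightarrow> j < n \<Longrightarrow> ip n (P' i) (P' j) = gramJ r d ?g i j"
    using ex_adapted_frame(2)[OF W'V W'i W'g ns] by blast
  have "\<exists>f\<in>U n. \<forall>i<n. f (P i) = P' i" by (rule ex_isometry[OF P(1) P'(1) _ nsP]) (simp_all add: P P')
  then obtain f where f: "f \<in> U n" and fP: "\<And>i. i < n \<Longrightarrow> f (P i) = P' i" by blast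
  note lf = U_lin[OF f]
  have f\<Phi>: "f (\<Phi> A) = \<Phi> (pCons 0 A)" for A
  proof -
    have "f (\<Phi> A) = (\<Sum>i<r + d. smul (co A i) (f (P i)))" unfolding \<Phi>_def by (rule lin_comb[OF lf])
    also have "\<dots> = (\<Sum>i<r + d. smul (co A i) (W' i))" using n by (intro sum.cong refl) (simp add: fP P')
    also have "\<dots> = \<Phi> (pCons 0 (A mod F))" unfolding comb_W' e_comb expand ..
    finally have 1: "f (\<Phi> A) = \<Phi> (pCons 0 (A mod F))" .
    have "pCons 0 A = pCons 0 (A mod F) + pCons 0 (A div F * F)" by simp
    then have "\<Phi> (pCons 0 A) = \<Phi> (pCons 0 (A mod F)) + \<Phi> (pCons 0 (A div F * F))" by (simp only: \<Phi>_add)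
    moreover have "\<Phi> (pCons 0 (A div F * F)) = 0"
      unfolding \<Phi>_eq_0 by (metis dvd_mult2 dvd_triv_right mult_pCons_left smult_0_left add_0 dvd_triv_right)
    ultimately show ?thesis using 1 by simp
  qed
  define v where "v = \<Phi> 1"
  have pactf: "pact f G v = \<Phi> G" for G
  proof (induction G)
    case (pCons a G)
    have "pCons a G = smult a 1 + pCons 0 G" by (simp add: one_pCons)
    then have "\<Phi> (pCons a G) = smul a v + \<Phi> (pCons 0 G)" unfolding v_def by (metis \<Phi>_add \<Phi>_smult)
    then show ?case unfolding pact_pCons[OF lf] pCons(2) f\<Phi> by simp
  qed (simp add: \<Phi>_0)
  have "is_minpoly f v F" unfolding is_minpoly_def pactf \<Phi>_eq_0 using F(1) by blast
  moreover have "sq n f v = s"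
  proof
    fix j :: int
    have pw: "(f ^^ k) v = \<Phi> (monom 1 k)" for k using pactf[of "monom 1 k"] by (simp add: pact_monom)
    have 1: "ip n v (\<Phi> B) = pact sh B s 0" for B unfolding v_def form by (simp add: frm0_def)
    have 2: "ip n v (\<Phi> (monom 1 k)) = s (int k)" for k unfolding 1 by (simp add: pact_monom sh_pow)
    show "sq n f v j = s j"
    proof (cases "j \<ge> 0")
      case True
      then show ?thesis unfolding sq_def pw 2 by simp
    next
      case False
      have "ip n (\<Phi> (monom 1 (nat (- j)))) v = cj (s (- j))"
        using ip_sym[of n "\<Phi> (monom 1 (nat (- j)))" v] False unfolding 2 by simp
      also have "\<dots> = s j" using s unfolding herm_seq_def by (metis minus_minus)
      finally show ?thesis using False unfolding sq_def pw by simp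
    qed
  qed
  ultimately show ?thesis using f \<Phi>_V[of 1] by (auto simp: v_def)
qed

end

section \<open>Gauss sums and Hermitian recurrent sequences\<close>

definition minp :: "(('i \<Rightarrow> 'k::field) \<Rightarrow> 'i \<Rightarrow> 'k) \<Rightarrow> ('i \<Rightarrow> 'k) \<Rightarrow> 'k poly" where
  "minp T v = (THE F. is_minpoly T v F)"

lemma minp_eq: "is_minpoly T v F \<Longrightarrow> minp T v = F"
  unfolding minp_def by (rule the_equality) (auto intro: is_minpoly_unique)

context hermitian_field
begin

lemma ex_minpoly_V:
  assumes f: "f \<in> U n" and v: "v \<in> V n"
  shows "\<exists>F. is_minpoly f v F"
proof -
  have "range (\<lambda>i. (f ^^ i) v) \<subseteq> V n" using U_V[OF U_funpow[OF f] v] by auto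
  then have "finite (range (\<lambda>i. (f ^^ i) v))" by (rule finite_subset) simp
  then have "\<not> inj (\<lambda>i. (f ^^ i) v)" using finite_imageD infinite_UNIV_nat by blast
  then obtain i j where ij: "i \<noteq> j" "(f ^^ i) v = (f ^^ j) v" by (auto simp: inj_def)
  have "coeff (monom 1 i - monom (1::'a) j) i = 1" using ij by simp
  then have "monom 1 i - monom (1::'a) j \<noteq> 0" by (metis coeff_0 zero_neq_one)
  moreover have "pact f (monom 1 i - monom 1 j) v = 0" using ij by (simp add: pact_diff pact_monom)
  ultimately show ?thesis by (rule ex_minpoly[OF U_lin[OF f]])
qed

definition HS :: "nat \<Rightarrow> (int \<Rightarrow> 'a) set" where
  "HS d = {s. herm_seq s \<and> (\<exists>D. is_minpoly sh s D) \<and> degree (minp sh s) = d}"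

lemma is_minpoly_minp: "\<exists>D. is_minpoly T v D \<Longrightarrow> is_minpoly T v (minp T v)"
  using minp_eq by blast

lemma minpoly_sh_coeff_0: "is_minpoly sh s D \<Longrightarrow> coeff D 0 \<noteq> 0"
  by (rule is_minpoly_coeff_0[OF _ lin_sh sh_eq_0D])

text \<open>A sequence is determined by its minimal polynomial and one window of values.\<close>

lemma finite_HS: "finite (HS d)"
proof -
  let ?h = "\<lambda>s :: int \<Rightarrow> 'a. (minp sh s, \<lambda>i. if i < d then s (int i) else 0)"
  have "inj_on ?h (HS d)"
  proof (rule inj_onI)
    fix s t assume st: "s \<in> HS d" "t \<in> HS d" "?h s = ?h t"
    let ?D = "minp sh s"
    have e: "minp sh t = ?D" using st(3) by simp
    have "is_minpoly sh t (minp sh t)" by (rule is_minpoly_minp) (use st(2) in \<open>auto simp: HS_def\<close>)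
    moreover have "is_minpoly sh s ?D" by (rule is_minpoly_minp) (use st(1) in \<open>auto simp: HS_def\<close>)
    ultimately have D: "is_minpoly sh s ?D" "is_minpoly sh t ?D" "degree ?D = d"
      using st(1) by (simp_all add: HS_def e)
    have w: "s (int i) = t (int i)" if "i < d" for i
      using st(3) that by (auto simp: fun_eq_iff) (metis that)
    have "s - t = 0"
    proof (rule recurrence_zero[OF is_minpoly_monic[OF D(1)] minpoly_sh_coeff_0[OF D(1)]])
      show "pact sh ?D (s - t) = 0"
        unfolding lin_diff[OF lin_pact[OF lin_sh]] by (simp add: is_minpoly_ann D)
      show "(s - t) (0 + int i) = 0" if "i < degree ?D" for i using w that D(3) by simp
    qed
    then show "s = t" by simp
  qed
  moreover have "?h ` HS d \<subseteq> {F. degree F \<le> d} \<times> V d" by (auto simp: HS_def V_def)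
  moreover have "finite ({F :: 'a poly. degree F \<le> d} \<times> (V d :: (nat \<Rightarrow> 'a) set))"
    by (intro finite_cartesian_product finite_polys finite_V)
  ultimately show ?thesis using finite_subset finite_imageD by blast
qed

text \<open>Indexed by twice the degree, the dimension taken up by a radical and its dual.\<close>
definition PB :: "nat \<Rightarrow> 'a poly set" where
  "PB m = {B. lead_coeff B = 1 \<and> coeff B 0 \<noteq> 0 \<and> 2 * degree B = m}"

lemma finite_PB: "finite (PB m)"
  by (rule finite_subset[OF _ finite_polys[of m]]) (auto simp: PB_def)

text \<open>Zero is a norm once and every other element of \<open>Fq\<close> is one
  \<open>q + 1\<close> times, so the sum is \<open>1 + (q + 1) * (0 - 1)\<close>.\<close>

lemma sum_norm_char:
  fixes \<phi> :: "'a \<Rightarrow> complex"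
  assumes add: "\<And>x y. \<phi> (x + y) = \<phi> x * \<phi> y" and "\<phi> 0 = 1" and s: "s \<in> Fq" "\<phi> s \<noteq> 1"
  shows "(\<Sum>x\<in>UNIV. \<phi> (cj x * x)) = - of_nat q"
proof -
  have "(\<Sum>x\<in>UNIV. \<phi> (cj x * x)) = (\<Sum>y\<in>Fq. \<Sum>x\<in>{x \<in> UNIV. x * cj x = y}. \<phi> (x * cj x))"
    by (subst sum.group) (auto simp: Fq_norm mult.commute)
  also have "\<dots> = (\<Sum>y\<in>Fq. of_nat (card {x. x * cj x = y}) * \<phi> y)"
    by (intro sum.cong refl) simp
  also have "\<dots> = of_nat (card {x. x * cj x = 0}) * \<phi> 0 + (\<Sum>y\<in>Fq - {0}. of_nat (card {x. x * cj x = y}) * \<phi> y)"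
    by (subst sum.remove[of _ 0]) auto
  also have "{x. x * cj x = 0} = {0}" by auto
  also have "(\<Sum>y\<in>Fq - {0}. of_nat (card {x. x * cj x = y}) * \<phi> y) = (\<Sum>y\<in>Fq - {0}. of_nat (q + 1) * \<phi> y)"
    by (intro sum.cong refl) (simp add: card_norm_fibre)
  also have "\<dots> = of_nat (q + 1) * ((\<Sum>y\<in>Fq. \<phi> y) - \<phi> 0)"
    by (simp add: sum_distrib_left[symmetric] sum_diff1)
  also have "(\<Sum>y\<in>Fq. \<phi> y) = 0"
    by (rule sum_additive_char_eq_0[of _ _ s]) (use s in \<open>auto simp: add Fq_add Fq_minus\<close>)
  finally show ?thesis using assms(2) by simp
qed

lemma gauss_sum:
  fixes \<phi> :: "'a \<Rightarrow> complex"
  assumes add: "\<And>x y. \<phi> (x + y) = \<phi> x * \<phi> y" and 0: "\<phi> 0 = 1" and s: "s \<in> Fq" "\<phi> s \<noteq> 1"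
  shows "(\<Sum>v\<in>V n. \<phi> (ip n v v)) = (- of_nat q) ^ n"
proof -
  have ex: "\<phi> (sum h A) = (\<Prod>i\<in>A. \<phi> (h i))" if "finite A" for h :: "nat \<Rightarrow> 'a" and A
    using that by (induction A rule: finite_induct) (auto simp: 0 add)
  have "(\<Sum>v\<in>V n. \<phi> (ip n v v)) = (\<Sum>v\<in>V n. \<Prod>i<n. \<phi> (cj (restrict v {..<n} i) * restrict v {..<n} i))"
    unfolding ip_def by (intro sum.cong refl) (simp add: ex)
  also have "\<dots> = (\<Sum>g\<in>PiE {..<n} (\<lambda>_. UNIV). \<Prod>i<n. \<phi> (cj (g i) * g i))"
    by (rule sum.reindex_bij_betw[OF bij_betw_V])
  also have "\<dots> = (\<Prod>i<n. \<Sum>x\<in>UNIV. \<phi> (cj x * x))"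
    by (rule prod_sum_PiE[symmetric]) auto
  also have "\<dots> = (- of_nat q) ^ n" using sum_norm_char[OF add 0 s] by simp
  finally show ?thesis .
qed

section \<open>Polynomials that agree with their conjugate reversal\<close>

definition star :: "'a poly \<Rightarrow> 'a poly" where "star G = map_poly cj (reflect_poly G)"

lemma coeff_star: "coeff (star G) i = (if i \<le> degree G then cj (coeff G (degree G - i)) else 0)"
  by (simp add: star_def coeff_map_poly coeff_reflect_poly)

lemma star_mult: "star (F * G) = star F * star G"
  unfolding star_def reflect_poly_mult by (rule poly_eqI) (simp add: coeff_map_poly coeff_mult)

text \<open>Agreement is up to a constant, which for monic \<open>G\<close> is forced to be
  \<open>cj (coeff G 0)\<close> by the coefficient of degree \<open>m\<close>.\<close>

definition scr :: "nat \<Rightarrow> 'a poly set" where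
  "scr m = {G. lead_coeff G = 1 \<and> degree G = m \<and> star G = smult (cj (coeff G 0)) G}"

lemma finite_scr: "finite (scr m)"
  by (rule finite_subset[OF _ finite_polys[of m]]) (auto simp: scr_def)

lemma scr_coeff: "G \<in> scr m \<Longrightarrow> i \<le> m \<Longrightarrow> cj (coeff G (m - i)) = cj (coeff G 0) * coeff G i"
  unfolding scr_def using coeff_star[of G i] by auto

lemma scr_norm: "G \<in> scr m \<Longrightarrow> coeff G 0 * cj (coeff G 0) = 1"
  using scr_coeff[of G m 0] by (auto simp: scr_def mult.commute)

lemma scr_coeff_0: "G \<in> scr m \<Longrightarrow> coeff G 0 \<noteq> 0"
  using scr_norm by force

lemma scr_mult: "F \<in> scr k \<Longrightarrow> G \<in> scr m \<Longrightarrow> F * G \<in> scr (k + m)"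
proof -
  assume F: "F \<in> scr k" and G: "G \<in> scr m"
  then have "F \<noteq> 0" "G \<noteq> 0" by (auto simp: scr_def)
  then have "degree (F * G) = k + m" using F G by (simp add: scr_def degree_mult_eq)
  moreover have "lead_coeff F = 1" "lead_coeff G = 1" using F G by (auto simp: scr_def)
  then have "lead_coeff (F * G) = 1" by (simp only: lead_coeff_mult mult_1)
  moreover have "star (F * G) = smult (cj (coeff (F * G) 0)) (F * G)"
    unfolding star_mult using F G by (simp add: scr_def coeff_mult_0 mult.commute)
  ultimately show ?thesis by (simp add: scr_def)
qed

lemma scr_div:
  assumes "D * G \<in> scr m" "D \<in> scr d"
  shows "G \<in> scr (m - d)"
proof -
  have nz: "D \<noteq> 0" "G \<noteq> 0" "cj (coeff D 0) \<noteq> 0" using assms scr_coeff_0 by (auto simp: scr_def)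
  have "degree (D * G) = m" "degree D = d" using assms by (auto simp: scr_def)
  then have deg: "degree G = m - d" using degree_mult_eq[OF nz(1,2)] by simp
  have "lead_coeff (D * G) = 1" "lead_coeff D = 1" using assms by (auto simp: scr_def)
  then have lc: "lead_coeff G = 1" by (simp only: lead_coeff_mult mult_1)
  have "star D * star G = smult (cj (coeff D 0) * cj (coeff G 0)) (D * G)"
    using assms(1) unfolding scr_def by (simp add: star_mult coeff_mult_0)
  moreover have "star D = smult (cj (coeff D 0)) D" using assms(2) by (simp add: scr_def)
  ultimately have "smult (cj (coeff D 0)) D * star G = smult (cj (coeff D 0)) D * smult (cj (coeff G 0)) G"
    by (simp add: mult.commute)
  moreover have "smult (cj (coeff D 0)) D \<noteq> 0" using nz by simp
  ultimately have "star G = smult (cj (coeff G 0)) G" by (rule mult_left_cancel[THEN iffD1, rotated])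
  then show ?thesis using deg lc by (simp add: scr_def)
qed

lemma pact_star:
  assumes "herm_seq s" "pact sh D s = 0" shows "pact sh (star D) s = 0"
proof
  fix j
  let ?d = "degree D"
  have s: "s j = cj (s (- j))" for j using assms(1) unfolding herm_seq_def by (metis minus_minus)
  have "degree (star D) \<le> ?d" by (rule degree_le) (simp add: coeff_star)
  then have "pact sh (star D) s j = (\<Sum>i\<le>?d. coeff (star D) i * s (j + int i))"
    by (simp add: pact_bound[of _ ?d] sh_pow)
  also have "\<dots> = (\<Sum>i\<le>?d. cj (coeff D (?d - i) * s (- j - int i)))"
    by (intro sum.cong refl) (subst s, simp add: coeff_star)
  also have "\<dots> = (\<Sum>k\<le>?d. cj (coeff D k * s (- j - int ?d + int k)))"
    by (rule sum.reindex_bij_witness[of _ "\<lambda>k. ?d - k" "\<lambda>k. ?d - k"]) (auto simp: of_nat_diff algebra_simps)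
  also have "\<dots> = cj (pact sh D s (- j - int ?d))" by (simp add: pact_sh)
  finally show "pact sh (star D) s j = 0 j" by (simp add: assms(2))
qed

text \<open>\<open>star D\<close> also annihilates a Hermitian sequence, so \<open>D\<close> divides
  it, and the degrees leave only a constant factor.\<close>

lemma minpoly_scr:
  assumes s: "herm_seq s" and D: "is_minpoly sh s D"
  shows "D \<in> scr (degree D)"
proof -
  have dv: "D dvd star D" using is_minpoly_iff[OF D] pact_star[OF s is_minpoly_ann[OF D]] by blast
  then obtain K where K: "star D = D * K" by (rule dvdE)
  have "degree (star D) \<le> degree D" by (rule degree_le) (simp add: coeff_star)
  moreover have l: "coeff (star D) (degree D) = cj (coeff D 0)" by (simp add: coeff_star)
  moreover have "star D \<noteq> 0" using l minpoly_sh_coeff_0[OF D] by (metis cj_eq_0_iff coeff_0)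
  ultimately have "degree K = 0" using K by (simp add: degree_mult_eq)
  then obtain x where "K = [:x:]" by (rule degree_eq_zeroE)
  then have "star D = smult x D" using K by simp
  moreover from this have "x = cj (coeff D 0)" using l is_minpoly_monic[OF D] by simp
  ultimately show ?thesis using is_minpoly_monic[OF D] by (simp add: scr_def)
qed

section \<open>Counting solutions of recurrences\<close>

definition Sol :: "'a poly \<Rightarrow> (int \<Rightarrow> 'a) set" where "Sol G = {s. pact sh G s = 0}"
definition HSol :: "'a poly \<Rightarrow> (int \<Rightarrow> 'a) set" where "HSol G = {s \<in> Sol G. herm_seq s}"

text \<open>A window of \<open>m\<close> consecutive values moves by the companion map
  \<open>C\<close>, which has the right inverse \<open>D\<close> because \<open>coeff G 0\<close> is
  nonzero; iterating both from the window \<open>a\<close> reaches all integer indices.\<close>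

lemma ex_recurrent_sequence:
  assumes G: "lead_coeff G = 1" "coeff G 0 \<noteq> 0" "degree G = m" and a: "a \<in> V m"
  shows "\<exists>s\<in>Sol G. \<forall>i<m. s (int i) = a i"
proof (cases "m = 0")
  case True
  then show ?thesis by (intro bexI[of _ 0]) (auto simp: Sol_def lin_0[OF lin_pact[OF lin_sh]])
next
  case False
  define C where "C a = (\<lambda>i. if Suc i < m then a (Suc i) else if Suc i = m then - (\<Sum>k<m. coeff G k * a k) else 0)" for a :: "nat \<Rightarrow> 'a"
  define D where "D a = (\<lambda>i. if i = 0 then - (\<Sum>k<m. coeff G (Suc k) * a k) / coeff G 0 else if i < m then a (i - 1) else 0)" for a :: "nat \<Rightarrow> 'a"
  have CV: "C x \<in> V m" for x by (auto simp: C_def V_def)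
  have DV: "D x \<in> V m" for x using False by (auto simp: D_def V_def)
  have CD: "C (D x) = x" if x: "x \<in> V m" for x
  proof
    fix i
    obtain m' where m': "m = Suc m'" using False by (cases m) auto
    have "(\<Sum>k<m. coeff G k * D x k) = - x m'"
    proof -
      have "(\<Sum>k<m. coeff G k * D x k) = coeff G 0 * D x 0 + (\<Sum>k<m'. coeff G (Suc k) * x k)"
        unfolding m' sum.lessThan_Suc_shift by (simp add: D_def m')
      also have "coeff G 0 * D x 0 = - (\<Sum>k<m. coeff G (Suc k) * x k)" using G(2) by (simp add: D_def)
      also have "(\<Sum>k<m. coeff G (Suc k) * x k) = (\<Sum>k<m'. coeff G (Suc k) * x k) + x m'"
        using G(1,3) by (simp add: m')
      finally show ?thesis by simp
    qed
    then show "C (D x) i = x i" using V_D[OF x, of i] by (auto simp: C_def) (auto simp: D_def m')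
  qed
  define W where "W j = (if j \<ge> 0 then (C ^^ nat j) a else (D ^^ nat (- j)) a)" for j :: int
  have powD: "(D ^^ k) a \<in> V m" for k by (induction k) (auto simp: a DV)
  have CW: "C (W j) = W (j + 1)" for j
  proof (cases "j \<ge> 0")
    case True
    then show ?thesis by (simp add: W_def nat_add_distrib)
  next
    case j: False
    then have k: "nat (- j) = Suc (nat (- (j + 1)))" by simp
    have "C (W j) = (D ^^ nat (- (j + 1))) a" using j unfolding W_def k by (simp add: CD[OF powD])
    also have "\<dots> = W (j + 1)" using j by (cases "j = -1") (auto simp: W_def)
    finally show ?thesis .
  qed
  \<comment> \<open>Overlapping windows agree, so all of them come from one sequence.\<close>
  have Wi: "W j i = W (j + int i) 0" if "i < m" for i j
    using that
  proof (induction i arbitrary: j)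
    case (Suc i)
    have "W j (Suc i) = C (W j) i" using Suc.prems by (simp add: C_def)
    then show ?case using Suc by (simp add: CW algebra_simps)
  qed simp
  define s where "s j = W j 0" for j
  have "pact sh G s = 0"
  proof
    fix j
    have "s (j + int m) = C (W j) (m - 1)"
      using Wi[of "m - 1" "j + 1"] False by (simp add: s_def CW of_nat_diff algebra_simps)
    also have "\<dots> = - (\<Sum>k<m. coeff G k * W j k)"
      using False by (simp add: C_def)
    also have "(\<Sum>k<m. coeff G k * W j k) = (\<Sum>k<m. coeff G k * s (j + int k))"
      unfolding s_def by (intro sum.cong refl arg_cong[where f = "(*) _"] Wi) simp
    finally have "(\<Sum>k<Suc m. coeff G k * s (j + int k)) = 0" using G(1,3) by simp
    then show "pact sh G s j = 0 j" unfolding pact_sh G(3) lessThan_Suc_atMost by simp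
  qed
  moreover have "s (int i) = a i" if "i < m" for i
    using Wi[OF that, of 0] by (simp add: s_def W_def)
  ultimately show ?thesis by (intro bexI[of _ s]) (auto simp: Sol_def)
qed

lemma Sol_add: "s \<in> Sol G \<Longrightarrow> t \<in> Sol G \<Longrightarrow> s + t \<in> Sol G"
  and Sol_smul: "s \<in> Sol G \<Longrightarrow> smul x s \<in> Sol G"
  and Sol_diff: "s \<in> Sol G \<Longrightarrow> t \<in> Sol G \<Longrightarrow> s - t \<in> Sol G"
  by (simp_all add: Sol_def lin_add[OF lin_pact[OF lin_sh]] lin_smul[OF lin_pact[OF lin_sh]] lin_diff[OF lin_pact[OF lin_sh]])

lemma card_Sol:
  assumes G: "lead_coeff G = 1" "coeff G 0 \<noteq> 0" "degree G = m"
  shows "card (Sol G) = (q ^ 2) ^ m" "finite (Sol G)"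
proof -
  let ?w = "\<lambda>s i. if i < m then s (int i) else 0"
  have "inj_on ?w (Sol G)"
  proof (rule inj_onI)
    fix s t assume st: "s \<in> Sol G" "t \<in> Sol G" "?w s = ?w t"
    have w: "s (int i) = t (int i)" if "i < m" for i using fun_cong[OF st(3), of i] that by simp
    have "s - t = 0"
    proof (rule recurrence_zero[OF G(1,2)])
      show "pact sh G (s - t) = 0" using Sol_diff[OF st(1,2)] by (simp add: Sol_def)
      show "(s - t) (0 + int i) = 0" if "i < degree G" for i using w that G(3) by simp
    qed
    then show "s = t" by simp
  qed
  moreover have "?w ` Sol G = V m"
  proof (intro equalityI subsetI)
    fix a :: "nat \<Rightarrow> 'a" assume a: "a \<in> V m"
    obtain s where "s \<in> Sol G" "\<forall>i<m. s (int i) = a i" using ex_recurrent_sequence[OF G a] by blast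
    then show "a \<in> ?w ` Sol G" using V_D[OF a] by (intro image_eqI[of _ _ s]) (auto simp: fun_eq_iff not_less)
  qed (auto simp: V_def)
  ultimately have "bij_betw ?w (Sol G) (V m)" by (simp add: bij_betw_def)
  then show "card (Sol G) = (q ^ 2) ^ m" "finite (Sol G)"
    using bij_betw_same_card[of ?w "Sol G" "V m"] bij_betw_finite[of ?w "Sol G" "V m"] by (auto simp: card_V card_field)
qed

definition conj_seq :: "(int \<Rightarrow> 'a) \<Rightarrow> int \<Rightarrow> 'a" where "conj_seq s = (\<lambda>j. cj (s (- j)))"

lemma conj_seq_Sol:
  assumes G: "G \<in> scr m" and s: "s \<in> Sol G" shows "conj_seq s \<in> Sol G"
proof -
  have d: "degree G = m" using G by (simp add: scr_def)
  have "pact sh G (conj_seq s) = 0"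
  proof
    fix j
    have "pact sh G (conj_seq s) j = (\<Sum>i\<le>m. coeff G i * cj (s (- j - int i)))"
      unfolding pact_sh d conj_seq_def by simp
    also have "\<dots> = (\<Sum>k\<le>m. cj (cj (coeff G 0) * coeff G k * s (- j - int m + int k)))"
    proof (rule sum.reindex_bij_witness[of _ "\<lambda>k. m - k" "\<lambda>k. m - k"])
      fix i assume "i \<in> {..m}"
      then have i: "i \<le> m" by simp
      have "cj (coeff G (m - (m - i))) = cj (coeff G 0) * coeff G (m - i)" by (rule scr_coeff[OF G]) simp
      then have "cj (cj (coeff G 0) * coeff G (m - i)) = coeff G i" using i by (metis cj_cj diff_diff_cancel)
      then show "cj (cj (coeff G 0) * coeff G (m - i) * s (- j - int m + int (m - i))) = coeff G i * cj (s (- j - int i))"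
        using i by (simp add: of_nat_diff)
    qed auto
    also have "\<dots> = cj (cj (coeff G 0) * pact sh G s (- j - int m))"
      unfolding pact_sh d by (simp add: sum_distrib_left mult.assoc)
    finally show "pact sh G (conj_seq s) j = 0 j" using s by (simp add: Sol_def)
  qed
  then show ?thesis by (simp add: Sol_def)
qed

lemma herm_seq_iff: "herm_seq s \<longleftrightarrow> conj_seq s = s"
  unfolding herm_seq_def conj_seq_def fun_eq_iff by (metis cj_cj minus_minus)

text \<open>The Hermitian solutions are the fixed points of the involution \<open>conj_seq\<close>
  of \<open>Sol G\<close>. Every solution is uniquely \<open>a + \<theta> b\<close> with
  \<open>a\<close>, \<open>b\<close> Hermitian, so their number is the square root of
  \<open>card (Sol G)\<close>.\<close>

lemma card_HSol:
  assumes G: "G \<in> scr m" shows "card (HSol G) = q ^ m" "finite (HSol G)"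
proof -
  note S = card_Sol[OF _ scr_coeff_0[OF G]]
  have mG: "lead_coeff G = 1" "degree G = m" using G by (auto simp: scr_def)
  show fin: "finite (HSol G)" using S(2)[OF mG] by (simp add: HSol_def)
  obtain \<theta> where "\<theta> \<notin> Fq" using ex_not_in_Fq by blast
  then have \<theta>: "\<theta> - cj \<theta> \<noteq> 0" by (simp add: Fq_def)
  have "bij_betw (\<lambda>(a, b). a + smul \<theta> b) (HSol G \<times> HSol G) (Sol G)"
  proof (rule bij_betw_imageI)
    show "inj_on (\<lambda>(a, b). a + smul \<theta> b) (HSol G \<times> HSol G)"
    proof (rule inj_onI, clarify)
      fix a b a' b' assume h: "a \<in> HSol G" "b \<in> HSol G" "a' \<in> HSol G" "b' \<in> HSol G"
        and e: "a + smul \<theta> b = a' + smul \<theta> b'"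
      have e1: "a j + \<theta> * b j = a' j + \<theta> * b' j" for j using fun_cong[OF e, of j] by simp
      have hh: "x (- j) = cj (x j)" if "x \<in> HSol G" for x j using that by (simp add: HSol_def herm_seq_def)
      have e2: "a j + cj \<theta> * b j = a' j + cj \<theta> * b' j" for j
        using arg_cong[OF e1[of "- j"], of cj] hh[OF h(1), of "- j"] hh[OF h(2), of "- j"] hh[OF h(3), of "- j"] hh[OF h(4), of "- j"]
        by simp
      have "(\<theta> - cj \<theta>) * b j = (\<theta> - cj \<theta>) * b' j" for j
      proof -
        have "(a j + \<theta> * b j) - (a j + cj \<theta> * b j) = (a' j + \<theta> * b' j) - (a' j + cj \<theta> * b' j)" using e1 e2 by simp
        then show ?thesis by (simp add: algebra_simps)
      qed
      then have b: "b = b'" using \<theta> by (auto simp: fun_eq_iff)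
      then show "a = a' \<and> b = b'" using e1 by (auto simp: fun_eq_iff)
    qed
    show "(\<lambda>(a, b). a + smul \<theta> b) ` (HSol G \<times> HSol G) = Sol G"
    proof (intro equalityI subsetI)
      fix x assume x: "x \<in> Sol G"
      \<comment> \<open>From the two equations \<open>x = a + \<theta> b\<close> and
        \<open>conj_seq x = a + cj \<theta> b\<close>.\<close>
      define b where "b = smul (inverse (\<theta> - cj \<theta>)) (x - conj_seq x)"
      define a where "a = x - smul \<theta> b"
      have bS: "b \<in> Sol G" unfolding b_def using x conj_seq_Sol[OF G x] by (intro Sol_smul Sol_diff)
      have aS: "a \<in> Sol G" unfolding a_def using x bS by (intro Sol_smul Sol_diff)
      have cb: "conj_seq b = b"
      proof
        fix j
        have "cj \<theta> - \<theta> = - (\<theta> - cj \<theta>)" by simp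
        then have "inverse (cj \<theta> - \<theta>) = - inverse (\<theta> - cj \<theta>)" by (metis inverse_minus_eq)
        then show "conj_seq b j = b j" by (simp add: conj_seq_def b_def algebra_simps)
      qed
      have ca: "conj_seq a = a"
      proof
        fix j
        have cbj: "cj (b (- j)) = b j" using fun_cong[OF cb, of j] by (simp add: conj_seq_def)
        have "(\<theta> - cj \<theta>) * b j = x j - cj (x (- j))" using \<theta> by (simp add: b_def conj_seq_def)
        then have "cj (x (- j)) = x j - (\<theta> - cj \<theta>) * b j" by (simp add: algebra_simps)
        then show "conj_seq a j = a j" by (simp add: conj_seq_def a_def cbj algebra_simps)
      qed
      have "x = a + smul \<theta> b" by (simp add: a_def)
      then show "x \<in> (\<lambda>(a, b). a + smul \<theta> b) ` (HSol G \<times> HSol G)"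
        using aS bS ca cb by (intro image_eqI[of _ _ "(a, b)"]) (auto simp: HSol_def herm_seq_iff)
    qed (auto simp: HSol_def intro: Sol_add Sol_smul)
  qed
  then have "card (HSol G \<times> HSol G) = (q ^ 2) ^ m" using bij_betw_same_card S(1)[OF mG] by metis
  then have "(card (HSol G)) ^ 2 = (q ^ m) ^ 2"
    by (simp add: card_cartesian_product power2_eq_square power_mult_distrib)
  then show "card (HSol G) = q ^ m" by (simp add: power2_eq_iff_nonneg)
qed

text \<open>\<open>\<phi> (s 0)\<close> is an additive character of \<open>HSol G\<close>. For
  \<open>m > 0\<close> it is nontrivial: a solution with value \<open>t\<close> at 0, where
  \<open>t + cj t = y\<close>, symmetrises to a Hermitian one with value \<open>y\<close>.\<close>

lemma sum_HSol_char:
  fixes \<phi> :: "'a \<Rightarrow> complex"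
  assumes add: "\<And>x y. \<phi> (x + y) = \<phi> x * \<phi> y" and 0: "\<phi> 0 = 1" and y: "y \<in> Fq" "\<phi> y \<noteq> 1" and G: "G \<in> scr m"
  shows "(\<Sum>s\<in>HSol G. \<phi> (s 0)) = (if m = 0 then 1 else 0)"
proof (cases "m = 0")
  case True
  then have "G = 1" using G by (auto simp: scr_def elim!: degree_eq_zeroE)
  then have "HSol G = {0}" by (auto simp: HSol_def Sol_def herm_seq_def)
  then show ?thesis using 0 True by simp
next
  case False
  have mG: "lead_coeff G = 1" "degree G = m" using G by (auto simp: scr_def)
  obtain t where t: "t + cj t = y" using trace_surj[OF y(1)] by blast
  have "smul t (ax 0) \<in> V m" using False by (intro V_smul ax_in_V) simp
  then obtain S where S: "S \<in> Sol G" "\<forall>i<m. S (int i) = smul t (ax 0) i"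
    using ex_recurrent_sequence[OF mG(1) scr_coeff_0[OF G] mG(2)] by blast
  have S0: "S 0 = t" using S(2)[rule_format, of 0] False by (simp add: ax_apply)
  define s where "s = S + conj_seq S"
  have sH: "s \<in> HSol G"
    using Sol_add[OF S(1) conj_seq_Sol[OF G S(1)]] by (simp add: HSol_def s_def herm_seq_def conj_seq_def add.commute)
  have HS: "x + y \<in> HSol G" if "x \<in> HSol G" "y \<in> HSol G" for x y
    using that Sol_add[of x G y] by (simp add: HSol_def herm_seq_def)
  have "smul (-1) s \<in> HSol G" using sH Sol_smul[of s G "-1"] by (simp add: HSol_def herm_seq_def)
  then have ms: "- s \<in> HSol G" by (simp add: smul_minus_left)
  have "\<phi> (s 0) \<noteq> 1" using t y(2) by (simp add: s_def conj_seq_def S0)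
  then have "(\<Sum>s\<in>HSol G. \<phi> (s 0)) = 0"
    by (intro sum_additive_char_eq_0[OF card_HSol(2)[OF G] HS _ sH ms]) (auto simp: add)
  then show ?thesis using False by simp
qed

end

section \<open>The recursion for the character averages\<close>

context trace_character
begin

lemma \<psi>_0: "\<psi> 0 = 1"
proof -
  have "\<psi> 0 * \<psi> 0 = \<psi> 0" using \<psi>_add[of 0 0] by simp
  moreover have "\<psi> 0 \<noteq> 0" using \<psi>_norm[of 0] by auto
  ultimately show ?thesis by simp
qed

lemma pc_mult: "F \<noteq> 0 \<Longrightarrow> G \<noteq> 0 \<Longrightarrow> pc (F * G) = pc F * pc G"
proof -
  assume "F \<noteq> 0" "G \<noteq> 0"
  then have "psum (F * G) = (\<lambda>l. psum F l + psum G l)" by (intro ext psum_mult)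
  then show ?thesis by (simp add: pc_def \<psi>_add tsum_add)
qed

lemma norm_pc: "norm (pc F) = 1"
  by (simp add: pc_def \<psi>_norm)

definition \<beta> :: "nat \<Rightarrow> complex" where "\<beta> m = (\<Sum>B\<in>PB m. pc B * rc B)"
definition \<nu> :: "('a \<Rightarrow> complex) \<Rightarrow> nat \<Rightarrow> complex" where "\<nu> w d = (\<Sum>s\<in>HS d. pc (minp sh s) * w (s 0))"
definition Lc :: "nat \<Rightarrow> complex" where "Lc m = (\<Sum>G\<in>scr m. pc G)"

text \<open>Grouped by \<open>(B, s)\<close>, each fibre is nonempty by \<open>ex_type\<close>, is a
  single type for \<open>type_sum\<close>, and has constant weight \<open>w (s 0)\<close> because
  \<open>s 0\<close> is the value of the form at \<open>v\<close>.\<close>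

lemma total:
  "(\<Sum>f\<in>U n. \<Sum>v\<in>V n. tc n f * w (ip n v v))
    = of_nat (card (U n)) * fps_nth (Abs_fps \<beta> * Abs_fps (\<nu> w) * Abs_fps E) n"
proof -
  \<comment> \<open>The labels that occur: \<open>ex_cyclic_frame\<close> shows the dimension bound
    to be necessary, \<open>ex_type\<close> shows it to be sufficient.\<close>
  define T where "T = {(B :: 'a poly, s :: int \<Rightarrow> 'a). lead_coeff B = 1 \<and> coeff B 0 \<noteq> 0 \<and> herm_seq s \<and> (\<exists>D. is_minpoly sh s D)
    \<and> 2 * degree B + degree (minp sh s) \<le> n}"
  define \<kappa> where "\<kappa> x = (minp (fst x) (snd x) div minp sh (sq n (fst x) (snd x)), sq n (fst x) (snd x))"
    for x :: "((nat \<Rightarrow> 'a) \<Rightarrow> nat \<Rightarrow> 'a) \<times> (nat \<Rightarrow> 'a)"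
  let ?S = "U n \<times> (V n :: (nat \<Rightarrow> 'a) set)"
  have finS: "finite ?S" by (simp add: finite_U)
  have finT: "finite T"
  proof (rule finite_subset)
    show "T \<subseteq> (\<Union>m\<in>{..n}. PB m) \<times> (\<Union>d\<in>{..n}. HS d)" by (auto simp: T_def PB_def HS_def)
    show "finite ((\<Union>m\<in>{..n}. PB m) \<times> (\<Union>d\<in>{..n}. HS d))" by (intro finite_cartesian_product finite_UN_I) (auto simp: finite_PB finite_HS)
  qed
  have ST: "\<kappa> ` ?S \<subseteq> T"
  proof
    fix y assume "y \<in> \<kappa> ` ?S"
    then obtain f v where y: "y = \<kappa> (f, v)" and f: "f \<in> U n" and v: "v \<in> V n" by auto
    obtain F where F: "is_minpoly f v F" using ex_minpoly_V[OF f v] by blast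
    have F0: "F \<noteq> 0" using is_minpoly_monic[OF F] by auto
    have aF: "pact sh F (sq n f v) = 0" by (rule pact_sh_sq[OF f is_minpoly_ann[OF F]])
    obtain D where D: "is_minpoly sh (sq n f v) D" using ex_minpoly[OF lin_sh F0 aF] by blast
    have "D dvd F" using is_minpoly_iff[OF D] aF by blast
    then have "degree D \<le> degree F" using F0 by (rule dvd_imp_degree_le)
    then obtain r where r: "degree F = r + degree D" by (metis le_add_diff_inverse2)
    obtain P where "cyclic_frame p rr q n r (degree D) f v F D P" using ex_cyclic_frame(2)[OF f v F D refl r] by blast
    then interpret C: cyclic_frame p rr q ty n r "degree D" f v F D P .
    have "lead_coeff (C.B * D) = 1" using is_minpoly_monic[OF F] by (simp only: C.F_eq[symmetric])
    then have "lead_coeff C.B = 1" using is_minpoly_monic[OF D] by (simp only: lead_coeff_mult mult_1_right)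
    moreover have "y = (C.B, sq n f v)" unfolding y \<kappa>_def by (simp add: minp_eq[OF F] minp_eq[OF D] C.B_def)
    ultimately show "y \<in> T"
      unfolding T_def using C.B_0 herm_seq_sq D C.le_n by (auto simp: C.deg_B minp_eq[OF D])
  qed
  have fibre: "(\<Sum>x\<in>{x \<in> ?S. \<kappa> x = (B, s)}. tc n (fst x) * w (ip n (snd x) (snd x)))
      = of_nat (card (U n)) * (pc B * rc B * (pc (minp sh s) * w (s 0)) * E (n - (2 * degree B + degree (minp sh s))))"
    if Bs: "(B, s) \<in> T" for B s
  proof -
    let ?D = "minp sh s"
    let ?F = "B * ?D"
    have B: "lead_coeff B = 1" "coeff B 0 \<noteq> 0" and s: "herm_seq s" and le: "2 * degree B + degree ?D \<le> n"
      using Bs unfolding T_def by auto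
    have D: "is_minpoly sh s ?D" by (rule is_minpoly_minp) (use Bs in \<open>auto simp: T_def\<close>)
    have D1: "lead_coeff ?D = 1" by (rule is_minpoly_monic[OF D])
    have nz: "B \<noteq> 0" "?D \<noteq> 0" using B(1) D1 by auto
    have F1: "lead_coeff ?F = 1" using B D1 by (simp only: lead_coeff_mult mult_1_right)
    have F0: "coeff ?F 0 \<noteq> 0" using B(2) minpoly_sh_coeff_0[OF D] by (simp add: coeff_mult_0)
    have degF: "degree ?F = degree B + degree ?D" by (rule degree_mult_eq[OF nz])
    obtain f0 v0 where fv: "f0 \<in> U n" "v0 \<in> V n" "is_minpoly f0 v0 ?F" "sq n f0 v0 = s"
      using ex_type[OF F1 F0 s D dvd_triv_right refl degF le] by blast
    let ?X = "{(f, v). f \<in> U n \<and> v \<in> V n \<and> is_minpoly f v ?F \<and> sq n f v = sq n f0 v0}"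
    have X: "{x \<in> ?S. \<kappa> x = (B, s)} = ?X"
    proof (intro equalityI subsetI)
      fix x assume x: "x \<in> {x \<in> ?S. \<kappa> x = (B, s)}"
      obtain f v where fvx: "x = (f, v)" by (cases x)
      have f: "f \<in> U n" "v \<in> V n" and k: "minp f v div minp sh (sq n f v) = B" "sq n f v = s"
        using x by (auto simp: fvx \<kappa>_def)
      obtain G where G: "is_minpoly f v G" using ex_minpoly_V[OF f] by blast
      have "?D dvd G" using is_minpoly_iff[OF D] pact_sh_sq[OF f(1) is_minpoly_ann[OF G]] k(2) by blast
      then have "G = ?F" using k minp_eq[OF G] by auto
      then show "x \<in> ?X" using f k(2) G fv(4) by (simp add: fvx)
    next
      fix x assume x: "x \<in> ?X"
      obtain f v where fvx: "x = (f, v)" by (cases x)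
      show "x \<in> {x \<in> ?S. \<kappa> x = (B, s)}"
        using x fv(4) minp_eq[of f v ?F] nz by (auto simp: fvx \<kappa>_def)
    qed
    have "(\<Sum>x\<in>?X. tc n (fst x) * w (ip n (snd x) (snd x))) = (\<Sum>(f, v)\<in>?X. tc n f) * w (s 0)"
      unfolding sum_distrib_right
    proof (intro sum.cong refl)
      fix x assume "x \<in> ?X"
      then have "sq n (fst x) (snd x) 0 = s 0" using fv(4) by auto
      then show "tc n (fst x) * w (ip n (snd x) (snd x)) = (case x of (f, v) \<Rightarrow> tc n f) * w (s 0)"
        by (simp add: sq_def case_prod_unfold)
    qed
    also have "(\<Sum>(f, v)\<in>?X. tc n f) = of_nat (card (U n)) * (pc ?F * rc (?F div ?D) * E (n - (2 * degree B + degree ?D)))"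
      by (rule type_sum[OF fv(1-3) _ refl degF]) (use D fv(4) in simp)
    finally show ?thesis unfolding X pc_mult[OF nz] using nz by (simp add: mult_ac)
  qed
  have "(\<Sum>f\<in>U n. \<Sum>v\<in>V n. tc n f * w (ip n v v)) = (\<Sum>x\<in>?S. tc n (fst x) * w (ip n (snd x) (snd x)))"
    by (simp add: sum.cartesian_product case_prod_unfold)
  also have "\<dots> = (\<Sum>y\<in>T. \<Sum>x\<in>{x \<in> ?S. \<kappa> x = y}. tc n (fst x) * w (ip n (snd x) (snd x)))"
    by (rule sum.group[OF finS finT ST, symmetric])
  also have "\<dots> = (\<Sum>y\<in>T. of_nat (card (U n)) * (pc (fst y) * rc (fst y) * (pc (minp sh (snd y)) * w (snd y 0))
      * E (n - (2 * degree (fst y) + degree (minp sh (snd y))))))"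
  proof (rule sum.cong[OF refl])
    fix y assume "y \<in> T"
    then show "(\<Sum>x\<in>{x \<in> ?S. \<kappa> x = y}. tc n (fst x) * w (ip n (snd x) (snd x)))
        = of_nat (card (U n)) * (pc (fst y) * rc (fst y) * (pc (minp sh (snd y)) * w (snd y 0))
          * E (n - (2 * degree (fst y) + degree (minp sh (snd y)))))"
      using fibre[of "fst y" "snd y"] by simp
  qed
  also have "\<dots> = of_nat (card (U n)) * (\<Sum>y\<in>T. pc (fst y) * rc (fst y) * (pc (minp sh (snd y)) * w (snd y 0))
      * E (n - (2 * degree (fst y) + degree (minp sh (snd y)))))" (is "_ = _ * sum ?X T")
    by (rule sum_distrib_left[symmetric])
  also have "sum ?X T = (\<Sum>m\<in>{0..n}. \<Sum>y\<in>{y \<in> T. 2 * degree (fst y) + degree (minp sh (snd y)) = m}. ?X y)"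
    by (rule sum.group[symmetric]) (use finT in \<open>auto simp: T_def\<close>)
  also have "\<dots> = (\<Sum>m\<in>{0..n}. (\<Sum>i\<in>{0..m}. \<beta> i * \<nu> w (m - i)) * E (n - m))"
  proof (rule sum.cong[OF refl])
    fix m assume m: "m \<in> {0..n}"
    let ?Tm = "{y \<in> T. 2 * degree (fst y) + degree (minp sh (snd y)) = m}"
    have "(\<Sum>y\<in>?Tm. ?X y) = (\<Sum>i\<in>{0..m}. \<Sum>y\<in>{y \<in> ?Tm. 2 * degree (fst y) = i}. ?X y)"
      by (rule sum.group[symmetric]) (use finT in auto)
    also have "\<dots> = (\<Sum>i\<in>{0..m}. \<beta> i * \<nu> w (m - i) * E (n - m))"
    proof (rule sum.cong[OF refl])
      fix i assume i: "i \<in> {0..m}"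
      have "{y \<in> ?Tm. 2 * degree (fst y) = i} = PB i \<times> HS (m - i)"
        using m i by (auto simp: T_def PB_def HS_def)
      then have "(\<Sum>y\<in>{y \<in> ?Tm. 2 * degree (fst y) = i}. ?X y)
          = (\<Sum>B\<in>PB i. \<Sum>s\<in>HS (m - i). ?X (B, s))" by (simp add: sum.cartesian_product case_prod_unfold)
      also have "\<dots> = (\<Sum>B\<in>PB i. \<Sum>s\<in>HS (m - i). pc B * rc B * (pc (minp sh s) * w (s 0)) * E (n - m))"
        using i by (intro sum.cong refl) (simp add: PB_def HS_def)
      also have "\<dots> = \<beta> i * \<nu> w (m - i) * E (n - m)"
        unfolding \<beta>_def \<nu>_def sum_product by (simp only: sum_distrib_right)
      finally show "(\<Sum>y\<in>{y \<in> ?Tm. 2 * degree (fst y) = i}. ?X y) = \<beta> i * \<nu> w (m - i) * E (n - m)" .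
    qed
    finally show "(\<Sum>y\<in>?Tm. ?X y) = (\<Sum>i\<in>{0..m}. \<beta> i * \<nu> w (m - i)) * E (n - m)"
      by (simp only: sum_distrib_right)
  qed
  also have "\<dots> = fps_nth (Abs_fps \<beta> * Abs_fps (\<nu> w) * Abs_fps E) n"
    by (simp add: fps_mult_nth)
  finally show ?thesis .
qed

text \<open>A pair \<open>(G, s)\<close> with \<open>s\<close> in \<open>HSol G\<close> amounts to
  \<open>s\<close> together with the cofactor of its minimal polynomial in \<open>G\<close>, which
  again lies in some \<open>scr\<close>.\<close>

lemma nu_L: "fps_nth (Abs_fps (\<nu> w) * Abs_fps Lc) m = (\<Sum>G\<in>scr m. pc G * (\<Sum>s\<in>HSol G. w (s 0)))"
proof -
  let ?Y = "SIGMA G:scr m. HSol G"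
  let ?X = "\<lambda>y. pc (fst y) * w (snd y (0::int))"
  have mp: "\<exists>D. is_minpoly sh s D" "minp sh s dvd G" if "G \<in> scr m" "s \<in> HSol G" for G s
  proof -
    have G0: "G \<noteq> 0" using that(1) by (auto simp: scr_def)
    have a: "pact sh G s = 0" using that(2) by (simp add: HSol_def Sol_def)
    show e: "\<exists>D. is_minpoly sh s D" by (rule ex_minpoly[OF lin_sh G0 a])
    show "minp sh s dvd G" using is_minpoly_iff[OF is_minpoly_minp[OF e]] a by blast
  qed
  have finY: "finite ?Y" by (intro finite_SigmaI finite_scr card_HSol(2))
  have "(\<Sum>G\<in>scr m. pc G * (\<Sum>s\<in>HSol G. w (s 0))) = (\<Sum>y\<in>?Y. ?X y)"
    by (simp add: sum_distrib_left sum.Sigma finite_scr card_HSol(2) case_prod_unfold)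
  also have "\<dots> = (\<Sum>d\<in>{0..m}. \<Sum>y\<in>{y \<in> ?Y. degree (minp sh (snd y)) = d}. ?X y)"
  proof (rule sum.group[symmetric, OF finY])
    show "(\<lambda>y. degree (minp sh (snd y))) ` ?Y \<subseteq> {0..m}"
    proof clarify
      fix G s assume Gs: "G \<in> scr m" "s \<in> HSol G"
      have "degree (minp sh s) \<le> degree G" by (rule dvd_imp_degree_le[OF mp(2)[OF Gs]]) (use Gs in \<open>auto simp: scr_def\<close>)
      then show "degree (minp sh (snd (G, s))) \<in> {0..m}" using Gs by (simp add: scr_def)
    qed
  qed simp
  also have "\<dots> = (\<Sum>d\<in>{0..m}. \<nu> w d * Lc (m - d))"
  proof (rule sum.cong[OF refl])
    fix d assume d: "d \<in> {0..m}"
    have "\<nu> w d * Lc (m - d) = (\<Sum>x\<in>HS d \<times> scr (m - d). pc (minp sh (fst x)) * w (fst x 0) * pc (snd x))"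
      unfolding \<nu>_def Lc_def sum_product by (simp add: sum.cartesian_product case_prod_unfold)
    also have "\<dots> = (\<Sum>y\<in>{y \<in> ?Y. degree (minp sh (snd y)) = d}. ?X y)"
    proof (rule sum.reindex_bij_witness[of _ "\<lambda>y. (snd y, fst y div minp sh (snd y))" "\<lambda>x. (snd x * minp sh (fst x), fst x)"])
      fix x assume x: "x \<in> HS d \<times> scr (m - d)"
      then have s: "herm_seq (fst x)" "degree (minp sh (fst x)) = d" by (auto simp: HS_def)
      have D: "is_minpoly sh (fst x) (minp sh (fst x))"
        by (rule is_minpoly_minp) (use x in \<open>auto simp: HS_def\<close>)
      have nz: "minp sh (fst x) \<noteq> 0" "snd x \<noteq> 0" using is_minpoly_monic[OF D] x by (auto simp: scr_def)
      show "(snd (snd x * minp sh (fst x), fst x), fst (snd x * minp sh (fst x), fst x) div minp sh (snd (snd x * minp sh (fst x), fst x))) = x"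
        using nz by simp
      have "snd x * minp sh (fst x) \<in> scr (m - d + d)"
        by (rule scr_mult) (use x minpoly_scr[OF s(1) D] s(2) in auto)
      moreover have "fst x \<in> HSol (snd x * minp sh (fst x))"
        unfolding HSol_def Sol_def using s(1) is_minpoly_iff[OF D] by auto
      ultimately show "(snd x * minp sh (fst x), fst x) \<in> {y \<in> ?Y. degree (minp sh (snd y)) = d}"
        using d s(2) by auto
      show "?X (snd x * minp sh (fst x), fst x) = pc (minp sh (fst x)) * w (fst x 0) * pc (snd x)"
        using nz by (simp add: pc_mult)
    next
      fix y assume y: "y \<in> {y \<in> ?Y. degree (minp sh (snd y)) = d}"
      then have G: "fst y \<in> scr m" "snd y \<in> HSol (fst y)" and dg: "degree (minp sh (snd y)) = d" by auto
      note m = mp[OF G]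
      have hs: "herm_seq (snd y)" using G by (simp add: HSol_def)
      have e: "minp sh (snd y) * (fst y div minp sh (snd y)) = fst y" using m(2) by simp
      show "(snd (snd y, fst y div minp sh (snd y)) * minp sh (fst (snd y, fst y div minp sh (snd y))), fst (snd y, fst y div minp sh (snd y))) = y"
        using e by (simp add: mult.commute)
      have "fst y div minp sh (snd y) \<in> scr (m - d)"
        by (rule scr_div[of "minp sh (snd y)"])
           (use e G(1) minpoly_scr[OF hs is_minpoly_minp[OF m(1)]] dg in auto)
      then show "(snd y, fst y div minp sh (snd y)) \<in> HS d \<times> scr (m - d)"
        using hs m(1) dg by (simp add: HS_def)
    qed
    finally show "(\<Sum>y\<in>{y \<in> ?Y. degree (minp sh (snd y)) = d}. ?X y) = \<nu> w d * Lc (m - d)" ..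
  qed
  also have "\<dots> = fps_nth (Abs_fps (\<nu> w) * Abs_fps Lc) m" by (simp add: fps_mult_nth)
  finally show ?thesis ..
qed

lemma scr_0: "scr 0 = {1}"
  by (auto simp: scr_def star_def elim!: degree_eq_zeroE)

lemma psum_1: "psum 1 l = (0 :: 'b::field)"
  by (simp add: psum_def)

lemma Lc_0: "Lc 0 = 1"
  by (simp add: Lc_def scr_0 pc_def psum_1[abs_def] tsum_def \<psi>_0)

theorem recursion:
  "of_nat q ^ n * E n = (\<Sum>i\<le>n. Lc i * (- 1) ^ (n - i) * E (n - i))"
proof -
  obtain \<psi>0 x0 where \<psi>0: "\<And>x y. \<psi>0 (x + y) = \<psi>0 x * \<psi>0 (y::'a)" "\<And>x. norm (\<psi>0 x :: complex) = 1" "\<psi>0 x0 \<noteq> 1"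
    using ex_additive_char by blast
  \<comment> \<open>Twisting by \<open>x0\<close> makes the character nontrivial at 1, hence on
    \<open>Fq\<close>.\<close>
  define \<phi> where "\<phi> y = \<psi>0 (x0 * y)" for y
  have add: "\<phi> (x + y) = \<phi> x * \<phi> y" for x y by (simp add: \<phi>_def distrib_left \<psi>0)
  have "\<psi>0 0 * \<psi>0 0 = \<psi>0 0" "\<psi>0 0 \<noteq> 0" using \<psi>0(1)[of 0 0] \<psi>0(2)[of 0] by auto
  then have \<phi>0: "\<phi> 0 = 1" by (simp add: \<phi>_def)
  have \<phi>1: "\<phi> 1 \<noteq> 1" by (simp add: \<phi>_def \<psi>0)
  let ?A = "Abs_fps E" and ?L = "Abs_fps Lc" and ?b = "Abs_fps \<beta>"
  let ?N1 = "Abs_fps (\<nu> (\<lambda>_. 1))" and ?N2 = "Abs_fps (\<nu> \<phi>)"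
  define A1 where "A1 = Abs_fps (\<lambda>n. (of_nat q ^ 2) ^ n * E n)"
  define A2 where "A2 = Abs_fps (\<lambda>n. (- of_nat q) ^ n * E n)"
  define L1 where "L1 = Abs_fps (\<lambda>n. of_nat q ^ n * Lc n)"
  have sw: "(\<Sum>f\<in>U n. \<Sum>v\<in>V n. tc n f * w (ip n v v)) = of_nat (card (U n)) * (E n * (\<Sum>v\<in>V n. w (ip n v v)))" for w n
  proof -
    have "(\<Sum>f\<in>U n. \<Sum>v\<in>V n. tc n f * w (ip n v v)) = (\<Sum>f\<in>U n. tc n f) * (\<Sum>v\<in>V n. w (ip n v v))"
      by (simp add: sum_product)
    then show ?thesis unfolding sum_tc_U by simp
  qed
  have tot: "E n * (\<Sum>v\<in>V n. w (ip n v v)) = fps_nth (?b * Abs_fps (\<nu> w) * ?A) n" for w n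
    using total[of n w] card_U_pos[of n] unfolding sw by simp
  have A1: "A1 = ?b * ?N1 * ?A"
    by (rule fps_ext) (simp add: tot[of _ "\<lambda>_. 1", symmetric] A1_def card_V card_field)
  have A2: "A2 = ?b * ?N2 * ?A"
    by (rule fps_ext) (simp add: tot[of _ \<phi>, symmetric] A2_def gauss_sum[OF add \<phi>0 Fq_1 \<phi>1])
  have N1: "?N1 * ?L = L1"
    by (rule fps_ext) (simp only: nu_L, simp add: L1_def card_HSol(1) Lc_def sum_distrib_left mult.commute)
  have N2: "?N2 * ?L = 1"
  proof (rule fps_ext)
    fix m
    have "(\<Sum>G\<in>scr m. pc G * (\<Sum>s\<in>HSol G. \<phi> (s 0))) = (\<Sum>G\<in>scr m. pc G * (if m = 0 then 1 else 0))"
      by (intro sum.cong refl arg_cong2[where f = "(*)"] sum_HSol_char[OF add \<phi>0 Fq_1 \<phi>1])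
    then show "fps_nth (?N2 * ?L) m = fps_nth 1 m"
      unfolding nu_L using Lc_0 by (simp add: Lc_def)
  qed
  \<comment> \<open>Multiplication by \<open>L\<close> turns \<open>\<nu>_1\<close> into
    \<open>L1\<close> and \<open>\<nu>_\<phi>\<close> into 1, so that the remaining
    \<open>\<beta> A\<close> is \<open>L\<close> times \<open>A2\<close>.\<close>
  have "?L * A1 = ?b * (?N1 * ?L) * ?A" unfolding A1 by (simp only: mult_ac)
  also have "\<dots> = L1 * (?b * (?N2 * ?L) * ?A)" unfolding N1 N2 by (simp only: mult_ac mult_1_right mult_1)
  also have "\<dots> = ?L * (L1 * A2)" unfolding A2 by (simp only: mult_ac)
  finally have "?L * A1 = ?L * (L1 * A2)" .
  moreover have "?L \<noteq> 0" using Lc_0 by (auto simp: fps_eq_iff intro!: exI[of _ 0])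
  ultimately have "A1 = L1 * A2" by simp
  then have "fps_nth A1 n = fps_nth (L1 * A2) n" by simp
  then have "of_nat q ^ n * (of_nat q ^ n * E n) = (\<Sum>i\<le>n. of_nat q ^ i * Lc i * ((- of_nat q) ^ (n - i) * E (n - i)))"
    by (simp add: A1_def A2_def L1_def fps_mult_nth atLeast0AtMost power2_eq_square power_mult_distrib mult.assoc)
  \<comment> \<open>Removing the common factor \<open>q ^ n\<close> replaces \<open>u\<close> by
    \<open>u / q\<close> in \<open>A(q^2 u) = L(qu) A(-qu)\<close>.\<close>
  also have "\<dots> = of_nat q ^ n * (\<Sum>i\<le>n. Lc i * (- 1) ^ (n - i) * E (n - i))"
    unfolding sum_distrib_left
  proof (intro sum.cong refl)
    fix i assume "i \<in> {..n}"
    then have "(of_nat q :: complex) ^ n = of_nat q ^ i * of_nat q ^ (n - i)" by (simp flip: power_add)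
    moreover have "(- of_nat q :: complex) ^ (n - i) = (- 1) ^ (n - i) * of_nat q ^ (n - i)"
      by (subst power_mult_distrib[symmetric]) simp
    ultimately show "of_nat q ^ i * Lc i * ((- of_nat q) ^ (n - i) * E (n - i))
        = of_nat q ^ n * (Lc i * (- 1) ^ (n - i) * E (n - i))" by (simp add: mult_ac)
  qed
  finally show ?thesis using q_ge_2 by simp
qed

end

section \<open>Cancellation in the L-function\<close>

lemma psum_0: "F \<noteq> 0 \<Longrightarrow> psum F 0 = (0::'k::field)"
  using psum_newton[of F 0] by (simp add: coeff_reflect_poly)

lemma psum_step:
  fixes F :: "'k::field poly"
  assumes F: "lead_coeff F = 1" and i: "i \<ge> 1"
  defines "a \<equiv> \<lambda>l. fps_nth (fps_of_poly (reflect_poly F)) l"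
  shows "psum F i = - of_nat i * a i - (\<Sum>l\<in>{1..<i}. a l * psum F (i - l))"
proof -
  have F0: "F \<noteq> 0" using F by auto
  have a0: "a 0 = 1" unfolding a_def nth_rev using F by simp
  have "{..i} = insert 0 (insert i {1..<i})" using i by auto
  then have "(\<Sum>l\<le>i. a l * psum F (i - l)) = psum F i + (\<Sum>l\<in>{1..<i}. a l * psum F (i - l))"
    using i by (simp add: a0 psum_0[OF F0])
  then show ?thesis using psum_newton[OF F0, of i] unfolding a_def by (simp add: algebra_simps)
qed

lemma psum_cong_top:
  fixes F G :: "'k::field poly"
  assumes F: "lead_coeff F = 1" "degree F = m" and G: "lead_coeff G = 1" "degree G = m"
    and top: "\<And>l. l \<le> i \<Longrightarrow> l \<le> m \<Longrightarrow> coeff F (m - l) = coeff G (m - l)"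
  shows "psum F i = psum G i"
  using top
proof (induction i rule: less_induct)
  case (less i)
  show ?case
  proof (cases "i = 0")
    case True
    have "F \<noteq> 0" "G \<noteq> 0" using F G by auto
    then show ?thesis using True by (simp add: psum_0)
  next
    case False
    have a: "fps_nth (fps_of_poly (reflect_poly F)) l = fps_nth (fps_of_poly (reflect_poly G)) l" if "l \<le> i" for l
      unfolding nth_rev F G using less.prems that by simp
    have "(\<Sum>l\<in>{1..<i}. fps_nth (fps_of_poly (reflect_poly F)) l * psum F (i - l))
        = (\<Sum>l\<in>{1..<i}. fps_nth (fps_of_poly (reflect_poly G)) l * psum G (i - l))"
    proof (intro sum.cong refl arg_cong2[where f = "(*)"])
      fix l assume l: "l \<in> {1..<i}"
      then show "fps_nth (fps_of_poly (reflect_poly F)) l = fps_nth (fps_of_poly (reflect_poly G)) l" by (intro a) simp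
      show "psum F (i - l) = psum G (i - l)" by (rule less.IH) (use l less.prems in auto)
    qed
    then show ?thesis using psum_step[OF F(1), of i] psum_step[OF G(1), of i] False a[of i] by simp
  qed
qed

text \<open>In the Newton identity for \<open>j\<close> the new coefficient occurs once, with factor
  \<open>- j\<close>; everything else involves higher coefficients.\<close>

lemma psum_diff_top:
  fixes F G :: "'k::field poly"
  assumes F: "lead_coeff F = 1" "degree F = m" and G: "lead_coeff G = 1" "degree G = m"
    and top: "\<And>l. l < j \<Longrightarrow> coeff F (m - l) = coeff G (m - l)" and j: "1 \<le> j" "j \<le> m"
  shows "psum F j = psum G j - of_nat j * (coeff F (m - j) - coeff G (m - j))"
proof -
  have "(\<Sum>l\<in>{1..<j}. fps_nth (fps_of_poly (reflect_poly F)) l * psum F (j - l))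
      = (\<Sum>l\<in>{1..<j}. fps_nth (fps_of_poly (reflect_poly G)) l * psum G (j - l))"
  proof (intro sum.cong refl arg_cong2[where f = "(*)"])
    fix l assume l: "l \<in> {1..<j}"
    show "fps_nth (fps_of_poly (reflect_poly F)) l = fps_nth (fps_of_poly (reflect_poly G)) l"
      unfolding nth_rev F G using l j top by simp
    show "psum F (j - l) = psum G (j - l)" by (rule psum_cong_top[OF F G]) (use l top in auto)
  qed
  then have "psum F j - psum G j = - of_nat j * coeff F (m - j) + of_nat j * coeff G (m - j)"
    using psum_step[OF F(1) j(1)] psum_step[OF G(1) j(1)] j(2) unfolding nth_rev F G by simp
  then show ?thesis by (simp add: algebra_simps)
qed

context hermitian_field
begin

section \<open>Coordinates on \<open>scr m\<close> and its size\<close>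

lemma scrI:
  assumes "lead_coeff G = 1" "degree G = m" "\<And>i. i \<le> m \<Longrightarrow> cj (coeff G (m - i)) = cj (coeff G 0) * coeff G i"
  shows "G \<in> scr m"
proof -
  have "star G = smult (cj (coeff G 0)) G"
    by (rule poly_eqI) (use assms in \<open>auto simp: coeff_star coeff_eq_0\<close>)
  then show ?thesis using assms by (simp add: scr_def)
qed

text \<open>The second monomial is forced by the symmetry when the coefficient at
  \<open>m - j\<close> changes by \<open>x\<close>. For \<open>1 \<le> j\<close> and
  \<open>2 * j < m\<close> the degrees are distinct and the constant term stays, so
  \<open>- x\<close> undoes the change.\<close>

definition shift_scr :: "nat \<Rightarrow> nat \<Rightarrow> 'a \<Rightarrow> 'a poly \<Rightarrow> 'a poly" where
  "shift_scr m j x G = G + monom x (m - j) + monom (coeff G 0 * cj x) j"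

lemma shift_scr:
  assumes G: "G \<in> scr m" and j: "1 \<le> j" "2 * j < m"
  shows "shift_scr m j x G \<in> scr m" and "shift_scr m j (- x) (shift_scr m j x G) = G"
    and "l < j \<Longrightarrow> coeff (shift_scr m j x G) (m - l) = coeff G (m - l)"
    and "coeff (shift_scr m j x G) (m - j) = coeff G (m - j) + x"
proof -
  let ?H = "shift_scr m j x G"
  have G': "lead_coeff G = 1" "degree G = m" using G by (auto simp: scr_def)
  have c: "coeff ?H i = coeff G i + (if i = m - j then x else 0) + (if i = j then coeff G 0 * cj x else 0)" for i
    by (auto simp: shift_scr_def)
  have H0: "coeff ?H 0 = coeff G 0" using j by (auto simp: c)
  have top: "coeff ?H m = 1" using G' j by (auto simp: c)
  have "degree ?H \<le> m" by (rule degree_le) (use G' j in \<open>auto simp: c coeff_eq_0\<close>)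
  then have d: "degree ?H = m" using top le_degree[of ?H m] by simp
  show "?H \<in> scr m"
  proof (rule scrI)
    fix i assume i: "i \<le> m"
    have n: "cj (coeff G 0) * coeff G 0 = 1" using scr_norm[OF G] by (simp add: mult.commute)
    have e: "cj (coeff G (m - i)) = cj (coeff G 0) * coeff G i" by (rule scr_coeff[OF G i])
    consider "i = j" | "i = m - j" | "i \<noteq> j" "i \<noteq> m - j" by blast
    then show "cj (coeff ?H (m - i)) = cj (coeff ?H 0) * coeff ?H i"
    proof cases
      case 1
      then have "cj (coeff ?H (m - i)) = cj (coeff G (m - i)) + cj x" using j by (simp add: c)
      also have "\<dots> = cj (coeff G 0) * coeff G i + (cj (coeff G 0) * coeff G 0) * cj x" unfolding e n by simp
      also have "\<dots> = cj (coeff ?H 0) * coeff ?H i" unfolding H0 using 1 j by (simp add: c algebra_simps)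
      finally show ?thesis .
    next
      case 2
      then have "cj (coeff ?H (m - i)) = cj (coeff G (m - i)) + cj (coeff G 0) * x" using j by (simp add: c)
      also have "\<dots> = cj (coeff ?H 0) * coeff ?H i" unfolding H0 e using 2 j by (simp add: c algebra_simps)
      finally show ?thesis .
    next
      case 3
      then have "m - i \<noteq> m - j" "m - i \<noteq> j" using i j by auto
      then show ?thesis unfolding H0 using e 3 by (simp add: c)
    qed
  qed (use d top in auto)
  show "shift_scr m j (- x) ?H = G"
    by (rule poly_eqI) (use j in \<open>auto simp: shift_scr_def[of m j "- x" ?H] H0 c\<close>)
  show "l < j \<Longrightarrow> coeff ?H (m - l) = coeff G (m - l)" using j by (auto simp: c)
  show "coeff ?H (m - j) = coeff G (m - j) + x" using j by (auto simp: c)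
qed

text \<open>The coefficients just below the leading one. With \<open>h\<close> the number of degrees
  below \<open>m\<close> and above \<open>m / 2\<close>, they are coordinates on
  \<open>scr m\<close> together with the constant term and, in even degree, the middle
  coefficient.\<close>

definition topc :: "nat \<Rightarrow> nat \<Rightarrow> 'a poly \<Rightarrow> nat \<Rightarrow> 'a" where
  "topc m h G = (\<lambda>i. if i < h then coeff G (m - 1 - i) else 0)"

lemma topc_V: "topc m h G \<in> V h"
  by (auto simp: topc_def V_def)

lemma topc_D:
  assumes "topc m h G = topc m h H" "1 \<le> l" "l \<le> h" shows "coeff G (m - l) = coeff H (m - l)"
proof -
  have "m - 1 - (l - 1) = m - l" "l - 1 < h" using assms(2,3) by auto
  then show ?thesis using fun_cong[OF assms(1), of "l - 1"] by (simp only: topc_def if_True)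
qed

lemma scr_eqI:
  assumes G: "G \<in> scr m" and H: "H \<in> scr m" and top: "\<And>l. 2 * l < m \<Longrightarrow> l \<ge> 1 \<Longrightarrow> coeff G (m - l) = coeff H (m - l)"
    and mid: "\<And>j. m = 2 * j \<Longrightarrow> coeff G j = coeff H j" and g0: "coeff G 0 = coeff H 0"
  shows "G = H"
proof (rule poly_eqI)
  have lG: "lead_coeff G = 1" "degree G = m" "lead_coeff H = 1" "degree H = m" using G H by (auto simp: scr_def)
  have cm: "coeff G m = coeff H m" using lG by metis
  have nz: "cj (coeff H 0) \<noteq> 0" using scr_coeff_0[OF H] by simp
  fix i
  consider "i > m" | "i = m" | "i = 0" | "0 < i" "i < m" "m < 2 * i" | "m = 2 * i" | "0 < i" "2 * i < m" by linarith
  then show "coeff G i = coeff H i"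
  proof cases
    case 1 then show ?thesis using lG by (simp add: coeff_eq_0)
  next
    case 4 then show ?thesis using top[of "m - i"] by simp
  next
    case 6
    have "cj (coeff G 0) * coeff G i = cj (coeff G (m - i))" by (rule scr_coeff[OF G, symmetric]) (use 6 in simp)
    also have "\<dots> = cj (coeff H 0) * coeff H i" using top[of i] 6 scr_coeff[OF H, of i] by simp
    finally show ?thesis using nz g0 by simp
  qed (use cm g0 mid in auto)
qed

lemma card_norm_1: "card {g. g * cj g = 1} = q + 1"
  by (rule card_norm_fibre) auto

text \<open>The constant term has norm 1, which leaves \<open>q + 1\<close> choices; in even degree
  the middle coefficient satisfies \<open>x ^ q = cj g * x\<close>, which leaves at most
  \<open>q\<close>.\<close>

lemma card_scr_le:
  assumes "m \<ge> 1" shows "card (scr m) \<le> (q + 1) * q ^ (m - 1)"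
proof (cases "even m")
  case False
  then obtain h where m: "m = 2 * h + 1" by (rule oddE)
  let ?f = "\<lambda>G. (topc m h G, coeff G 0)"
  have "inj_on ?f (scr m)"
  proof (rule inj_onI)
    fix G H assume GH: "G \<in> scr m" "H \<in> scr m" "?f G = ?f H"
    show "G = H"
    proof (rule scr_eqI[OF GH(1,2)])
      fix l assume "2 * l < m" "1 \<le> l"
      then show "coeff G (m - l) = coeff H (m - l)" using GH(3) m by (intro topc_D) auto
    qed (use GH(3) m in \<open>auto, presburger\<close>)
  qed
  moreover have "?f ` scr m \<subseteq> V h \<times> {g. g * cj g = 1}" using topc_V scr_norm by auto
  ultimately have "card (scr m) \<le> card ((V h :: (nat \<Rightarrow> 'a) set) \<times> {g::'a. g * cj g = 1})"
    by (rule card_inj_on_le) (simp add: finite_cartesian_product)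
  then show ?thesis by (simp add: card_cartesian_product card_norm_1 card_V card_field m power_mult[symmetric] mult.commute)
next
  case True
  then obtain j where "m = 2 * j" by (rule evenE)
  then obtain h where m: "m = 2 * h + 2" using assms by (cases j) auto
  let ?f = "\<lambda>G. (topc m h G, coeff G 0, coeff G (Suc h))"
  have "inj_on ?f (scr m)"
  proof (rule inj_onI)
    fix G H assume GH: "G \<in> scr m" "H \<in> scr m" "?f G = ?f H"
    show "G = H"
    proof (rule scr_eqI[OF GH(1,2)])
      fix l assume "2 * l < m" "1 \<le> l"
      then show "coeff G (m - l) = coeff H (m - l)" using GH(3) m by (intro topc_D) auto
    next
      fix j assume "m = 2 * j"
      then have "j = Suc h" using m by simp
      then show "coeff G j = coeff H j" using GH(3) by simp
    qed (use GH(3) in auto)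
  qed
  moreover have "?f ` scr m \<subseteq> V h \<times> (SIGMA g:{g. g * cj g = 1}. {x. x ^ q = cj g * x})"
    using topc_V scr_norm scr_coeff[of _ m "Suc h"] m by (fastforce simp: cj_def[symmetric])
  ultimately have "card (scr m) \<le> card ((V h :: (nat \<Rightarrow> 'a) set) \<times> (SIGMA g:{g::'a. g * cj g = 1}. {x. x ^ q = cj g * x}))"
    by (rule card_inj_on_le) (simp add: finite_cartesian_product)
  also have "\<dots> = (q ^ 2) ^ h * (\<Sum>g\<in>{g::'a. g * cj g = 1}. card {x. x ^ q = cj g * x})"
    by (simp add: card_cartesian_product card_V card_field)
  also have "(\<Sum>g\<in>{g::'a. g * cj g = 1}. card {x. x ^ q = cj g * x}) \<le> (\<Sum>g\<in>{g::'a. g * cj g = 1}. q)"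
    using q_ge_2 by (intro sum_mono card_pow_linear_le) simp
  also have "\<dots> = (q + 1) * q" by (simp add: card_norm_1)
  finally show ?thesis by (simp add: m power_mult[symmetric] algebra_simps)
qed

lemma ex_scr:
  assumes t: "t \<in> V h" and g: "g * cj g = 1" and x: "cj x = cj g * x"
  shows "\<exists>G\<in>scr (2 * h + 2). topc (2 * h + 2) h G = t \<and> coeff G 0 = g \<and> coeff G (Suc h) = x"
proof -
  let ?m = "2 * h + 2"
  \<comment> \<open>The lower half is filled in from the top half by the symmetry, with the factor
    \<open>g\<close>.\<close>
  define cf where "cf k = (if k = 0 then g else if k \<le> h then g * cj (t (k - 1)) else if k = Suc h then x
    else if k < ?m then t (?m - 1 - k) else 1)" for k
  define G where "G = polyof (Suc ?m) cf"
  have c: "coeff G k = (if k \<le> ?m then cf k else 0)" for k by (auto simp: G_def coeff_polyof)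
  have top: "coeff G ?m = 1" by (simp add: c cf_def)
  have "degree G \<le> ?m" by (rule degree_le) (simp add: c)
  then have d: "degree G = ?m" using top le_degree[of G ?m] by simp
  have g': "cj g * g = 1" "cj (g * cj g) = 1" using g by (simp_all add: mult.commute)
  have g'': "cj g * (g * y) = y" for y using g' by (simp add: mult.assoc[symmetric])
  have "G \<in> scr ?m"
  proof (rule scrI)
    fix i assume i: "i \<le> ?m"
    consider "i = 0" | "1 \<le> i" "i \<le> h" | "i = Suc h" | "Suc h < i" "i < ?m" | "i = ?m" using i by linarith
    then show "cj (coeff G (?m - i)) = cj (coeff G 0) * coeff G i"
    proof cases
      case 2
      then have "?m - i > Suc h" "?m - i < ?m" "?m - 1 - (?m - i) = i - 1" by auto
      then show ?thesis using 2 by (simp add: c cf_def g'')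
    next
      case 4
      then have "?m - i \<noteq> 0" "?m - i \<le> h" "?m - i - 1 = ?m - 1 - i" by auto
      then show ?thesis using 4 by (simp add: c cf_def)
    qed (simp_all add: c cf_def g' x)
  qed (use d top in auto)
  moreover have "topc ?m h G = t"
    using V_D[OF t] by (auto simp: topc_def fun_eq_iff c cf_def)
  moreover have "coeff G 0 = g" "coeff G (Suc h) = x" by (simp_all add: c cf_def)
  ultimately show ?thesis by blast
qed

end

text \<open>\<open>J\<close> carries the largest exponent that occurs. As \<open>b J\<close> is
  nonzero in the field, the power sum with this exponent really depends on the coefficient at
  \<open>m - b J\<close>.\<close>

locale nontrivial_trace_character = trace_character p rr q ty \<psi> I c b
  for p rr q and ty :: "'a::{finite,field} itself" and \<psi> I c b +
  fixes J :: nat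
  assumes finI: "finite I" and JI: "J \<in> I" and bJ: "i \<in> I \<Longrightarrow> i \<noteq> J \<Longrightarrow> b i < b J"
    and cJ: "c J \<noteq> 0" and bJ_p: "of_nat (b J) \<noteq> (0::'a)" and \<psi>_nontriv: "\<exists>x. \<psi> x \<noteq> 1"
begin

lemma bJ_pos: "1 \<le> b J" using b_pos JI by blast

text \<open>Smaller exponents see only coefficients on which \<open>F\<close> and \<open>G\<close>
  agree, so the coefficient at \<open>m - b J\<close> enters through the power sum with exponent
  \<open>b J\<close> alone.\<close>

lemma tsum_top:
  assumes F: "lead_coeff F = 1" "degree F = m" and G: "lead_coeff G = 1" "degree G = m"
    and top: "\<And>l. l < b J \<Longrightarrow> coeff F (m - l) = coeff G (m - l)" and j: "b J \<le> m"
  shows "tsum (psum F) = tsum (psum G) + (- c J * of_nat (b J)) * (coeff F (m - b J) - coeff G (m - b J))"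
proof -
  have e: "(\<Sum>i\<in>I - {J}. c i * psum F (b i)) = (\<Sum>i\<in>I - {J}. c i * psum G (b i))"
  proof (intro sum.cong refl arg_cong[where f = "(*) _"])
    fix i assume "i \<in> I - {J}"
    then have "b i < b J" using bJ by blast
    then show "psum F (b i) = psum G (b i)" using top by (intro psum_cong_top[OF F G]) auto
  qed
  have d: "psum F (b J) = psum G (b J) - of_nat (b J) * (coeff F (m - b J) - coeff G (m - b J))"
    by (rule psum_diff_top[OF F G top bJ_pos j])
  show ?thesis
    unfolding tsum_def sum.remove[OF finI JI] e d by (simp add: algebra_simps)
qed

lemma ex_char_value: "\<exists>x. \<psi> (- c J * of_nat (b J) * x) \<noteq> 1"
proof -
  obtain y where "\<psi> y \<noteq> 1" using \<psi>_nontriv by blast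
  then show ?thesis using cJ bJ_p by (intro exI[of _ "- y / (c J * of_nat (b J))"]) simp
qed

text \<open>Above degree \<open>2 b_J\<close> the coefficient that \<open>p_{b_J}\<close> sees linearly can be shifted freely.\<close>
lemma Lc_large: assumes m: "m > 2 * b J" shows "Lc m = 0"
proof -
  let ?j = "b J"
  obtain x where x: "\<psi> (- c J * of_nat ?j * x) \<noteq> 1" using ex_char_value by blast
  note sh = shift_scr[OF _ bJ_pos, of _ m]
  have "Lc m = (\<Sum>G\<in>scr m. pc (shift_scr m ?j x G))"
    unfolding Lc_def
    by (rule sum.reindex_bij_witness[of _ "shift_scr m ?j x" "shift_scr m ?j (- x)"])
       (use sh(1)[of _ x] sh(2)[of _ x] sh(1)[of _ "- x"] sh(2)[of _ "- x"] m in auto)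
  also have "\<dots> = (\<Sum>G\<in>scr m. \<psi> (- c J * of_nat ?j * x) * pc G)"
  proof (rule sum.cong[OF refl])
    fix G assume G: "G \<in> scr m"
    have "shift_scr m ?j x G \<in> scr m" by (rule sh(1)[OF G m])
    then have l: "lead_coeff (shift_scr m ?j x G) = 1" "degree (shift_scr m ?j x G) = m" "lead_coeff G = 1" "degree G = m"
      using G by (auto simp: scr_def)
    have e: "tsum (psum (shift_scr m ?j x G)) = tsum (psum G) + - c J * of_nat ?j * x"
      using tsum_top[OF l sh(3)[OF G m]] sh(4)[OF G m, of x] m by simp
    show "pc (shift_scr m ?j x G) = \<psi> (- c J * of_nat ?j * x) * pc G"
      unfolding pc_def e \<psi>_add by (rule mult.commute)
  qed
  also have "\<dots> = \<psi> (- c J * of_nat ?j * x) * Lc m" by (simp add: Lc_def sum_distrib_left)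
  finally have "(1 - \<psi> (- c J * of_nat ?j * x)) * Lc m = 0" by (simp add: algebra_simps)
  then show ?thesis using x by simp
qed

lemma norm_Lc_le: "norm (Lc m) \<le> real (card (scr m))"
  unfolding Lc_def by (rule order_trans[OF norm_sum]) (simp add: norm_pc)

text \<open>A nonzero \<open>x\<close> forces \<open>g = x / cj x\<close>, while 0 admits all
  \<open>q + 1\<close> values of \<open>g\<close>; so the sum is the full character sum, which
  vanishes, plus \<open>q\<close>.\<close>

lemma sum_mid:
  assumes y: "\<exists>x. \<psi> (y * x) \<noteq> 1"
  shows "(\<Sum>(g, x)\<in>(SIGMA g:{g. g * cj g = 1}. {x. cj x = cj g * x}). \<psi> (y * x)) = of_nat q"
proof -
  let ?M = "SIGMA g:{g::'a. g * cj g = 1}. {x. cj x = cj g * x}"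
  have card: "card {z \<in> ?M. snd z = x} = (if x = 0 then q + 1 else 1)" for x
  proof (cases "x = 0")
    case True
    then have "{z \<in> ?M. snd z = x} = (\<lambda>g. (g, 0)) ` {g. g * cj g = 1}" by auto
    then show ?thesis using True card_norm_1 by (simp add: card_image inj_on_def)
  next
    case False
    have "{z \<in> ?M. snd z = x} = {(x / cj x, x)}"
    proof (intro equalityI subsetI)
      fix z assume "z \<in> {z \<in> ?M. snd z = x}"
      then obtain g where z: "z = (g, x)" "g * cj g = 1" "cj x = cj g * x" by auto
      have "x = g * cj x" using arg_cong[OF z(3), of cj] by simp
      then show "z \<in> {(x / cj x, x)}" using False z(1) by (metis cj_eq_0_iff nonzero_mult_div_cancel_right singletonI)
    qed (use False in auto)
    then show ?thesis using False by simp
  qed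
  have "(\<Sum>(g, x)\<in>?M. \<psi> (y * x)) = (\<Sum>z\<in>?M. \<psi> (y * snd z))" by (simp add: case_prod_unfold)
  also have "\<dots> = (\<Sum>x\<in>UNIV. \<Sum>z\<in>{z \<in> ?M. snd z = x}. \<psi> (y * snd z))"
    by (rule sum.group[symmetric]) auto
  also have "\<dots> = (\<Sum>x\<in>UNIV. of_nat (if x = 0 then q + 1 else 1) * \<psi> (y * x))"
    unfolding card[symmetric] by (intro sum.cong refl) simp
  also have "\<dots> = (\<Sum>x\<in>UNIV. \<psi> (y * x) + (if x = 0 then of_nat q * \<psi> (y * x) else 0))"
    by (intro sum.cong refl) (simp add: algebra_simps)
  also have "\<dots> = (\<Sum>x\<in>UNIV. \<psi> (y * x)) + of_nat q" by (simp add: sum.distrib \<psi>_0)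
  also have "(\<Sum>x\<in>UNIV. \<psi> (y * x)) = 0"
    using y by (elim exE, intro sum_additive_char_eq_0) (auto simp: distrib_left \<psi>_add)
  finally show ?thesis by simp
qed

text \<open>In degree \<open>2 b_J\<close> that coefficient \<open>x\<close> is the middle one, tied to the constant term \<open>g\<close> by
  \<open>cj x = cj g * x\<close>. The trivial bound is too large here by the factor \<open>1 + 1/q\<close>.\<close>
lemma norm_Lc_mid: "norm (Lc (2 * b J)) \<le> real q ^ (2 * b J)"
proof -
  obtain h where h: "b J = Suc h" using bJ_pos by (cases "b J") auto
  let ?m = "2 * h + 2" and ?y = "- c J * of_nat (b J)"
  let ?M = "SIGMA g:{g::'a. g * cj g = 1}. {x. cj x = cj g * x}"
  have fibre: "norm (\<Sum>G\<in>{G \<in> scr ?m. topc ?m h G = t}. pc G) = real q" if t: "t \<in> V h" for t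
  proof -
    obtain G0 where G0: "G0 \<in> scr ?m" "topc ?m h G0 = t" "coeff G0 (Suc h) = 0"
      using ex_scr[OF t, of 1 0] by auto
    have pcG: "pc G = pc G0 * \<psi> (?y * coeff G (Suc h))" if G: "G \<in> scr ?m" "topc ?m h G = t" for G
    proof -
      have l: "lead_coeff G = 1" "degree G = ?m" "lead_coeff G0 = 1" "degree G0 = ?m"
        using G G0 by (auto simp: scr_def)
      have "coeff G (?m - l) = coeff G0 (?m - l)" if "l < b J" for l
      proof (cases "l = 0")
        case True then show ?thesis using l by (metis diff_zero)
      next
        case False
        then show ?thesis using G(2) G0(2) that h by (intro topc_D[of ?m h]) auto
      qed
      from tsum_top[OF l this] have e: "tsum (psum G) = tsum (psum G0) + ?y * coeff G (Suc h)"
        using h G0(3) by simp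
      show ?thesis unfolding pc_def e \<psi>_add ..
    qed
    have "(\<Sum>G\<in>{G \<in> scr ?m. topc ?m h G = t}. pc G) = (\<Sum>G\<in>{G \<in> scr ?m. topc ?m h G = t}. pc G0 * \<psi> (?y * coeff G (Suc h)))"
      by (intro sum.cong refl) (simp add: pcG)
    also have "\<dots> = (\<Sum>z\<in>?M. pc G0 * \<psi> (?y * snd z))"
    proof (rule sum.reindex_bij_betw[where h = "\<lambda>G. (coeff G 0, coeff G (Suc h))" and g = "\<lambda>z. pc G0 * \<psi> (?y * snd z)", simplified snd_conv])
      show "bij_betw (\<lambda>G. (coeff G 0, coeff G (Suc h))) {G \<in> scr ?m. topc ?m h G = t} ?M"
      proof (rule bij_betw_imageI)
        show "inj_on (\<lambda>G. (coeff G 0, coeff G (Suc h))) {G \<in> scr ?m. topc ?m h G = t}"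
        proof (rule inj_onI)
          fix G H assume GH: "G \<in> {G \<in> scr ?m. topc ?m h G = t}" "H \<in> {G \<in> scr ?m. topc ?m h G = t}"
            "(coeff G 0, coeff G (Suc h)) = (coeff H 0, coeff H (Suc h))"
          show "G = H"
          proof (rule scr_eqI)
            fix l assume "2 * l < ?m" "1 \<le> l"
            then show "coeff G (?m - l) = coeff H (?m - l)" using GH by (intro topc_D[of ?m h]) auto
          next
            fix j assume "?m = 2 * j"
            then have "j = Suc h" by simp
            then show "coeff G j = coeff H j" using GH(3) by simp
          qed (use GH in auto)
        qed
        show "(\<lambda>G. (coeff G 0, coeff G (Suc h))) ` {G \<in> scr ?m. topc ?m h G = t} = ?M"
        proof (intro equalityI subsetI)
          fix z assume "z \<in> ?M"
          then obtain g x where z: "z = (g, x)" "g * cj g = 1" "cj x = cj g * x" by auto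
          show "z \<in> (\<lambda>G. (coeff G 0, coeff G (Suc h))) ` {G \<in> scr ?m. topc ?m h G = t}"
            using ex_scr[OF t z(2,3)] z(1) by force
        next
          fix z assume "z \<in> (\<lambda>G. (coeff G 0, coeff G (Suc h))) ` {G \<in> scr ?m. topc ?m h G = t}"
          then obtain G where G: "G \<in> scr ?m" "z = (coeff G 0, coeff G (Suc h))" by auto
          have "cj (coeff G (?m - Suc h)) = cj (coeff G 0) * coeff G (Suc h)" by (rule scr_coeff[OF G(1)]) simp
          then show "z \<in> ?M" using scr_norm[OF G(1)] G(2) by simp
        qed
      qed
    qed
    also have "\<dots> = pc G0 * (\<Sum>(g, x)\<in>?M. \<psi> (?y * x))" by (simp add: sum_distrib_left case_prod_unfold)
    also have "(\<Sum>(g, x)\<in>?M. \<psi> (?y * x)) = of_nat q" by (rule sum_mid[OF ex_char_value])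
    finally show ?thesis by (simp add: norm_mult norm_pc)
  qed
  have "Lc ?m = (\<Sum>t\<in>V h. \<Sum>G\<in>{G \<in> scr ?m. topc ?m h G = t}. pc G)"
    unfolding Lc_def by (rule sum.group[symmetric]) (auto simp: finite_scr topc_V)
  then have "norm (Lc ?m) \<le> (\<Sum>t\<in>(V h :: (nat \<Rightarrow> 'a) set). norm (\<Sum>G\<in>{G \<in> scr ?m. topc ?m h G = t}. pc G))"
    by (simp only: norm_sum)
  also have "\<dots> = (\<Sum>t\<in>(V h :: (nat \<Rightarrow> 'a) set). real q)" by (intro sum.cong refl fibre)
  also have "\<dots> = real q ^ (2 * h + 1)" by (simp add: card_V card_field power_mult[symmetric] mult.commute)
  \<comment> \<open>One power of \<open>q\<close> is given away; \<open>q ^ (2 * b J)\<close> is the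
    bound required in \<open>norm_Lc\<close>, where the binomial coefficient is 1.\<close>
  also have "\<dots> \<le> real q ^ (2 * h + 2)" using q_ge_2 by (intro power_increasing) auto
  finally show ?thesis using h by simp
qed

text \<open>Strictly between degrees 0 and \<open>2 * b J\<close> the trivial bound exceeds
  \<open>q ^ m\<close> by the factor \<open>1 + 1 / q\<close>, which a binomial coefficient of at
  least 2 absorbs. At both ends this coefficient is 1 and leaves no such room.\<close>

theorem norm_Lc: "norm (Lc m) \<le> real ((2 * b J) choose m) * real q ^ m"
proof -
  consider "m = 0" | "1 \<le> m" "m < 2 * b J" | "m = 2 * b J" | "m > 2 * b J" by linarith
  then show ?thesis
  proof cases
    case 1 then show ?thesis by (simp add: Lc_0)
  next
    case 2
    obtain N k where N: "2 * b J = Suc N" "m = Suc k" using 2 by (metis Suc_le_D One_nat_def less_imp_Suc_add)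
    have "N choose k > 0" "N choose Suc k > 0" using 2 N by (auto simp: zero_less_binomial_iff)
    then have "2 \<le> (2 * b J) choose m" unfolding N binomial_Suc_Suc by linarith
    then have "2 * q ^ m \<le> ((2 * b J) choose m) * q ^ m" by (intro mult_right_mono) auto
    moreover have "(q + 1) * q ^ (m - 1) \<le> 2 * q ^ m"
      using q_ge_2 N(2) by (simp add: mult.assoc[symmetric])
    ultimately have "card (scr m) \<le> ((2 * b J) choose m) * q ^ m" using card_scr_le[OF 2(1)] by linarith
    then show ?thesis using norm_Lc_le[of m] by (metis (no_types, lifting) of_nat_le_iff of_nat_mult of_nat_power order_trans)
  next
    case 3 then show ?thesis using norm_Lc_mid by simp
  next
    case 4 then show ?thesis by (simp add: Lc_large)
  qed
qed

end

section \<open>Solving the recursion\<close>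

text \<open>By Euler's identity these are the coefficients of \<open>\<Prod>_{i \<ge> 0} (1 + u Q^{-i})\<close>.\<close>
definition qexp :: "real \<Rightarrow> real fps" where
  "qexp Q = Abs_fps (\<lambda>k. \<Prod>i\<in>{1..k}. Q / (Q ^ i - 1))"

text \<open>The substitution of \<open>x u\<close> for the variable \<open>u\<close>.\<close>

definition fps_dilate :: "'k::comm_semiring_1 \<Rightarrow> 'k fps \<Rightarrow> 'k fps" where
  "fps_dilate x f = Abs_fps (\<lambda>n. x ^ n * fps_nth f n)"

lemma fps_dilate_mult: "fps_dilate x (f * g) = fps_dilate x f * fps_dilate x g"
proof (rule fps_ext)
  fix n
  have "fps_nth (fps_dilate x f * fps_dilate x g) n = (\<Sum>i=0..n. x ^ n * (fps_nth f i * fps_nth g (n - i)))"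
    unfolding fps_mult_nth
  proof (intro sum.cong refl)
    fix i assume "i \<in> {0..n}"
    then have "x ^ n = x ^ i * x ^ (n - i)" by (simp flip: power_add)
    then show "fps_nth (fps_dilate x f) i * fps_nth (fps_dilate x g) (n - i) = x ^ n * (fps_nth f i * fps_nth g (n - i))"
      by (simp add: fps_dilate_def mult_ac)
  qed
  then show "fps_nth (fps_dilate x (f * g)) n = fps_nth (fps_dilate x f * fps_dilate x g) n"
    by (simp add: fps_dilate_def fps_mult_nth sum_distrib_left)
qed

lemma fps_dilate_power: "fps_dilate x (f ^ N) = fps_dilate x f ^ N"
proof (induction N)
  case 0
  show ?case by (rule fps_ext) (simp add: fps_dilate_def)
qed (simp add: fps_dilate_mult)

lemma nth_one_plus_power: "fps_nth ((1 + fps_const x * fps_X) ^ N) i = of_nat (N choose i) * x ^ i"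
  for x :: "'k::comm_ring_1"
proof (induction N arbitrary: i)
  case 0
  show ?case by (cases i) auto
next
  case (Suc N)
  note IH = Suc.IH
  let ?f = "1 + fps_const x * fps_X"
  have e: "fps_nth (?f ^ Suc N) i = fps_nth (?f ^ N) i + fps_nth (fps_const x * (fps_X * ?f ^ N)) i"
    by (simp add: distrib_right mult.assoc)
  show ?case
  proof (cases i)
    case (Suc j)
    have "fps_nth (?f ^ Suc N) i = of_nat (N choose Suc j) * x ^ Suc j + x * (of_nat (N choose j) * x ^ j)"
      unfolding e unfolding Suc by (simp add: IH)
    then show ?thesis by (simp add: Suc algebra_simps)
  next
    case 0
    show ?thesis unfolding e unfolding 0 by (simp add: IH)
  qed
qed

text \<open>Replacing \<open>u\<close> by \<open>Q u\<close> in the product shifts its index and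
  adds the single factor \<open>1 + Q u\<close>.\<close>

lemma qexp_dilate:
  assumes "Q > 1" shows "fps_dilate Q (qexp Q) = (1 + fps_const Q * fps_X) * qexp Q"
proof (rule fps_ext)
  fix k
  show "fps_nth (fps_dilate Q (qexp Q)) k = fps_nth ((1 + fps_const Q * fps_X) * qexp Q) k"
  proof (cases k)
    case 0
    then show ?thesis by (simp add: fps_dilate_def)
  next
    case (Suc l)
    have "Q ^ Suc l > 1" using assms by (rule one_less_power) simp
    then have "Q ^ Suc l - 1 \<noteq> 0" by simp
    then have e: "Q ^ Suc l * (Q / (Q ^ Suc l - 1)) = Q / (Q ^ Suc l - 1) + Q" by (simp add: field_simps)
    let ?g = "fps_nth (qexp Q) l"
    have g: "fps_nth (qexp Q) (Suc l) = (Q / (Q ^ Suc l - 1)) * ?g"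
      by (simp add: qexp_def atLeastAtMostSuc_conv del: power_Suc)
    have "fps_nth (fps_dilate Q (qexp Q)) (Suc l) = (Q ^ Suc l * (Q / (Q ^ Suc l - 1))) * ?g"
      unfolding fps_dilate_def fps_nth_Abs_fps g by (simp only: mult.assoc)
    also have "\<dots> = fps_nth (qexp Q) (Suc l) + Q * ?g" unfolding e g by (rule distrib_right)
    also have "\<dots> = fps_nth ((1 + fps_const Q * fps_X) * qexp Q) (Suc l)"
      by (simp add: distrib_right mult.assoc)
    finally show ?thesis unfolding Suc .
  qed
qed

text \<open>This is the recursion for \<open>E\<close> with the signs removed and the coefficients
  of \<open>L\<close> replaced by their bounds.\<close>

lemma qexp_power_rec:
  assumes "Q > 1"
  shows "Q ^ n * fps_nth (qexp Q ^ N) n = (\<Sum>i\<le>n. real (N choose i) * Q ^ i * fps_nth (qexp Q ^ N) (n - i))"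
proof -
  have "fps_dilate Q (qexp Q ^ N) = (1 + fps_const Q * fps_X) ^ N * qexp Q ^ N"
    unfolding fps_dilate_power qexp_dilate[OF assms] power_mult_distrib ..
  then have "fps_nth (fps_dilate Q (qexp Q ^ N)) n = fps_nth ((1 + fps_const Q * fps_X) ^ N * qexp Q ^ N) n" by simp
  then show ?thesis
    unfolding fps_mult_nth nth_one_plus_power by (simp add: fps_dilate_def atLeast0AtMost)
qed

lemma qexp_nonneg: "Q > 1 \<Longrightarrow> fps_nth (qexp Q) k \<ge> 0"
  unfolding qexp_def by (auto intro!: prod_nonneg divide_nonneg_nonneg simp: one_le_power)

lemma qexp_power_nonneg: "Q > 1 \<Longrightarrow> fps_nth (qexp Q ^ N) k \<ge> 0"
proof (induction N arbitrary: k)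
  case 0
  show ?case by (cases k) auto
qed (auto simp: fps_mult_nth intro!: sum_nonneg mult_nonneg_nonneg qexp_nonneg)

text \<open>Factor \<open>i\<close> is at most \<open>1 + 1 / (Q - 1)\<close> times \<open>Q\<close>
  to the power \<open>- (i - 1)\<close>, and the numbers \<open>i - 1\<close> add up to
  \<open>k * (k - 1) / 2\<close>.\<close>

lemma qexp_le:
  assumes Q: "Q > 1"
  shows "fps_nth (qexp Q) k \<le> (1 + 1 / (Q - 1)) ^ k * Q powr (real k / 2 - real k ^ 2 / 2)"
proof (induction k)
  case 0
  show ?case using Q by (simp add: qexp_def)
next
  case (Suc k)
  have p: "Q ^ k * (Q - 1) \<le> Q ^ Suc k - 1" using Q one_le_power[of Q k] by (simp add: algebra_simps)
  have pos: "Q ^ k * (Q - 1) > 0" using Q by simp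
  have pos': "Q ^ Suc k - 1 > 0" using p pos by linarith
  have "Q / (Q ^ Suc k - 1) \<le> Q / (Q ^ k * (Q - 1))"
    using p pos pos' Q by (intro divide_left_mono mult_pos_pos) (auto simp del: power_Suc)
  also have "\<dots> = (1 + 1 / (Q - 1)) * Q powr (- real k)"
    using Q by (simp add: powr_minus powr_realpow field_simps)
  finally have f: "Q / (Q ^ Suc k - 1) \<le> (1 + 1 / (Q - 1)) * Q powr (- real k)" .
  have "fps_nth (qexp Q) (Suc k) = fps_nth (qexp Q) k * (Q / (Q ^ Suc k - 1))"
    by (simp add: qexp_def atLeastAtMostSuc_conv mult.commute del: power_Suc)
  also have "\<dots> \<le> ((1 + 1 / (Q - 1)) ^ k * Q powr (real k / 2 - real k ^ 2 / 2)) * ((1 + 1 / (Q - 1)) * Q powr (- real k))"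
    using Suc f Q pos' by (intro mult_mono) (auto simp del: power_Suc)
  also have "\<dots> = (1 + 1 / (Q - 1)) ^ Suc k * (Q powr (real k / 2 - real k ^ 2 / 2) * Q powr (- real k))" by simp
  also have "Q powr (real k / 2 - real k ^ 2 / 2) * Q powr (- real k) = Q powr (real (Suc k) / 2 - real (Suc k) ^ 2 / 2)"
    unfolding powr_add[symmetric] by (rule arg_cong[where f = "\<lambda>x. Q powr x"]) (simp add: power2_eq_square field_simps)
  finally show ?case .
qed

text \<open>The difference is a square, zero for \<open>y = N * x\<close>, the even split of
  \<open>n\<close> among the factors.\<close>

lemma square_split:
  fixes x y N :: real assumes "N > 0"
  shows "(x + y) ^ 2 / (2 * (N + 1)) \<le> x ^ 2 / 2 + y ^ 2 / (2 * N)"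
proof -
  have "(x ^ 2 / 2 + y ^ 2 / (2 * N)) - (x + y) ^ 2 / (2 * (N + 1)) = (N * x - y) ^ 2 / (2 * N * (N + 1))"
    using assms by (simp add: divide_simps power2_eq_square) algebra
  also have "\<dots> \<ge> 0" using assms by simp
  finally show ?thesis by simp
qed

lemma qexp_power_le:
  assumes Q: "Q > 1"
  shows "fps_nth (qexp Q ^ Suc N) n
    \<le> real ((n + N) choose n) * ((1 + 1 / (Q - 1)) ^ n * Q powr (real n / 2 - real n ^ 2 / (2 * real (Suc N))))"
proof (induction N arbitrary: n)
  case 0
  show ?case using qexp_le[OF Q, of n] by simp
next
  case (Suc N)
  let ?c = "1 + 1 / (Q - 1)"
  have c: "?c \<ge> 0" using Q by simp
  have "fps_nth (qexp Q ^ Suc (Suc N)) n = (\<Sum>k\<le>n. fps_nth (qexp Q) k * fps_nth (qexp Q ^ Suc N) (n - k))"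
    by (subst power_Suc) (simp add: fps_mult_nth atLeast0AtMost del: power_Suc)
  also have "\<dots> \<le> (\<Sum>k\<le>n. real ((n - k + N) choose (n - k)) * (?c ^ n * Q powr (real n / 2 - real n ^ 2 / (2 * real (Suc (Suc N))))))"
  proof (intro sum_mono)
    fix k assume "k \<in> {..n}"
    then have k: "k \<le> n" by simp
    have "fps_nth (qexp Q) k * fps_nth (qexp Q ^ Suc N) (n - k)
      \<le> (?c ^ k * Q powr (real k / 2 - real k ^ 2 / 2))
        * (real ((n - k + N) choose (n - k)) * (?c ^ (n - k) * Q powr (real (n - k) / 2 - real (n - k) ^ 2 / (2 * real (Suc N)))))"
      by (rule mult_mono[OF qexp_le[OF Q] Suc _ qexp_power_nonneg[OF Q]]) (use c in simp)
    also have "\<dots> = real ((n - k + N) choose (n - k)) * (?c ^ n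
        * Q powr ((real k / 2 - real k ^ 2 / 2) + (real (n - k) / 2 - real (n - k) ^ 2 / (2 * real (Suc N)))))"
    proof -
      have "?c ^ n = ?c ^ k * ?c ^ (n - k)" using k by (simp flip: power_add)
      then show ?thesis unfolding powr_add by (simp only: mult_ac)
    qed
    also have "\<dots> \<le> real ((n - k + N) choose (n - k)) * (?c ^ n * Q powr (real n / 2 - real n ^ 2 / (2 * real (Suc (Suc N)))))"
    proof (intro mult_left_mono powr_mono)
      have "(real k + real (n - k)) ^ 2 / (2 * (real (Suc N) + 1)) \<le> real k ^ 2 / 2 + real (n - k) ^ 2 / (2 * real (Suc N))"
        by (rule square_split) simp
      moreover have e: "real k + real (n - k) = real n" using k by simp
      moreover have "real (Suc N) + 1 = real (Suc (Suc N))" by simp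
      ultimately have "real n ^ 2 / (2 * real (Suc (Suc N))) \<le> real k ^ 2 / 2 + real (n - k) ^ 2 / (2 * real (Suc N))" by metis
      then show "(real k / 2 - real k ^ 2 / 2) + (real (n - k) / 2 - real (n - k) ^ 2 / (2 * real (Suc N)))
          \<le> real n / 2 - real n ^ 2 / (2 * real (Suc (Suc N)))"
        using e by linarith
    qed (use Q c in auto)
    finally show "fps_nth (qexp Q) k * fps_nth (qexp Q ^ Suc N) (n - k)
      \<le> real ((n - k + N) choose (n - k)) * (?c ^ n * Q powr (real n / 2 - real n ^ 2 / (2 * real (Suc (Suc N)))))" .
  qed
  also have "\<dots> = real (\<Sum>k\<le>n. (n - k + N) choose (n - k)) * (?c ^ n * Q powr (real n / 2 - real n ^ 2 / (2 * real (Suc (Suc N)))))"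
    by (simp add: sum_distrib_right)
  \<comment> \<open>Hockey-stick sum; the result counts the ways to distribute \<open>n\<close> over
    \<open>N + 2\<close> factors.\<close>
  also have "(\<Sum>k\<le>n. (n - k + N) choose (n - k)) = (\<Sum>k\<le>n. (N + k) choose k)"
    by (rule sum.reindex_bij_witness[of _ "\<lambda>k. n - k" "\<lambda>k. n - k"]) (auto simp: add.commute)
  also have "\<dots> = (n + Suc N) choose n"
    unfolding sum_choose_lower by (simp add: add.commute)
  finally show ?case .
qed

text \<open>\<open>qexp_power_rec\<close> is the extremal case. The term \<open>i = 0\<close>
  contains \<open>E n\<close> itself with a factor of norm at most 1; moved to the left it leaves
  \<open>Q ^ n - 1\<close>, which is positive for \<open>n > 0\<close>.\<close>

lemma recursion_bound:
  fixes E L :: "nat \<Rightarrow> complex"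
  assumes Q: "Q > 1" and L: "\<And>m. norm (L m) \<le> real (N choose m) * Q ^ m" and E0: "norm (E 0) \<le> 1"
    and rec: "\<And>n. of_real Q ^ n * E n = (\<Sum>i\<le>n. L i * (- 1) ^ (n - i) * E (n - i))"
  shows "norm (E n) \<le> fps_nth (qexp Q ^ N) n"
proof (induction n rule: less_induct)
  case (less n)
  show ?case
  proof (cases n)
    case 0
    have "fps_nth (qexp Q ^ N) 0 = 1" by (simp add: qexp_def fps_power_zeroth)
    then show ?thesis using E0 0 by simp
  next
    case (Suc m)
    let ?e = "fps_nth (qexp Q ^ N)"
    have Qn: "Q ^ n > 1" using Q Suc by (intro one_less_power) auto
    have ins: "{..n} = insert 0 {1..n}" by auto
    have "Q ^ n * norm (E n) = norm (of_real Q ^ n * E n)" using Q by (simp add: norm_mult norm_power)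
    also have "\<dots> \<le> (\<Sum>i\<le>n. norm (L i) * norm (E (n - i)))"
      unfolding rec by (rule order_trans[OF norm_sum]) (simp add: norm_mult norm_power)
    also have "\<dots> = norm (L 0) * norm (E n) + (\<Sum>i\<in>{1..n}. norm (L i) * norm (E (n - i)))"
      unfolding ins by simp
    also have "\<dots> \<le> 1 * norm (E n) + (\<Sum>i\<in>{1..n}. (real (N choose i) * Q ^ i) * ?e (n - i))"
      using L[of 0] Q by (intro add_mono mult_right_mono sum_mono mult_mono L less) auto
    also have "(\<Sum>i\<in>{1..n}. (real (N choose i) * Q ^ i) * ?e (n - i)) = Q ^ n * ?e n - ?e n"
      unfolding qexp_power_rec[OF Q] ins by simp
    finally have "(Q ^ n - 1) * norm (E n) \<le> (Q ^ n - 1) * ?e n" by (simp add: algebra_simps)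
    then show ?thesis using Qn by simp
  qed
qed

definition deviation_bound :: "real \<Rightarrow> nat \<Rightarrow> nat \<Rightarrow> real" where
  "deviation_bound Q n K = real ((n + (2 * K - 1)) choose n) * ((1 + 1 / (Q - 1)) ^ n * Q powr (real n / 2 - real n ^ 2 / (4 * real K)))"

context nontrivial_trace_character
begin

lemma norm_E_le_1: "norm (E n) \<le> 1"
proof -
  have "norm (\<Sum>f\<in>U n. tc n f) \<le> real (card (U n))"
    by (rule order_trans[OF norm_sum]) (simp add: tc_def \<psi>_norm)
  then show ?thesis using card_U_pos[of n] by (simp add: E_def norm_divide field_simps)
qed

text \<open>\<open>K\<close> is free because \<open>b J\<close> varies with the coefficients
  \<open>c\<close>, while the final estimate uses \<open>b k\<close> for all of them.\<close>

theorem norm_E_le: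
  assumes K: "b J \<le> K"
  shows "norm (E n) \<le> deviation_bound (real q) n K"
proof -
  have Q: "real q > 1" using q_ge_2 by simp
  have K1: "1 \<le> K" using bJ_pos K by simp
  have "norm (E n) \<le> fps_nth (qexp (real q) ^ (2 * K)) n"
  proof (rule recursion_bound[OF Q, where L = Lc])
    fix m
    have "(2 * b J) choose m \<le> (2 * K) choose m" by (rule binomial_right_mono) (use K in simp)
    then show "norm (Lc m) \<le> real ((2 * K) choose m) * real q ^ m"
      using norm_Lc[of m] by (meson mult_right_mono of_nat_0_le_iff of_nat_mono order_trans zero_le_power)
    show "of_real (real q) ^ n * E n = (\<Sum>i\<le>n. Lc i * (- 1) ^ (n - i) * E (n - i))" for n
      using recursion[of n] by simp
  qed (rule norm_E_le_1)
  also have "2 * K = Suc (2 * K - 1)" using K1 by simp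
  also have "fps_nth (qexp (real q) ^ Suc (2 * K - 1)) n \<le> real ((n + (2 * K - 1)) choose n)
      * ((1 + 1 / (real q - 1)) ^ n * real q powr (real n / 2 - real n ^ 2 / (2 * real (Suc (2 * K - 1)))))"
    by (rule qexp_power_le[OF Q])
  also have "2 * real (Suc (2 * K - 1)) = 4 * real K" using K1 by simp
  finally show ?thesis unfolding deviation_bound_def .
qed

end

context hermitian_field
begin

text \<open>Fourier inversion over the tuples \<open>c\<close>: the zero tuple gives the main term,
  and every other one is bounded by \<open>norm_E_le\<close> with \<open>J\<close> its last nonzero
  index.\<close>

lemma trace_equidistribution:
  assumes k: "k \<ge> 1" and b: "strict_mono_on {1..k} b" "\<And>i. i \<in> {1..k} \<Longrightarrow> 1 \<le> b i \<and> coprime (b i) p"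
  shows "\<bar>real (card {f \<in> U n. \<forall>i\<in>{1..k}. trU n (f ^^ b i) = a i}) / real (card (U n)) - 1 / (real q ^ 2) ^ k\<bar>
    \<le> deviation_bound (real q) n (b k)"
proof -
  let ?N = "card {f \<in> U n. \<forall>i\<in>{1..k}. trU n (f ^^ b i) = a i}" and ?C = "PiE {1..k} (\<lambda>_. UNIV :: 'a set)"
  let ?X = "deviation_bound (real q) n (b k)"
  obtain \<psi> :: "'a \<Rightarrow> complex" where \<psi>: "\<And>x y. \<psi> (x + y) = \<psi> x * \<psi> y" "\<And>x. norm (\<psi> x) = 1" "\<exists>x. \<psi> x \<noteq> 1"
    using ex_additive_char by blast
  have "\<psi> 0 * \<psi> 0 = \<psi> 0" "\<psi> 0 \<noteq> 0" using \<psi>(1)[of 0 0] \<psi>(2)[of 0] by auto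
  then have \<psi>0: "\<psi> 0 = 1" by simp
  have \<psi>_sum: "\<psi> (sum h A) = (\<Prod>i\<in>A. \<psi> (h i))" if "finite A" for h :: "nat \<Rightarrow> 'a" and A
    using that by (induction A rule: finite_induct) (auto simp: \<psi>0 \<psi>)
  have orth: "(\<Sum>x\<in>UNIV. \<psi> (x * y)) = (if y = 0 then of_nat (q ^ 2) else 0)" for y
  proof (cases "y = 0")
    case False
    obtain z where "\<psi> z \<noteq> 1" using \<psi>(3) by blast
    then have "\<psi> ((z / y) * y) \<noteq> 1" using False by simp
    then have "(\<Sum>x\<in>UNIV. \<psi> (x * y)) = 0"
      by (intro sum_additive_char_eq_0[of UNIV "\<lambda>x. \<psi> (x * y)" "z / y"]) (auto simp: distrib_right \<psi>(1))
    then show ?thesis using False by simp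
  qed (simp add: \<psi>0 card_field)
  have ind: "(\<Sum>c\<in>?C. \<psi> (\<Sum>i\<in>{1..k}. c i * y i)) = (if \<forall>i\<in>{1..k}. y i = 0 then (of_nat q ^ 2) ^ k else 0)" for y
  proof -
    have "(\<Sum>c\<in>?C. \<psi> (\<Sum>i\<in>{1..k}. c i * y i)) = (\<Sum>c\<in>?C. \<Prod>i\<in>{1..k}. \<psi> (c i * y i))" by (simp add: \<psi>_sum)
    also have "\<dots> = (\<Prod>i\<in>{1..k}. \<Sum>x\<in>UNIV. \<psi> (x * y i))" by (rule prod_sum_PiE[symmetric]) auto
    also have "\<dots> = (if \<forall>i\<in>{1..k}. y i = 0 then (of_nat q ^ 2) ^ k else 0)"
      unfolding orth by (auto simp: prod_zero_iff)
    finally show ?thesis .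
  qed
  define S where "S c = (\<Sum>f\<in>U n. \<psi> (\<Sum>i\<in>{1..k}. c i * trU n (f ^^ b i)))" for c
  define t where "t c = \<psi> (- (\<Sum>i\<in>{1..k}. c i * a i)) * S c" for c
  \<comment> \<open>The zero tuple as an element of \<open>PiE\<close>, hence
    \<open>undefined\<close> outside \<open>{1..k}\<close>.\<close>
  define z where "z = restrict (\<lambda>_. 0 :: 'a) {1..k}"
  have zC: "z \<in> ?C" by (simp add: z_def)
  have finC: "finite ?C" by (intro finite_PiE) auto
  have cardC: "card ?C = (q ^ 2) ^ k" by (simp add: card_PiE card_field)
  have count: "(of_nat q ^ 2) ^ k * of_nat ?N = (\<Sum>c\<in>?C. t c)"
  proof -
    have "(\<Sum>c\<in>?C. t c) = (\<Sum>c\<in>?C. \<Sum>f\<in>U n. \<psi> (\<Sum>i\<in>{1..k}. c i * (trU n (f ^^ b i) - a i)))"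
      unfolding t_def S_def sum_distrib_left
    proof (intro sum.cong refl)
      fix c f
      have "(\<Sum>i\<in>{1..k}. c i * (trU n (f ^^ b i) - a i)) = - (\<Sum>i\<in>{1..k}. c i * a i) + (\<Sum>i\<in>{1..k}. c i * trU n (f ^^ b i))"
        by (simp add: right_diff_distrib sum_subtractf)
      then show "\<psi> (- (\<Sum>i\<in>{1..k}. c i * a i)) * \<psi> (\<Sum>i\<in>{1..k}. c i * trU n (f ^^ b i))
          = \<psi> (\<Sum>i\<in>{1..k}. c i * (trU n (f ^^ b i) - a i))" by (simp only: \<psi>(1))
    qed
    also have "\<dots> = (\<Sum>f\<in>U n. if \<forall>i\<in>{1..k}. trU n (f ^^ b i) - a i = 0 then (of_nat q ^ 2) ^ k else 0)"
      by (subst sum.swap) (simp only: ind)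
    also have "\<dots> = (\<Sum>f\<in>{f \<in> U n. \<forall>i\<in>{1..k}. trU n (f ^^ b i) = a i}. (of_nat q ^ 2) ^ k)"
      by (rule sum.mono_neutral_cong_right) (auto simp: finite_U)
    finally show ?thesis by (simp add: mult.commute)
  qed
  have tz: "t z = of_nat (card (U n))"
    by (simp add: t_def S_def z_def \<psi>0)
  have tc: "norm (t c) \<le> real (card (U n)) * ?X" if c: "c \<in> ?C - {z}" for c
  proof -
    define I where "I = {i \<in> {1..k}. c i \<noteq> 0}"
    have "I \<noteq> {}"
    proof
      assume "I = {}"
      then have "c i = 0" if "i \<in> {1..k}" for i using that by (auto simp: I_def)
      moreover have "c i = undefined" if "i \<notin> {1..k}" for i using c that by (auto simp: PiE_def extensional_def)
      ultimately have "c = z" by (auto simp: z_def fun_eq_iff)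
      then show False using c by simp
    qed
    have finI: "finite I" by (simp add: I_def)
    define J where "J = Max I"
    have JI: "J \<in> I" unfolding J_def using finI \<open>I \<noteq> {}\<close> by (rule Max_in)
    then have J: "J \<in> {1..k}" "c J \<noteq> 0" by (auto simp: I_def)
    interpret nontrivial_trace_character p rr q ty \<psi> I c b J
    proof unfold_locales
      show "b i < b J" if "i \<in> I" "i \<noteq> J" for i
      proof -
        have "i \<le> J" unfolding J_def using finI that(1) by (rule Max_ge)
        then have "i < J" using that(2) by simp
        then show ?thesis using b(1) that(1) J(1) unfolding strict_mono_on_def I_def by auto
      qed
      have "\<not> p dvd b J"
        using b(2)[OF J(1)] prime_p by (metis coprime_absorb_right not_prime_unit)
      then show "of_nat (b J) \<noteq> (0 :: 'a)" by (simp add: of_nat_eq_0_iff_char_dvd CHAR_eq)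
    qed (use \<psi> b finI JI J in \<open>auto simp: I_def\<close>)
    have "(\<Sum>i\<in>{1..k}. c i * trU n (f ^^ b i)) = tsum (\<lambda>l. trU n (f ^^ l))" for f
      unfolding tsum_def by (rule sum.mono_neutral_right) (auto simp: I_def)
    then have "S c = of_nat (card (U n)) * E n" unfolding S_def sum_tc_U[symmetric] tc_def by simp
    moreover have "b J \<le> b k"
      using b(1) J(1) unfolding strict_mono_on_def by (cases "J = k") (auto intro!: less_imp_le)
    ultimately show ?thesis
      using norm_E_le[of "b k" n] by (simp add: t_def norm_mult \<psi>(2) mult_left_mono)
  qed
  have X0: "?X \<ge> 0" unfolding deviation_bound_def using q_ge_2 by simp
  have "norm ((of_nat q ^ 2) ^ k * of_nat ?N - of_nat (card (U n)) :: complex) = norm (\<Sum>c\<in>?C - {z}. t c)"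
    unfolding count sum.remove[OF finC zC] tz by simp
  also have "\<dots> \<le> (\<Sum>c\<in>?C - {z}. real (card (U n)) * ?X)"
    by (rule order_trans[OF norm_sum sum_mono]) (rule tc)
  also have "\<dots> \<le> (\<Sum>c\<in>?C. real (card (U n)) * ?X)"
    using finC X0 by (intro sum_mono2) auto
  also have "\<dots> = (real q ^ 2) ^ k * (real (card (U n)) * ?X)" unfolding sum_constant cardC by simp
  finally have main: "norm ((of_nat q ^ 2) ^ k * of_nat ?N - of_nat (card (U n)) :: complex) \<le> (real q ^ 2) ^ k * (real (card (U n)) * ?X)" .
  have "((of_nat q ^ 2) ^ k * of_nat ?N - of_nat (card (U n)) :: complex) = of_real ((real q ^ 2) ^ k * real ?N - real (card (U n)))"
    by simp
  then have main': "\<bar>(real q ^ 2) ^ k * real ?N - real (card (U n))\<bar> \<le> (real q ^ 2) ^ k * (real (card (U n)) * ?X)"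
    using main by (simp only: norm_of_real)
  let ?D = "(real q ^ 2) ^ k * real (card (U n))"
  have D: "?D > 0" using q_ge_2 card_U_pos[of n] by simp
  have "real ?N / real (card (U n)) - 1 / (real q ^ 2) ^ k = ((real q ^ 2) ^ k * real ?N - real (card (U n))) / ?D"
    using q_ge_2 card_U_pos[of n] by (simp add: diff_divide_distrib)
  then have "\<bar>real ?N / real (card (U n)) - 1 / (real q ^ 2) ^ k\<bar> = \<bar>(real q ^ 2) ^ k * real ?N - real (card (U n))\<bar> / ?D"
    using D by (simp only: abs_divide abs_of_pos)
  also have "\<dots> \<le> ((real q ^ 2) ^ k * (real (card (U n)) * ?X)) / ?D"
    using main' D by (intro divide_right_mono) auto
  also have "\<dots> = ?X" using q_ge_2 card_U_pos[of n] by simp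
  finally show ?thesis .
qed

end

section \<open>From matrices to isometries\<close>

text \<open>\<open>e\<close> enumerates the index type of the matrices; beyond \<open>n\<close> the
  operator is the identity, to match \<open>U n\<close>.\<close>

definition mat_op :: "nat \<Rightarrow> (nat \<Rightarrow> 'n) \<Rightarrow> 'k::field^'n^'n \<Rightarrow> (nat \<Rightarrow> 'k) \<Rightarrow> nat \<Rightarrow> 'k" where
  "mat_op n e M x = (\<lambda>i. if i < n then \<Sum>j<n. M $ e i $ e j * x j else x i)"

lemma mat_op_mult:
  fixes A B :: "'k::field^'n::finite^'n"
  assumes e: "bij_betw e {..<n} (UNIV :: 'n set)"
  shows "mat_op n e (A ** B) = mat_op n e A \<circ> mat_op n e B"
proof (intro ext)
  fix x i
  show "mat_op n e (A ** B) x i = (mat_op n e A \<circ> mat_op n e B) x i"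
  proof (cases "i < n")
    case True
    have "(\<Sum>j<n. (A ** B) $ e i $ e j * x j) = (\<Sum>j<n. \<Sum>k<n. A $ e i $ e k * B $ e k $ e j * x j)"
      unfolding matrix_matrix_mult_def by (simp add: sum_distrib_right sum.reindex_bij_betw[OF e, symmetric])
    also have "\<dots> = (\<Sum>k<n. A $ e i $ e k * (\<Sum>j<n. B $ e k $ e j * x j))"
      by (subst sum.swap) (simp add: sum_distrib_left mult.assoc)
    finally show ?thesis using True by (simp add: mat_op_def)
  qed (simp add: mat_op_def)
qed

lemma mat_op_1:
  assumes e: "bij_betw e {..<n} (UNIV :: 'n::finite set)"
  shows "mat_op n e (mat 1 :: 'k::field^'n^'n) = id"
proof (intro ext)
  fix x i
  have "(\<Sum>j<n. (mat 1 :: 'k^'n^'n) $ e i $ e j * x j) = x i" if i: "i < n"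
  proof -
    have "(\<Sum>j<n. (mat 1 :: 'k^'n^'n) $ e i $ e j * x j) = (\<Sum>j<n. (if i = j then 1 else 0) * x j)"
      using bij_betw_imp_inj_on[OF e] i by (intro sum.cong refl) (auto simp: mat_def inj_on_def)
    then show ?thesis using i by (simp add: sum_delta_mult)
  qed
  then show "mat_op n e (mat 1 :: 'k^'n^'n) x i = id x i" by (simp add: mat_op_def)
qed

lemma mat_op_pow:
  fixes M :: "'k::field^'n::finite^'n"
  assumes "bij_betw e {..<n} (UNIV :: 'n set)"
  shows "mat_op n e (matrix_pow M l) = mat_op n e M ^^ l"
  by (induction l) (simp_all add: mat_op_1[OF assms] mat_op_mult[OF assms])

lemma mat_op_ax: "i < n \<Longrightarrow> j < n \<Longrightarrow> mat_op n e M (ax j) i = M $ e i $ e j"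
  by (simp add: mat_op_def ax_apply if_distrib[of "(*) _"] cong: if_cong)

lemma trU_mat_op:
  fixes M :: "'k::field^'n::finite^'n"
  assumes "bij_betw e {..<n} (UNIV :: 'n set)"
  shows "trU n (mat_op n e M) = trace M"
proof -
  have "trU n (mat_op n e M) = (\<Sum>i<n. M $ e i $ e i)" unfolding trU_def by (intro sum.cong refl) (simp add: mat_op_ax)
  also have "\<dots> = trace M" unfolding trace_def by (rule sum.reindex_bij_betw[OF assms])
  finally show ?thesis .
qed

lemma lin_mat_op: "lin (mat_op n e M)"
  by (auto simp: lin_def mat_op_def fun_eq_iff algebra_simps sum.distrib sum_distrib_left)

context hermitian_field
begin

lemma mat_op_isometry:
  fixes M :: "'a^'n::finite^'n"
  assumes e: "bij_betw e {..<n} (UNIV :: 'n set)"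
  shows "M ** conj_transpose q M = mat 1 \<longleftrightarrow> (\<forall>x y. ip n (mat_op n e M x) (mat_op n e M y) = ip n x y)"
proof -
  have gram: "(conj_transpose q M ** M) $ e i $ e j = ip n (mat_op n e M (ax i)) (mat_op n e M (ax j))" if "i < n" "j < n" for i j
  proof -
    have "(conj_transpose q M ** M) $ e i $ e j = (\<Sum>k<n. cj (M $ e k $ e i) * M $ e k $ e j)"
      unfolding matrix_matrix_mult_def conj_transpose_def
      by (simp add: sum.reindex_bij_betw[OF e, symmetric] cj_def)
    also have "\<dots> = ip n (mat_op n e M (ax i)) (mat_op n e M (ax j))"
      unfolding ip_def using that by (intro sum.cong refl) (simp add: mat_op_ax)
    finally show ?thesis .
  qed
  have inj: "e i = e j \<longleftrightarrow> i = j" if "i < n" "j < n" for i j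
    using bij_betw_imp_inj_on[OF e] that by (auto simp: inj_on_def)
  have ax: "ip n (ax i) (ax j) = (if i = j then 1 else 0)" if "i < n" "j < n" for i j
    using that by (simp add: ip_ax_left ax_apply)
  \<comment> \<open>The Gram matrix of the columns is the product in the other order; for square
    matrices both orders are equivalent.\<close>
  have "M ** conj_transpose q M = mat 1 \<longleftrightarrow> conj_transpose q M ** M = mat 1"
    by (rule matrix_left_right_inverse)
  also have "\<dots> \<longleftrightarrow> (\<forall>x y. ip n (mat_op n e M x) (mat_op n e M y) = ip n x y)"
  proof
    assume M: "conj_transpose q M ** M = mat 1"
    have g: "ip n (mat_op n e M (ax i)) (mat_op n e M (ax j)) = ip n (ax i) (ax j)" if "i < n" "j < n" for i j
      using gram[OF that] that by (simp add: M mat_def inj ax)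
    have "ip n (mat_op n e M x) (mat_op n e M y) = ip n x y" for x y
    proof -
      have red: "ip n (mat_op n e M x) z = ip n (mat_op n e M (tr n x)) z" for x z
        unfolding ip_def by (intro sum.cong refl) (simp add: mat_op_def tr_def)
      have red': "ip n z (mat_op n e M y) = ip n z (mat_op n e M (tr n y))" for y z
        unfolding ip_def by (intro sum.cong refl) (simp add: mat_op_def tr_def)
      have exp: "tr n x = (\<Sum>i<n. smul (x i) (ax i))" for x :: "nat \<Rightarrow> 'a"
        by (subst V_expand[OF tr_in_V]) (intro sum.cong refl, simp add: tr_def)
      have "ip n (mat_op n e M x) (mat_op n e M y) = ip n (mat_op n e M (tr n x)) (mat_op n e M (tr n y))"
        using red red' by metis
      also have "\<dots> = (\<Sum>i<n. \<Sum>j<n. cj (x i) * y j * ip n (mat_op n e M (ax i)) (mat_op n e M (ax j)))"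
        unfolding exp lin_comb[OF lin_mat_op] by (rule ip_comb)
      also have "\<dots> = (\<Sum>i<n. \<Sum>j<n. cj (x i) * y j * ip n (ax i) (ax j))"
        by (intro sum.cong refl) (simp add: g)
      also have "\<dots> = ip n (tr n x) (tr n y)" unfolding exp by (rule ip_comb[symmetric])
      finally show ?thesis by (simp only: ip_tr)
    qed
    then show "\<forall>x y. ip n (mat_op n e M x) (mat_op n e M y) = ip n x y" by blast
  next
    assume iso: "\<forall>x y. ip n (mat_op n e M x) (mat_op n e M y) = ip n x y"
    show "conj_transpose q M ** M = mat 1"
      unfolding vec_eq_iff
    proof (intro allI)
      fix a b :: 'n
      obtain i j where ij: "i < n" "j < n" "a = e i" "b = e j"
        using bij_betw_imp_surj_on[OF e] by (metis UNIV_I imageE lessThan_iff)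
      have "(conj_transpose q M ** M) $ a $ b = ip n (ax i) (ax j)"
        unfolding ij(3,4) gram[OF ij(1,2)] using iso by blast
      then show "(conj_transpose q M ** M) $ a $ b = mat 1 $ a $ b"
        using ij by (simp add: ax mat_def inj)
    qed
  qed
  finally show ?thesis .
qed

lemma bij_betw_unitary_group:
  assumes e: "bij_betw e {..<n} (UNIV :: 'n::finite set)"
  shows "bij_betw (mat_op n e) (unitary_group q :: ('a^'n^'n) set) (U n)"
proof (rule bij_betw_imageI)
  show "inj_on (mat_op n e) (unitary_group q :: ('a^'n^'n) set)"
  proof (rule inj_onI)
    fix A B :: "'a^'n^'n" assume AB: "mat_op n e A = mat_op n e B"
    show "A = B"
      unfolding vec_eq_iff
    proof (intro allI)
      fix a b :: 'n
      obtain i j where ij: "i < n" "j < n" "a = e i" "b = e j"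
        using bij_betw_imp_surj_on[OF e] by (metis UNIV_I imageE lessThan_iff)
      show "A $ a $ b = B $ a $ b" unfolding ij(3,4) mat_op_ax[OF ij(1,2), symmetric] AB ..
    qed
  qed
  have U_iff: "mat_op n e M \<in> U n \<longleftrightarrow> M ** conj_transpose q M = mat 1" for M :: "'a^'n^'n"
  proof -
    have "mat_op n e M x \<in> V n" if "x \<in> V n" for x using that by (auto simp: V_def mat_op_def)
    moreover have "mat_op n e M x = x" if x: "tr n x = 0" for x
    proof
      fix i
      have "x j = 0" if "j < n" for j using fun_cong[OF x, of j] that by (simp add: tr_def)
      then show "mat_op n e M x i = x i" by (simp add: mat_op_def)
    qed
    ultimately show ?thesis unfolding mat_op_isometry[OF e] U_def using lin_mat_op[of n e M] by blast
  qed
  have group: "M \<in> unitary_group q \<longleftrightarrow> M ** conj_transpose q M = mat 1" for M :: "'a^'n^'n"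
    unfolding unitary_group_def by (auto simp: invertible_right_inverse)
  show "mat_op n e ` (unitary_group q :: ('a^'n^'n) set) = U n"
  proof (intro equalityI subsetI)
    fix f assume f: "f \<in> U n"
    define M :: "'a^'n^'n" where "M = (\<chi> a b. f (ax (the_inv_into {..<n} e b)) (the_inv_into {..<n} e a))"
    have Mij: "M $ e i $ e j = f (ax j) i" if "i < n" "j < n" for i j
      using that by (simp add: M_def the_inv_into_f_f[OF bij_betw_imp_inj_on[OF e]])
    have "mat_op n e M = f"
    proof (intro ext)
      fix x i
      show "mat_op n e M x i = f x i"
      proof (cases "i < n")
        case True
        have "f (tr n x) = (\<Sum>j<n. smul (tr n x j) (f (ax j)))"
          by (subst V_expand[OF tr_in_V[of n x]]) (rule lin_comb[OF U_lin[OF f]])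
        then have "f (tr n x) i = (\<Sum>j<n. M $ e i $ e j * x j)"
          using True by (simp add: Mij tr_def mult.commute)
        moreover have "f x i = f (tr n x) i" using fun_cong[OF U_split[OF f, of x], of i] True by (simp add: tr_def)
        ultimately show ?thesis using True by (simp add: mat_op_def)
      next
        case False
        have "f (tr n x) i = 0" using V_D[OF U_V[OF f tr_in_V]] False by simp
        then have "f x i = x i" using fun_cong[OF U_split[OF f, of x], of i] False by (simp add: tr_def)
        then show ?thesis using False by (simp add: mat_op_def)
      qed
    qed
    then show "f \<in> mat_op n e ` (unitary_group q :: ('a^'n^'n) set)"
      using f U_iff[of M] group[of M] by (intro image_eqI[of _ _ M]) auto
  qed (use U_iff group in auto)
qed

end

theorem theorem1p4:
  fixes p r q n k :: nat
    and b :: "nat \<Rightarrow> nat"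
    and a :: "nat \<Rightarrow> 'a::{finite,field}"
  assumes "prime p" and "r \<ge> 1" and "q = p ^ r"
    and "CARD('a) = q ^ 2"
    and "CARD('n::finite) = n" and "n \<ge> 1"
    and "k \<ge> 1"
    and "strict_mono_on {1..k} b"
    and "\<forall>i\<in>{1..k}. b i > 0 \<and> coprime (b i) p"
  shows "\<bar>real (card {M \<in> (unitary_group q :: ('a^'n^'n) set).
                 \<forall>i\<in>{1..k}. trace (matrix_pow M (b i)) = a i})
           / real (card (unitary_group q :: ('a^'n^'n) set))
         - 1 / (real q ^ 2) ^ k\<bar>
    \<le> real q powr (- (real n ^ 2 / (4 * real (b k)))) * real q powr (real n / 2)
       * (1 + 1 / (real q - 1)) ^ n * real ((n - 1 + 2 * b k) choose n)"
proof -
  interpret hermitian_field p r q "TYPE('a)"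
    by unfold_locales (use assms in auto)
  obtain e :: "nat \<Rightarrow> 'n" where e: "bij_betw e {..<n} UNIV"
    using ex_bij_betw_nat_finite[of "UNIV :: 'n set"] assms(5) by (auto simp: atLeast0LessThan)
  note bij = bij_betw_unitary_group[OF e]
  let ?G = "unitary_group q :: ('a^'n^'n) set"
  have tr: "trU n (mat_op n e M ^^ l) = trace (matrix_pow M l)" for M :: "'a^'n^'n" and l
    by (simp only: mat_op_pow[OF e, symmetric] trU_mat_op[OF e])
  have "bij_betw (mat_op n e) {M \<in> ?G. \<forall>i\<in>{1..k}. trace (matrix_pow M (b i)) = a i}
      {f \<in> U n. \<forall>i\<in>{1..k}. trU n (f ^^ b i) = a i}"
    using bij unfolding bij_betw_def by (auto simp: tr[symmetric] intro: inj_on_subset)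
  then have c1: "card {M \<in> ?G. \<forall>i\<in>{1..k}. trace (matrix_pow M (b i)) = a i}
      = card {f \<in> U n. \<forall>i\<in>{1..k}. trU n (f ^^ b i) = a i}" by (rule bij_betw_same_card)
  have c2: "card ?G = card (U n)" by (rule bij_betw_same_card[OF bij])
  have "1 \<le> b i \<and> coprime (b i) p" if "i \<in> {1..k}" for i using assms(9) that by (simp add: Suc_leI)
  then have "\<bar>real (card {M \<in> ?G. \<forall>i\<in>{1..k}. trace (matrix_pow M (b i)) = a i}) / real (card ?G) - 1 / (real q ^ 2) ^ k\<bar>
    \<le> deviation_bound (real q) n (b k)"
    unfolding c1 c2 by (rule trace_equidistribution[OF assms(7,8)])
  also have "b k > 0" using assms(7,9) by simp
  \<comment> \<open>Positivity of \<open>n\<close> and of \<open>b k\<close> reconciles the two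
    truncated subtractions.\<close>
  then have "n + (2 * b k - 1) = n - 1 + 2 * b k" using assms(6) by simp
  then have "deviation_bound (real q) n (b k) = real q powr (- (real n ^ 2 / (4 * real (b k)))) * real q powr (real n / 2)
       * (1 + 1 / (real q - 1)) ^ n * real ((n - 1 + 2 * b k) choose n)"
    unfolding deviation_bound_def by (simp add: powr_add[symmetric])
  finally show ?thesis .
qed

end
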